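(* Let $W\subset\mathrm{GL}(V)$ be a Coxeter group, $S=\mathbb{C}[V]$, $R=S^W$, and let $\circ$ be the Frobenius (Dubrovin) multiplication on $\mathrm{Der}_R$. Let $tp\colon\mathrm{Der}_S\to\mathrm{Der}_R\otimes_RS$ be the tangent map of $p\colon V\to V/W$ and let $\omega p\colon \mathrm{Der}_R\to\mathrm{Der}_R\otimes_RS$, $\chi\mapsto\chi\otimes1$. (a) The multiplication $\circ$ on $\mathrm{Der}_R$ can be lifted to $\mathrm{Der}_S$, though without multiplicative unit. That is, there is an $S$-bilinear commutative associative multiplication $\circ$ on $\mathrm{Der}_S$, having no unit element, such that $tp(\eta_1\circ\eta_2)=\omega p(\chi_1\circ\chi_2)$ whenever $\eta_i\in\mathrm{Der}_S$ is a lift of $\chi_i\in\mathrm{Der}_R$ for $i=1,2$. (b) In the same way $\mathrm{Der}_S$ becomes a module over the ring $(\mathrm{Der}_R,\circ)$. That is, there is a module structure $(\chi,\eta)\mapsto\chi\cdot\eta$, $R$-linear in $\chi$ and $S$-linear in $\eta$, such that $tp(\chi\cdot\eta)=\omega p(\chi\circ\xi)$ whenever $\chi\in\mathrm{Der}_R$ and $\eta\in\mathrm{Der}_S$ is a lift of $\xi\in\mathrm{Der}_R$. (c) The map $tp$ is $\mathrm{Der}_R$-linear with respect to the structure in (b) and the Frobenius multiplication induced on $\mathrm{Der}_R\otimes_RS$: $tp(\chi\cdot\eta)=(\chi\otimes1)\circ tp(\eta)$ for all $\chi\in\mathrm{Der}_R$, $\eta\in\mathrm{Der}_S$.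
   Context: A Coxeter group is a finite group $W\subset\mathrm{GL}(V)$ generated by reflections defined over $\mathbb{R}$, where $V=V_{\mathbb R}\otimes_{\mathbb R}\mathbb{C}\ne0$, with $V^W=0$. Let $\ell=\dim V$, $S=\mathbb{C}[V]=\mathbb{C}[x_1,\dots,x_\ell]$, and $R=S^W=\mathbb{C}[p_1,\dots,p_\ell]$ with $p_i$ homogeneous basic invariants. Let $p\colon V=\operatorname{Spec}S\to\operatorname{Spec}R=V/W$ be the quotient map. $\mathrm{Der}_S$ and $\mathrm{Der}_R$ are the modules of $\mathbb{C}$-derivations (vector fields) of $S$ and $R$. The tangent map is $tp(\sum_j\eta_j\partial_{x_j})=\sum_{i,j}\eta_j\,\partial_{x_j}(p_i)\,\partial_{p_i}$. We say $\eta\in\mathrm{Der}_S$ is a lift of $\chi\in\mathrm{Der}_R$ if $tp(\eta)=\omega p(\chi)$. The multiplication on $\mathrm{Der}_R\otimes_RS$ is the $S$-bilinear extension of $\circ$. Frobenius multiplication. Let $W$ be irreducible, with $\deg p_1\le\dots\le\deg p_\ell=h$ ($h$ the Coxeter number), and choose coordinates $x_i$ orthonormal for the $W$-invariant inner product. Define the symmetric form $g^*$ on $\Omega^1_R$ by $g^*(dp_i,dp_j)=\sum_k\partial_{x_k}(p_i)\partial_{x_k}(p_j)\in R$. Let $e=\partial_{p_\ell}$ and $E=\frac1h\sum_i\deg(p_i)\,p_i\,\partial_{p_i}$. By K. Saito, the form $\eta^*=\mathrm{Lie}_e\,g^*$, i.e. $\eta^*(dp_i,dp_j)=\partial_{p_\ell}(g^*(dp_i,dp_j))$,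 is nondegenerate and its dual metric $\eta$ on $\mathrm{Der}_R$ is flat. By Dubrovin there is a unique $R$-bilinear commutative associative multiplication $\circ$ on $\mathrm{Der}_R$ with unit $e$ making $V/W$ a Frobenius manifold with metric $\eta$, unit field $e$, Euler field $E$ and intersection form $g^*$. This means: $\eta(X\circ Y,Z)=\eta(X,Y\circ Z)$; the tensor $(\nabla_X c)(Y,Z,T)$, with $c(Y,Z,T)=\eta(Y\circ Z,T)$ and $\nabla$ the Levi-Civita connection of $\eta$, is totally symmetric; $\mathrm{Lie}_E(\circ)=\circ$; and $g^*(\alpha,\beta)=\langle\alpha\circ\beta,E\rangle$ for $\alpha,\beta\in\Omega^1_R$, where $\circ$ is transported to $\Omega^1_R$ via $\eta$. For reducible $W$, $V/W$ carries the product multiplication (direct product of the structures of the irreducible summands). *)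

theory Defs
  imports
    "HOL-Analysis.Analysis"
    "HOL-Library.Poly_Mapping"
    "HOL-Library.Function_Algebras"
begin

section \<open>Polynomials\<close>

text \<open>
  The space \<open>V\<^sub>\<real>\<close> is \<^typ>\<open>real^'n\<close>, so the rank is the (nonzero) cardinality of the index
  type \<open>'n\<close>. The ring \<open>S\<close> of complex polynomials on \<open>V = V\<^sub>\<real> \<otimes> \<complex>\<close> is the type below: a
  polynomial is a finitely supported map from exponent vectors to coefficients. All subrings
  of \<open>S\<close> occurring here (such as the invariants) are sets of such polynomials.
\<close>

type_synonym 'n cpoly = "('n \<Rightarrow>\<^sub>0 nat) \<Rightarrow>\<^sub>0 complex"

definition cnst :: "complex \<Rightarrow> 'n cpoly" where
  "cnst c = Poly_Mapping.single 0 c"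

definition var :: "'n \<Rightarrow> 'n cpoly" where
  "var j = Poly_Mapping.single (Poly_Mapping.single j 1) 1"

definition mon_deg :: "('n::finite \<Rightarrow>\<^sub>0 nat) \<Rightarrow> nat" where
  "mon_deg m = (\<Sum>i\<in>UNIV. Poly_Mapping.lookup m i)"

definition deg :: "'n::finite cpoly \<Rightarrow> nat" where
  "deg f = Max (insert 0 (mon_deg ` Poly_Mapping.keys f))"

definition homogeneous :: "'n::finite cpoly \<Rightarrow> bool" where
  "homogeneous f \<longleftrightarrow> (\<forall>m\<in>Poly_Mapping.keys f. mon_deg m = deg f)"

text \<open>Partial derivative; the truncated subtraction of exponents only matters for terms whose
  coefficient is 0.\<close>

definition pd :: "'n \<Rightarrow> 'n cpoly \<Rightarrow> 'n cpoly" where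
  "pd j f = (\<Sum>m\<in>Poly_Mapping.keys f.
     Poly_Mapping.single (m - Poly_Mapping.single j 1)
       (of_nat (Poly_Mapping.lookup m j) * Poly_Mapping.lookup f m))"

text \<open>\<open>dirder v\<close> is the derivative in the direction of the vector \<open>v\<close>.\<close>

definition dirder :: "real^'n::finite \<Rightarrow> 'n cpoly \<Rightarrow> 'n cpoly" where
  "dirder v f = (\<Sum>j\<in>UNIV. cnst (complex_of_real (v $ j)) * pd j f)"

text \<open>\<open>subst p q\<close> is \<open>q(p\<^sub>1, \<dots>, p\<^sub>l)\<close>.\<close>

definition subst :: "('n::finite \<Rightarrow> 'n cpoly) \<Rightarrow> 'n cpoly \<Rightarrow> 'n cpoly" where
  "subst p q = (\<Sum>m\<in>Poly_Mapping.keys q.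
     cnst (Poly_Mapping.lookup q m) * (\<Prod>i\<in>UNIV. p i ^ Poly_Mapping.lookup m i))"

text \<open>\<open>pullback A f\<close> is the polynomial \<open>x \<mapsto> f (A x)\<close>.\<close>

definition pullback :: "real^'n^'n \<Rightarrow> 'n::finite cpoly \<Rightarrow> 'n cpoly" where
  "pullback A = subst (\<lambda>i. \<Sum>j\<in>UNIV. cnst (complex_of_real (A $ i $ j)) * var j)"

section \<open>Coxeter groups and their invariants\<close>

definition reflection :: "real^'n^'n::finite \<Rightarrow> bool" where
  "reflection s \<longleftrightarrow> s ** s = mat 1 \<and> dim {v. s *v v = v} + 1 = CARD('n)"

text \<open>For a set of involutions, the generated monoid is the generated group.\<close>

inductive_set generated :: "(real^'n^'n::finite) set \<Rightarrow> (real^'n^'n) set"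
  for T :: "(real^'n^'n) set"
where
  one: "mat 1 \<in> generated T"
| mult: "s \<in> T \<Longrightarrow> w \<in> generated T \<Longrightarrow> s ** w \<in> generated T"

text \<open>Being defined over the reals, the group is given by real matrices, which act on \<open>V\<close> by
  extension of scalars; accordingly \<open>V\<^sup>W = 0\<close> is expressed on \<open>V\<^sub>\<real>\<close>.\<close>

definition coxeter_group :: "(real^'n^'n::finite) set \<Rightarrow> bool" where
  "coxeter_group W \<longleftrightarrow>
     finite W \<and> W = generated {s \<in> W. reflection s} \<and>
     (\<forall>v. (\<forall>w\<in>W. w *v v = v) \<longrightarrow> v = 0)"

definition invariants :: "(real^'n^'n) set \<Rightarrow> 'n::finite cpoly set" where
  "invariants W = {f. \<forall>w\<in>W. pullback w f = f}"

text \<open>Surjectivity in \<^const>\<open>bij_betw\<close> says that the \<open>p i\<close> generate the invariant ring,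
  injectivity that they are algebraically independent.\<close>

definition basic_invariants :: "(real^'n^'n) set \<Rightarrow> ('n::finite \<Rightarrow> 'n cpoly) \<Rightarrow> bool" where
  "basic_invariants W p \<longleftrightarrow>
     (\<forall>i. homogeneous (p i)) \<and> bij_betw (subst p) UNIV (invariants W)"

definition invariant_inner_product ::
    "(real^'n^'n) set \<Rightarrow> (real^'n::finite \<Rightarrow> real^'n \<Rightarrow> real) \<Rightarrow> bool" where
  "invariant_inner_product W B \<longleftrightarrow>
     (\<forall>x. linear (B x)) \<and> (\<forall>x y. B x y = B y x) \<and> (\<forall>x. x \<noteq> 0 \<longrightarrow> B x x > 0) \<and>
     (\<forall>w\<in>W. \<forall>x y. B (w *v x) (w *v y) = B x y)"

definition orthonormal ::
    "(real^'n::finite \<Rightarrow> real^'n \<Rightarrow> real) \<Rightarrow> ('n \<Rightarrow> real^'n) \<Rightarrow> bool" where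
  "orthonormal B u \<longleftrightarrow> (\<forall>i j. B (u i) (u j) = (if i = j then 1 else 0))"

section \<open>Vector fields\<close>

type_synonym 'n vfield = "'n cpoly \<Rightarrow> 'n cpoly"

text \<open>The \<open>\<complex>\<close>-derivations of a subalgebra \<open>A\<close> of \<open>S\<close> are represented by functions on all of
  \<open>S\<close> that vanish outside \<open>A\<close>. Derivations are added pointwise.\<close>

definition Der :: "'n cpoly set \<Rightarrow> 'n vfield set" where
  "Der A = {D.
     (\<forall>f\<in>A. D f \<in> A) \<and> (\<forall>f. f \<notin> A \<longrightarrow> D f = 0) \<and>
     (\<forall>f\<in>A. \<forall>g\<in>A. D (f + g) = D f + D g) \<and>
     (\<forall>c. \<forall>f\<in>A. D (cnst c * f) = cnst c * D f) \<and>
     (\<forall>f\<in>A. \<forall>g\<in>A. D (f * g) = D f * g + f * D g)}"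

abbreviation DerS :: "'n vfield set" where
  "DerS \<equiv> Der UNIV"

abbreviation DerR :: "(real^'n^'n) set \<Rightarrow> 'n::finite vfield set" where
  "DerR W \<equiv> Der (invariants W)"

definition smul :: "'n cpoly \<Rightarrow> 'n vfield \<Rightarrow> 'n vfield" (infixr "\<odot>" 75) where
  "s \<odot> X = (\<lambda>f. s * X f)"

definition bracket :: "'n vfield \<Rightarrow> 'n vfield \<Rightarrow> 'n vfield" where
  "bracket X Y = (\<lambda>f. X (Y f) - Y (X f))"

definition linear_on ::
    "'n cpoly set \<Rightarrow> 'n vfield set \<Rightarrow> 'n vfield set \<Rightarrow> ('n vfield \<Rightarrow> 'n vfield) \<Rightarrow> bool" where
  "linear_on A M N F \<longleftrightarrow>
     (\<forall>X\<in>M. F X \<in> N) \<and> (\<forall>X\<in>M. \<forall>Y\<in>M. F (X + Y) = F X + F Y) \<and>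
     (\<forall>a\<in>A. \<forall>X\<in>M. F (a \<odot> X) = a \<odot> F X)"

text \<open>Linear over \<open>A\<close> in the first argument (from \<open>M\<close>) and over \<open>A'\<close> in the second
  (from \<open>M'\<close>), with values in \<open>N\<close>.\<close>

definition bilinear_on ::
    "'n cpoly set \<Rightarrow> 'n vfield set \<Rightarrow> 'n cpoly set \<Rightarrow> 'n vfield set \<Rightarrow> 'n vfield set
     \<Rightarrow> ('n vfield \<Rightarrow> 'n vfield \<Rightarrow> 'n vfield) \<Rightarrow> bool" where
  "bilinear_on A M A' M' N F \<longleftrightarrow>
     (\<forall>Y\<in>M'. linear_on A M N (\<lambda>X. F X Y)) \<and> (\<forall>X\<in>M. linear_on A' M' N (F X))"

definition commutative_on :: "'n vfield set \<Rightarrow> ('n vfield \<Rightarrow> 'n vfield \<Rightarrow> 'n vfield) \<Rightarrow> bool" where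
  "commutative_on M F \<longleftrightarrow> (\<forall>X\<in>M. \<forall>Y\<in>M. F X Y = F Y X)"

definition associative_on :: "'n vfield set \<Rightarrow> ('n vfield \<Rightarrow> 'n vfield \<Rightarrow> 'n vfield) \<Rightarrow> bool" where
  "associative_on M F \<longleftrightarrow> (\<forall>X\<in>M. \<forall>Y\<in>M. \<forall>Z\<in>M. F (F X Y) Z = F X (F Y Z))"

definition is_unit_on ::
    "'n vfield set \<Rightarrow> ('n vfield \<Rightarrow> 'n vfield \<Rightarrow> 'n vfield) \<Rightarrow> 'n vfield \<Rightarrow> bool" where
  "is_unit_on M F \<epsilon> \<longleftrightarrow> \<epsilon> \<in> M \<and> (\<forall>X\<in>M. F \<epsilon> X = X \<and> F X \<epsilon> = X)"

text \<open>\<open>\<partial>/\<partial>p\<^sub>i\<close> as a derivation of \<open>A\<close>, where the \<open>p i\<close> are algebraically independent and \<open>A\<close> is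
  the subalgebra generated by some of them: write \<open>f = q(p)\<close>, differentiate \<open>q\<close>, substitute.\<close>

definition coord_field :: "('n::finite \<Rightarrow> 'n cpoly) \<Rightarrow> 'n cpoly set \<Rightarrow> 'n \<Rightarrow> 'n vfield" where
  "coord_field p A i = (\<lambda>f. if f \<in> A then subst p (pd i (inv (subst p) f)) else 0)"

section \<open>Frobenius manifolds\<close>

text \<open>Levi-Civita connection of the metric \<open>\<eta>\<close> on \<open>Der A\<close>.\<close>

definition levi_civita ::
    "'n cpoly set \<Rightarrow> ('n vfield \<Rightarrow> 'n vfield \<Rightarrow> 'n cpoly)
     \<Rightarrow> ('n vfield \<Rightarrow> 'n vfield \<Rightarrow> 'n vfield) \<Rightarrow> bool" where
  "levi_civita A \<eta> nabla \<longleftrightarrow>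
     (\<forall>Y\<in>Der A. linear_on A (Der A) (Der A) (\<lambda>X. nabla X Y)) \<and>
     (\<forall>X\<in>Der A. \<forall>Y\<in>Der A. \<forall>Z\<in>Der A. nabla X (Y + Z) = nabla X Y + nabla X Z) \<and>
     (\<forall>X\<in>Der A. \<forall>Y\<in>Der A. \<forall>a\<in>A. nabla X (a \<odot> Y) = X a \<odot> Y + a \<odot> nabla X Y) \<and>
     (\<forall>X\<in>Der A. \<forall>Y\<in>Der A. nabla X Y - nabla Y X = bracket X Y) \<and>
     (\<forall>X\<in>Der A. \<forall>Y\<in>Der A. \<forall>Z\<in>Der A.
        X (\<eta> Y Z) = \<eta> (nabla X Y) Z + \<eta> Y (nabla X Z))"

definition flat :: "'n cpoly set \<Rightarrow> ('n vfield \<Rightarrow> 'n vfield \<Rightarrow> 'n vfield) \<Rightarrow> bool" where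
  "flat A nabla \<longleftrightarrow> (\<forall>X\<in>Der A. \<forall>Y\<in>Der A. \<forall>Z\<in>Der A.
     nabla X (nabla Y Z) - nabla Y (nabla X Z) - nabla (bracket X Y) Z = 0)"

text \<open>\<open>(\<nabla>\<^sub>X c)(Y, Z, T)\<close> for \<open>c(Y, Z, T) = \<eta>(Y \<circ> Z, T)\<close>.\<close>

definition nabla_c ::
    "('n vfield \<Rightarrow> 'n vfield \<Rightarrow> 'n cpoly) \<Rightarrow> ('n vfield \<Rightarrow> 'n vfield \<Rightarrow> 'n vfield)
     \<Rightarrow> ('n vfield \<Rightarrow> 'n vfield \<Rightarrow> 'n vfield)
     \<Rightarrow> 'n vfield \<Rightarrow> 'n vfield \<Rightarrow> 'n vfield \<Rightarrow> 'n vfield \<Rightarrow> 'n cpoly" where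
  "nabla_c \<eta> nabla mul X Y Z T =
     X (\<eta> (mul Y Z) T) - \<eta> (mul (nabla X Y) Z) T - \<eta> (mul Y (nabla X Z)) T
       - \<eta> (mul Y Z) (nabla X T)"

definition frobenius_manifold ::
    "'n cpoly set \<Rightarrow> ('n vfield \<Rightarrow> 'n vfield \<Rightarrow> 'n cpoly)
     \<Rightarrow> ('n vfield \<Rightarrow> 'n vfield \<Rightarrow> 'n vfield) \<Rightarrow> 'n vfield \<Rightarrow> 'n vfield \<Rightarrow> bool" where
  "frobenius_manifold A \<eta> mul e E \<longleftrightarrow>
     bilinear_on A (Der A) A (Der A) (Der A) mul \<and>
     commutative_on (Der A) mul \<and> associative_on (Der A) mul \<and> is_unit_on (Der A) mul e \<and>
     (\<forall>X\<in>Der A. \<forall>Y\<in>Der A. \<forall>Z\<in>Der A. \<eta> (mul X Y) Z = \<eta> X (mul Y Z)) \<and>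
     (\<exists>nabla. levi_civita A \<eta> nabla \<and> flat A nabla \<and>
        (\<forall>X\<in>Der A. \<forall>Y\<in>Der A. \<forall>Z\<in>Der A. \<forall>T\<in>Der A.
           nabla_c \<eta> nabla mul X Y Z T = nabla_c \<eta> nabla mul Y X Z T \<and>
           nabla_c \<eta> nabla mul X Y Z T = nabla_c \<eta> nabla mul X Z Y T \<and>
           nabla_c \<eta> nabla mul X Y Z T = nabla_c \<eta> nabla mul X Y T Z)) \<and>
     (\<forall>X\<in>Der A. \<forall>Y\<in>Der A.
        bracket E (mul X Y) - mul (bracket E X) Y - mul X (bracket E Y) = mul X Y)"

section \<open>The Frobenius multiplication of an irreducible Coxeter group\<close>

text \<open>
  In this section \<open>A\<close> is the polynomial algebra generated by the algebraically independent
  homogeneous \<open>p i\<close>, \<open>i \<in> I\<close>, and \<open>u\<close> is an orthonormal basis of \<open>V\<^sub>\<real>\<close>. For irreducible \<open>W\<close> one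
  has \<open>A = invariants W\<close> and \<open>I = UNIV\<close>; the extra generality is used for the irreducible
  summands of a reducible group.
\<close>

text \<open>\<open>g\<^sup>*(dp\<^sub>i, dp\<^sub>j)\<close>. The partial derivatives with respect to the orthonormal coordinates are the
  derivatives in the directions of the orthonormal basis \<open>u\<close>.\<close>

definition gstar :: "('n \<Rightarrow> real^'n) \<Rightarrow> ('n \<Rightarrow> 'n cpoly) \<Rightarrow> 'n \<Rightarrow> 'n \<Rightarrow> 'n::finite cpoly" where
  "gstar u p i j = (\<Sum>k\<in>UNIV. dirder (u k) (p i) * dirder (u k) (p j))"

text \<open>\<open>\<eta>\<^sup>*(dp\<^sub>i, dp\<^sub>j)\<close> for \<open>e = \<partial>/\<partial>p\<^sub>m\<close>.\<close>

definition etastar ::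
    "('n \<Rightarrow> real^'n) \<Rightarrow> ('n \<Rightarrow> 'n cpoly) \<Rightarrow> 'n cpoly set \<Rightarrow> 'n \<Rightarrow> 'n \<Rightarrow> 'n \<Rightarrow> 'n::finite cpoly" where
  "etastar u p A m i j = coord_field p A m (gstar u p i j)"

text \<open>\<open>H\<close> is the inverse over \<open>A\<close> of the \<open>I \<times> I\<close> matrix \<open>G\<close>. It exists iff the form with Gram
  matrix \<open>G\<close> is nondegenerate, and is then the Gram matrix of the dual form.\<close>

definition inverse_matrix ::
    "'n cpoly set \<Rightarrow> 'n set \<Rightarrow> ('n \<Rightarrow> 'n \<Rightarrow> 'n cpoly) \<Rightarrow> ('n \<Rightarrow> 'n \<Rightarrow> 'n cpoly) \<Rightarrow> bool" where
  "inverse_matrix A I G H \<longleftrightarrow>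
     (\<forall>i\<in>I. \<forall>j\<in>I. H i j \<in> A) \<and>
     (\<forall>i\<in>I. \<forall>k\<in>I. (\<Sum>j\<in>I. G i j * H j k) = (if i = k then 1 else 0)) \<and>
     (\<forall>i\<in>I. \<forall>k\<in>I. (\<Sum>j\<in>I. H i j * G j k) = (if i = k then 1 else 0))"

definition metric ::
    "('n \<Rightarrow> 'n cpoly) \<Rightarrow> 'n set \<Rightarrow> ('n \<Rightarrow> 'n \<Rightarrow> 'n cpoly) \<Rightarrow> 'n vfield \<Rightarrow> 'n vfield \<Rightarrow> 'n cpoly" where
  "metric p I H X Y = (\<Sum>i\<in>I. \<Sum>j\<in>I. X (p i) * Y (p j) * H i j)"

definition euler_field ::
    "('n::finite \<Rightarrow> 'n cpoly) \<Rightarrow> 'n cpoly set \<Rightarrow> 'n set \<Rightarrow> 'n \<Rightarrow> 'n vfield" where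
  "euler_field p A I m =
     (\<Sum>i\<in>I. (cnst (of_nat (deg (p i)) / of_nat (deg (p m))) * p i) \<odot> coord_field p A i)"

text \<open>A 1-form \<open>\<Sum>i\<in>I. \<alpha>\<^sub>i dp\<^sub>i\<close> is represented by its coefficients.\<close>

definition one_forms :: "'n cpoly set \<Rightarrow> 'n set \<Rightarrow> ('n \<Rightarrow> 'n cpoly) set" where
  "one_forms A I = {\<alpha>. (\<forall>i\<in>I. \<alpha> i \<in> A) \<and> (\<forall>i. i \<notin> I \<longrightarrow> \<alpha> i = 0)}"

text \<open>The vector field corresponding under the metric with inverse Gram matrix \<open>G\<close> to the
  1-form \<open>\<alpha>\<close>.\<close>

definition sharp ::
    "('n::finite \<Rightarrow> 'n cpoly) \<Rightarrow> 'n cpoly set \<Rightarrow> 'n set \<Rightarrow> ('n \<Rightarrow> 'n \<Rightarrow> 'n cpoly)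
     \<Rightarrow> ('n \<Rightarrow> 'n cpoly) \<Rightarrow> 'n vfield" where
  "sharp p A I G \<alpha> = (\<Sum>i\<in>I. \<Sum>k\<in>I. (\<alpha> i * G i k) \<odot> coord_field p A k)"

text \<open>
  The index \<open>m\<close> is that of the basic invariant of highest degree (the Coxeter number). Since the
  product on 1-forms is the one on vector fields transported via \<open>\<eta>\<close>, the pairing of
  \<open>\<alpha> \<circ> \<beta>\<close> with \<open>E\<close> is \<open>\<eta>(\<alpha>\<^sup>\<sharp> \<circ> \<beta>\<^sup>\<sharp>, E)\<close>.
\<close>

definition irreducible_frobenius_mult ::
    "'n cpoly set \<Rightarrow> 'n set \<Rightarrow> ('n \<Rightarrow> real^'n) \<Rightarrow> ('n::finite \<Rightarrow> 'n cpoly)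
     \<Rightarrow> ('n vfield \<Rightarrow> 'n vfield \<Rightarrow> 'n vfield) \<Rightarrow> bool" where
  "irreducible_frobenius_mult A I u p mul \<longleftrightarrow>
     (\<exists>m\<in>I. \<exists>H. (\<forall>i\<in>I. deg (p i) \<le> deg (p m)) \<and>
        inverse_matrix A I (etastar u p A m) H \<and>
        frobenius_manifold A (metric p I H) mul (coord_field p A m) (euler_field p A I m) \<and>
        (\<forall>\<alpha>\<in>one_forms A I. \<forall>\<beta>\<in>one_forms A I.
           (\<Sum>i\<in>I. \<Sum>j\<in>I. \<alpha> i * \<beta> j * gstar u p i j) =
           metric p I H
             (mul (sharp p A I (etastar u p A m) \<alpha>) (sharp p A I (etastar u p A m) \<beta>))
             (euler_field p A I m)))"

section \<open>The Frobenius multiplication of a general Coxeter group\<close>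

definition irreducible_summand :: "(real^'n^'n) set \<Rightarrow> (real^'n::finite) set \<Rightarrow> bool" where
  "irreducible_summand W U \<longleftrightarrow>
     subspace U \<and> U \<noteq> {0} \<and> (\<forall>w\<in>W. (*v) w ` U \<subseteq> U) \<and>
     (\<forall>U'. subspace U' \<and> U' \<subseteq> U \<and> (\<forall>w\<in>W. (*v) w ` U' \<subseteq> U') \<longrightarrow> U' = {0} \<or> U' = U)"

text \<open>The polynomial ring on the summand \<open>U\<close>, as the subring of \<open>S\<close> consisting of the pullbacks
  along the orthogonal projection of \<open>V\<^sub>\<real>\<close> onto \<open>U\<close>. For \<open>U = V\<^sub>\<real>\<close> it is all of \<open>S\<close>.\<close>

definition coord_ring ::
    "(real^'n::finite \<Rightarrow> real^'n \<Rightarrow> real) \<Rightarrow> (real^'n) set \<Rightarrow> 'n cpoly set" where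
  "coord_ring B U =
     {pullback P f | P f. range ((*v) P) = U \<and> P ** P = P \<and> (\<forall>x y. B (P *v x) y = B x (P *v y))}"

text \<open>The basic invariants are compatible with the decomposition of \<open>V\<close> into irreducible summands:
  each of them is an invariant of one of the factors of \<open>W\<close>. This is no condition if \<open>W\<close> is
  irreducible.\<close>

definition adapted ::
    "(real^'n^'n) set \<Rightarrow> (real^'n::finite \<Rightarrow> real^'n \<Rightarrow> real) \<Rightarrow> ('n \<Rightarrow> 'n cpoly) \<Rightarrow> bool" where
  "adapted W B p \<longleftrightarrow> (\<forall>i. \<exists>U. irreducible_summand W U \<and> p i \<in> coord_ring B U)"

text \<open>
  The irreducible summands \<open>U\<close> of \<open>V\<^sub>\<real>\<close> are unique and pairwise orthogonal, \<open>W\<close> is the product of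
  Coxeter groups acting on them, and the invariant ring of the factor belonging to \<open>U\<close> is
  \<open>invariants W \<inter> coord_ring B U\<close>, with basic invariants those \<open>p i\<close> contained in it. For these,
  \<^const>\<open>gstar\<close> is the form of the factor, as only directions in \<open>U\<close> contribute. The product
  multiplication is the bilinear one extending the multiplications of the factors (the vector
  field on a factor with components \<open>X (p k)\<close> being regarded as a vector field on the product) and
  vanishing on vector fields from different factors.
\<close>

definition frobenius_mult ::
    "(real^'n^'n) set \<Rightarrow> (real^'n \<Rightarrow> real^'n \<Rightarrow> real) \<Rightarrow> ('n \<Rightarrow> real^'n) \<Rightarrow> ('n::finite \<Rightarrow> 'n cpoly)
     \<Rightarrow> ('n vfield \<Rightarrow> 'n vfield \<Rightarrow> 'n vfield) \<Rightarrow> bool" where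
  "frobenius_mult W B u p mul \<longleftrightarrow>
     (let R = invariants W in
      bilinear_on R (Der R) R (Der R) (Der R) mul \<and>
      (\<forall>U. irreducible_summand W U \<longrightarrow>
        (let A = R \<inter> coord_ring B U; I = {i. p i \<in> coord_ring B U} in
         (\<exists>mulU. irreducible_frobenius_mult A I u p mulU \<and>
           (\<forall>i\<in>I. \<forall>j\<in>I. mul (coord_field p R i) (coord_field p R j) =
              (\<Sum>k\<in>I. mulU (coord_field p A i) (coord_field p A j) (p k) \<odot> coord_field p R k))) \<and>
         (\<forall>i\<in>I. \<forall>j. j \<notin> I \<longrightarrow>
            mul (coord_field p R i) (coord_field p R j) = 0 \<and>
            mul (coord_field p R j) (coord_field p R i) = 0))))"

section \<open>Vector fields along the quotient map\<close>

text \<open>As \<open>Der\<^sub>R\<close> is free on the \<open>\<partial>/\<partial>p\<^sub>i\<close>, the \<open>S\<close>-module \<open>Der\<^sub>R \<otimes>\<^sub>R S\<close> is free on the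
  \<open>\<partial>/\<partial>p\<^sub>i \<otimes> 1\<close>; its elements are represented by their coordinates in this basis.\<close>

definition tangent_map :: "('n \<Rightarrow> 'n cpoly) \<Rightarrow> 'n::finite vfield \<Rightarrow> ('n cpoly)^'n" where
  "tangent_map p X = (\<chi> i. \<Sum>j\<in>UNIV. X (var j) * pd j (p i))"

definition omega_map :: "('n \<Rightarrow> 'n cpoly) \<Rightarrow> 'n::finite vfield \<Rightarrow> ('n cpoly)^'n" where
  "omega_map p X = (\<chi> i. X (p i))"

text \<open>\<open>X\<close> is a lift of \<open>Y\<close>.\<close>

definition lift_of :: "('n \<Rightarrow> 'n cpoly) \<Rightarrow> 'n::finite vfield \<Rightarrow> 'n vfield \<Rightarrow> bool" where
  "lift_of p X Y \<longleftrightarrow> tangent_map p X = omega_map p Y"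

text \<open>The \<open>S\<close>-bilinear extension to \<open>Der\<^sub>R \<otimes>\<^sub>R S\<close> of an \<open>R\<close>-bilinear multiplication on \<open>Der\<^sub>R\<close>.\<close>

definition extended_mult ::
    "'n cpoly set \<Rightarrow> ('n \<Rightarrow> 'n cpoly) \<Rightarrow> ('n vfield \<Rightarrow> 'n vfield \<Rightarrow> 'n vfield)
     \<Rightarrow> ('n cpoly)^'n \<Rightarrow> ('n cpoly)^'n \<Rightarrow> ('n cpoly)^'n::finite" where
  "extended_mult R p mul s t =
     (\<Sum>i\<in>UNIV. \<Sum>j\<in>UNIV.
        (s $ i * t $ j) *s omega_map p (mul (coord_field p R i) (coord_field p R j)))"

end

theory Submission
  imports Defs "HOL-Computational_Algebra.Fraction_Field" "HOL-Computational_Algebra.Polynomial"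
begin

text \<open>
  Let \<open>J\<close> be the matrix of \<open>tp\<close> in orthonormal coordinates, so that \<open>K = J J\<^sup>T\<close> is the Gram matrix of
  \<open>g\<^sup>*\<close>, and let \<open>M\<close> be the matrix of the multiplication by some vector field. Everything follows
  once \<open>N = J\<^sup>-\<^sup>1 M J\<close> is known to be polynomial. By \<open>g\<^sup>*(\<alpha>, \<beta>) = \<eta>(\<alpha>\<^sup>\<sharp> \<circ> \<beta>\<^sup>\<sharp>, E)\<close> and the associativity and
  commutativity of \<open>\<circ>\<close> one has \<open>M K = K M\<^sup>T\<close>, which says that \<open>N\<close> is symmetric. Differentiating the
  orbit polynomial \<open>\<Prod>(T - \<mu>)\<close> of a linear form \<open>\<lambda>\<close>, whose coefficients are invariants, at its root
  \<open>\<lambda>\<close> shows that the row of \<open>J\<^sup>-\<^sup>1\<close> belonging to \<open>\<lambda>\<close> has at most the denominator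
  \<open>\<Prod>(\<lambda> - \<mu>)\<close>, \<open>\<mu>\<close> ranging over the orbit without \<open>\<lambda>\<close>. For a suitable choice of \<open>\<lambda>\<close>, poles of \<open>N\<close> are
  therefore possible only along the mirrors of reflections, and there only simple ones in the row
  of the normal direction. The column of \<open>J\<close> belonging to the normal direction vanishes on the
  mirror, so this column of \<open>N\<close> has no pole, and by symmetry neither has the row.

  There is no unit because the image of \<open>tp\<close> vanishes at the origin, while a unit would have to be
  mapped to the unit of \<open>Der\<^sub>R \<otimes>\<^sub>R S\<close>.
\<close>

section \<open>Polynomials\<close>

lemma sum_single_lookup:
  fixes f :: "'a \<Rightarrow>\<^sub>0 'b::comm_monoid_add"
  shows "(\<Sum>m\<in>Poly_Mapping.keys f. Poly_Mapping.single m (Poly_Mapping.lookup f m)) = f"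
  by (rule poly_mapping_eqI)
    (simp add: lookup_sum lookup_single when_def in_keys_iff sum.If_cases Int_def)

lemma monomial_induct [case_names single add]:
  fixes f :: "'a \<Rightarrow>\<^sub>0 'b::comm_monoid_add"
  assumes "\<And>m c. P (Poly_Mapping.single m c)" and "\<And>f g. P f \<Longrightarrow> P g \<Longrightarrow> P (f + g)"
  shows "P f"
proof -
  have "P (\<Sum>m\<in>A. Poly_Mapping.single m (Poly_Mapping.lookup f m))" if "finite A" for A
    using that
  proof induction
    case empty
    \<comment> \<open>The zero polynomial counts as a term with coefficient 0; its exponent is
      arbitrary.\<close>
    show ?case using assms(1)[of undefined 0] by simp
  qed (use assms in auto)
  from this[OF finite_keys[of f]] show ?thesis by (simp add: sum_single_lookup)
qed

lemma cnst_0 [simp]: "cnst 0 = 0"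
  and cnst_1 [simp]: "cnst 1 = 1"
  and cnst_add: "cnst (a + b) = cnst a + cnst b"
  and cnst_mult: "cnst (a * b) = cnst a * cnst b"
  and cnst_uminus: "cnst (- a) = - cnst a"
  by (simp_all add: cnst_def single_add mult_single single_uminus)

lemma cnst_sum: "cnst (sum f A) = (\<Sum>x\<in>A. cnst (f x))"
  by (induction A rule: infinite_finite_induct) (auto simp: cnst_add)

lemma cnst_eq_iff [simp]: "cnst a = cnst b \<longleftrightarrow> a = b"
  by (metis cnst_def lookup_single_eq)

lemma cnst_eq_0_iff [simp]: "cnst a = 0 \<longleftrightarrow> a = 0"
  using cnst_eq_iff[of a 0] by (simp del: cnst_eq_iff)

lemma var_power: "var j ^ k = Poly_Mapping.single (Poly_Mapping.single j k) 1"
  by (induction k) (auto simp: var_def mult_single single_add[symmetric])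

lemma prod_single: "(\<Prod>i\<in>I. Poly_Mapping.single (a i) 1) = Poly_Mapping.single (\<Sum>i\<in>I. a i) (1::'a::comm_semiring_1)"
  by (induction I rule: infinite_finite_induct) (auto simp: mult_single)

lemma sum_single_exponents:
  "(\<Sum>i\<in>UNIV. Poly_Mapping.single i (Poly_Mapping.lookup m i)) = (m :: 'n::finite \<Rightarrow>\<^sub>0 'b::comm_monoid_add)"
  by (rule poly_mapping_eqI) (simp add: lookup_sum lookup_single when_def)

lemma single_eq_monomial:
  "Poly_Mapping.single m c = cnst c * (\<Prod>i\<in>(UNIV::'n::finite set). var i ^ Poly_Mapping.lookup m i)"
  by (simp add: var_power prod_single sum_single_exponents cnst_def mult_single)

text \<open>Induction over the generation of the ring, so that ring homomorphisms and derivations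
  need only be compared on constants and variables.\<close>

lemma cpoly_induct [case_names cnst var add mult]:
  fixes f :: "'n::finite cpoly"
  assumes c: "\<And>c. P (cnst c)" and v: "\<And>j. P (var j)"
    and a: "\<And>f g. P f \<Longrightarrow> P g \<Longrightarrow> P (f + g)" and m: "\<And>f g. P f \<Longrightarrow> P g \<Longrightarrow> P (f * g)"
  shows "P f"
proof (induction f rule: monomial_induct)
  case (single m c)
  have one: "P 1" using c[of 1] by simp
  have pow: "P (var i ^ k)" for i k by (induction k) (auto intro: one v assms(4))
  have "P (\<Prod>i\<in>A. var i ^ Poly_Mapping.lookup m i)" if "finite A" for A
    using that by induction (auto intro: one pow assms(4))
  then show ?case unfolding single_eq_monomial by (intro assms(4) c) simp
qed (rule a)

section \<open>Substitution and partial derivatives\<close>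

lemma subst_single:
  "subst p (Poly_Mapping.single m c) = cnst c * (\<Prod>i\<in>UNIV. p i ^ Poly_Mapping.lookup m i)"
  by (cases "c = 0") (simp_all add: subst_def)

lemma subst_add: "subst p (f + g) = subst p f + subst p g"
  unfolding subst_def
  by (rule setsum_keys_plus_distrib) (auto simp: cnst_add distrib_right)

lemma subst_mult: "subst p (f * g) = subst p f * subst p g"
proof (induction f rule: monomial_induct)
  case (single m c)
  show ?case
  proof (induction g rule: monomial_induct)
    case (single n d)
    show ?case
      by (simp add: mult_single subst_single cnst_mult lookup_add power_add prod.distrib mult_ac)
  qed (simp add: algebra_simps subst_add)
qed (simp add: algebra_simps subst_add)

lemma subst_cnst [simp]: "subst p (cnst c) = cnst c"
  by (simp add: cnst_def subst_single)
    
lemma subst_0 [simp]: "subst p 0 = 0"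
  and subst_1 [simp]: "subst p 1 = 1"
  using subst_cnst[of p 0] subst_cnst[of p 1] by simp_all

lemma subst_var [simp]: "subst p (var i) = p i"
proof -
  have "subst p (var i) = (\<Prod>k\<in>UNIV. if k = i then p k else 1)"
    unfolding var_def subst_single cnst_def[symmetric] cnst_1 mult_1_left
    by (rule prod.cong) (auto simp: lookup_single when_def)
  then show ?thesis by simp
qed

lemma subst_uminus: "subst p (- f) = - subst p f"
  using subst_add[of p f "- f"] by (simp add: eq_neg_iff_add_eq_0 add.commute)

lemma subst_diff: "subst p (f - g) = subst p f - subst p g"
  using subst_add[of p f "- g"] by (simp add: subst_uminus)

lemma subst_sum: "subst p (sum f A) = (\<Sum>x\<in>A. subst p (f x))"
  by (induction A rule: infinite_finite_induct) (auto simp: subst_add)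

lemma subst_prod: "subst p (prod f A) = (\<Prod>x\<in>A. subst p (f x))"
  by (induction A rule: infinite_finite_induct) (auto simp: subst_mult)

lemmas subst_hom = subst_add subst_mult subst_uminus subst_diff subst_sum subst_prod

lemma subst_subst: "subst p (subst q f) = subst (\<lambda>i. subst p (q i)) f"
  by (induction f rule: cpoly_induct) (simp_all add: subst_add subst_mult)

lemma pd_single:
  "pd j (Poly_Mapping.single m c) =
    Poly_Mapping.single (m - Poly_Mapping.single j 1) (of_nat (Poly_Mapping.lookup m j) * c)"
  by (cases "c = 0") (simp_all add: pd_def)

lemma pd_add: "pd j (f + g) = pd j f + pd j g"
  unfolding pd_def
  by (rule setsum_keys_plus_distrib) (auto simp: single_add distrib_left)

lemma pd_mult: "pd j (f * g) = pd j f * g + f * pd j g"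
proof (induction f rule: monomial_induct)
  case (single m c)
  show ?case
  proof (induction g rule: monomial_induct)
    case (single n d)
    \<comment> \<open>Truncated subtraction commutes with adding \<open>n\<close> only if
      \<open>j\<close> occurs in \<open>m\<close>. Otherwise the coefficient is 0 and both sides
      vanish.\<close>
    have *: "Poly_Mapping.single (m + n - Poly_Mapping.single j 1) (of_nat (Poly_Mapping.lookup m j) * x)
      = Poly_Mapping.single (m - Poly_Mapping.single j 1 + n) (of_nat (Poly_Mapping.lookup m j) * x)"
      for m n :: "'a \<Rightarrow>\<^sub>0 nat" and x :: complex
    proof (cases "Poly_Mapping.lookup m j = 0")
      case False
      have "m + n - Poly_Mapping.single j 1 = m - Poly_Mapping.single j 1 + n"
        using False by (intro poly_mapping_eqI) (auto simp: lookup_add lookup_minus lookup_single when_def)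
      then show ?thesis by simp
    qed simp
    show ?case
      using *[of m n "c * d"] *[of n m "c * d"]
      by (simp add: mult_single pd_single lookup_add distrib_right distrib_left single_add add.commute mult_ac)
  qed (simp add: algebra_simps pd_add)
qed (simp add: algebra_simps pd_add)

lemma pd_cnst [simp]: "pd j (cnst c) = 0"
  by (simp add: cnst_def pd_single)

lemma pd_var: "pd j (var i) = (if i = j then 1 else 0)"
  by (simp add: var_def pd_single lookup_single when_def)

section \<open>The polynomial ring as an integral domain\<close>

text \<open>Polynomials are an integral domain in the library only for linearly ordered variables, hence the
  renaming of the variables to numbers.\<close>

definition rename :: "('n::finite \<Rightarrow> nat) \<Rightarrow> 'n cpoly \<Rightarrow> nat cpoly" where
  "rename s f = (\<Sum>m\<in>Poly_Mapping.keys f. Poly_Mapping.single (\<Sum>i\<in>UNIV. Poly_Mapping.single (s i) (Poly_Mapping.lookup m i)) (Poly_Mapping.lookup f m))"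

lemma rename_single:
  "rename s (Poly_Mapping.single m c) = Poly_Mapping.single (\<Sum>i\<in>UNIV. Poly_Mapping.single (s i) (Poly_Mapping.lookup m i)) c"
  by (cases "c = 0") (simp_all add: rename_def)

lemma rename_add: "rename s (f + g) = rename s f + rename s g"
  unfolding rename_def
  by (rule setsum_keys_plus_distrib) (auto simp: single_add)

lemma rename_mult: "rename s (f * g) = rename s f * rename s g"
proof (induction f rule: monomial_induct)
  case (single m c)
  show ?case
  proof (induction g rule: monomial_induct)
    case (single n d)
    show ?case
      by (simp add: mult_single rename_single lookup_add single_add sum.distrib)
  qed (simp add: algebra_simps rename_add)
qed (simp add: algebra_simps rename_add)

lemma rename_0 [simp]: "rename s 0 = 0"
  by (simp add: rename_def)

text \<open>An injective renaming is injective on monomials, so each coefficient of \<open>f\<close>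
  can be read off from the renamed polynomial.\<close>

lemma rename_eq_0:
  assumes s: "inj s" and "rename s f = 0"
  shows "f = 0"
proof (rule poly_mapping_eqI)
  let ?r = "\<lambda>m :: 'a \<Rightarrow>\<^sub>0 nat. \<Sum>i\<in>UNIV. Poly_Mapping.single (s i) (Poly_Mapping.lookup m i)"
  have r: "Poly_Mapping.lookup (?r m) (s i) = Poly_Mapping.lookup m i" for m :: "'a \<Rightarrow>\<^sub>0 nat" and i
    using s by (simp add: lookup_sum lookup_single when_def inj_eq)
  have inj: "?r m = ?r n \<longleftrightarrow> m = n" for m n
  proof
    assume "?r m = ?r n"
    then have "Poly_Mapping.lookup (?r m) (s i) = Poly_Mapping.lookup (?r n) (s i)" for i by simp
    then have "Poly_Mapping.lookup m i = Poly_Mapping.lookup n i" for i by (simp only: r)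
    then show "m = n" by (intro poly_mapping_eqI)
  qed simp
  fix m
  have "0 = Poly_Mapping.lookup (rename s f) (?r m)" using assms by simp
  also have "\<dots> = (\<Sum>n\<in>Poly_Mapping.keys f. if n = m then Poly_Mapping.lookup f n else 0)"
    unfolding rename_def by (simp add: lookup_sum lookup_single when_def inj)
  also have "\<dots> = Poly_Mapping.lookup f m" by (simp add: in_keys_iff)
  finally show "Poly_Mapping.lookup f m = Poly_Mapping.lookup 0 m" by simp
qed

lemma ex_rename: "\<exists>s :: 'n::finite \<Rightarrow> nat. inj s"
  using finite_imp_inj_to_nat_seg[of "UNIV :: 'n set"] by auto

lemma cpoly_mult_eq_0_iff:
  fixes f g :: "'n::finite cpoly"
  shows "f * g = 0 \<longleftrightarrow> f = 0 \<or> g = 0"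
proof
  obtain s :: "'n \<Rightarrow> nat" where s: "inj s" using ex_rename by blast
  assume "f * g = 0"
  then have "rename s f * rename s g = 0" by (simp flip: rename_mult)
  then show "f = 0 \<or> g = 0" using rename_eq_0[OF s] by auto
qed auto

lemma cpoly_mult_cancel_left:
  fixes f g h :: "'n::finite cpoly"
  assumes "h * f = h * g" "h \<noteq> 0"
  shows "f = g"
proof -
  have "h * (f - g) = 0" using assms by (simp add: algebra_simps)
  then show ?thesis using assms by (simp add: cpoly_mult_eq_0_iff)
qed

lemma cpoly_prod_eq_0_iff:
  fixes f :: "'a \<Rightarrow> 'n::finite cpoly"
  assumes "finite A"
  shows "prod f A = 0 \<longleftrightarrow> (\<exists>a\<in>A. f a = 0)"
  using assms by induction (auto simp: cpoly_mult_eq_0_iff)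

text \<open>Over the field of fractions this is the equality of left and right inverses.\<close>

lemma cpoly_left_right_inverse:
  fixes X A :: "'n::finite cpoly^'m::finite^'m"
  assumes XA: "X ** A = mat d" and d: "d \<noteq> 0"
  shows "A ** X = mat d"
proof -
  obtain s :: "'n \<Rightarrow> nat" where s: "inj s" using ex_rename by blast
  define \<iota> :: "'n cpoly \<Rightarrow> nat cpoly fract" where "\<iota> f = Fract (rename s f) 1" for f
  have hom: "\<iota> (f + g) = \<iota> f + \<iota> g" "\<iota> (f * g) = \<iota> f * \<iota> g" "\<iota> 0 = 0" for f g
    by (simp_all add: \<iota>_def rename_add rename_mult Zero_fract_def)
  have sum: "\<iota> (sum f B) = (\<Sum>x\<in>B. \<iota> (f x))" for f and B :: "'m set"
    by (induction B rule: infinite_finite_induct) (auto simp: hom)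
  have \<iota>0: "\<iota> f = 0 \<longleftrightarrow> f = 0" for f
    using rename_eq_0[OF s] by (auto simp: \<iota>_def Zero_fract_def eq_fract)
  have inj: "\<iota> f = \<iota> g \<longleftrightarrow> f = g" for f g
  proof
    assume "\<iota> f = \<iota> g"
    then have "\<iota> (f - g) = 0" using hom(1)[of "f - g" g] by simp
    then show "f = g" using \<iota>0 by simp
  qed simp
  define X' A' where "X' = (\<chi> i j. \<iota> (X $ i $ j) / \<iota> d)" and "A' = (\<chi> i j. \<iota> (A $ i $ j))"
  have XA': "(\<Sum>k\<in>UNIV. X $ i $ k * A $ k $ j) = (if i = j then d else 0)" for i j
    using arg_cong[OF XA, of "\<lambda>M. M $ i $ j"] by (simp add: matrix_matrix_mult_def mat_def)
  have "X' ** A' = mat 1"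
  proof -
    have "(\<Sum>k\<in>UNIV. \<iota> (X $ i $ k) / \<iota> d * \<iota> (A $ k $ j)) = (if i = j then 1 else 0)" for i j
    proof -
      have "(\<Sum>k\<in>UNIV. \<iota> (X $ i $ k) / \<iota> d * \<iota> (A $ k $ j)) = \<iota> (\<Sum>k\<in>UNIV. X $ i $ k * A $ k $ j) / \<iota> d"
        by (simp add: sum hom sum_divide_distrib)
      also have "\<dots> = (if i = j then 1 else 0)" unfolding XA' using \<iota>0 d hom(3) by auto
      finally show ?thesis .
    qed
    then show ?thesis by (simp add: X'_def A'_def matrix_matrix_mult_def mat_def vec_eq_iff)
  qed
  then have "A' ** X' = mat 1" by (rule matrix_left_right_inverse1)
  then have *: "(\<Sum>k\<in>UNIV. \<iota> (A $ i $ k) * (\<iota> (X $ k $ j) / \<iota> d)) = (if i = j then 1 else 0)" for i j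
    by (simp add: X'_def A'_def matrix_matrix_mult_def mat_def vec_eq_iff)
  have "\<iota> (\<Sum>k\<in>UNIV. A $ i $ k * X $ k $ j) = \<iota> (if i = j then d else 0)" for i j
  proof -
    have "\<iota> (\<Sum>k\<in>UNIV. A $ i $ k * X $ k $ j) / \<iota> d = (\<Sum>k\<in>UNIV. \<iota> (A $ i $ k) * (\<iota> (X $ k $ j) / \<iota> d))"
      by (simp add: sum hom sum_divide_distrib)
    also note *
    finally show ?thesis using \<iota>0[of d] d hom(3) by (auto split: if_splits)
  qed
  then show ?thesis unfolding inj by (simp add: matrix_matrix_mult_def mat_def vec_eq_iff)
qed

section \<open>Polynomials in some of the variables\<close>

text \<open>Given inductively, so that statements about the subalgebra generated by some of the
  basic invariants follow by rule induction.\<close>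

inductive_set polys_in :: "'n::finite set \<Rightarrow> 'n cpoly set" for I where
  cnst: "cnst c \<in> polys_in I"
| var: "i \<in> I \<Longrightarrow> var i \<in> polys_in I"
| add: "f \<in> polys_in I \<Longrightarrow> g \<in> polys_in I \<Longrightarrow> f + g \<in> polys_in I"
| mult: "f \<in> polys_in I \<Longrightarrow> g \<in> polys_in I \<Longrightarrow> f * g \<in> polys_in I"

lemma polys_in_UNIV: "polys_in UNIV = UNIV"
proof -
  have "f \<in> polys_in UNIV" for f
    by (induction f rule: cpoly_induct) (auto intro: polys_in.intros)
  then show ?thesis by blast
qed

lemma subst_in_polys_in: "(\<And>i. s i \<in> polys_in I) \<Longrightarrow> subst s q \<in> polys_in I"
  by (induction q rule: cpoly_induct) (auto simp: subst_hom intro: polys_in.intros)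

lemma pd_polys_in: "q \<in> polys_in I \<Longrightarrow> pd i q \<in> polys_in I"
proof (induction rule: polys_in.induct)
  case (cnst c)
  show ?case using polys_in.cnst[of 0 I] by simp
next
  case (var j)
  show ?case using polys_in.cnst[of 0 I] polys_in.cnst[of 1 I] by (simp add: pd_var)
qed (auto simp: pd_add pd_mult intro: polys_in.intros)

section \<open>The value at the origin\<close>

text \<open>Evaluation at the origin, hence a ring homomorphism to the complex numbers. It is what
  excludes a unit in the end.\<close>

definition const_coeff :: "'n::finite cpoly \<Rightarrow> complex" where
  "const_coeff f = Poly_Mapping.lookup f 0"

lemma const_coeff_cnst: "const_coeff (cnst c) = c"
  by (simp add: const_coeff_def cnst_def)

lemma const_coeff_add: "const_coeff (f + g) = const_coeff f + const_coeff g"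
  by (simp add: const_coeff_def lookup_add)

lemma const_coeff_sum: "const_coeff (sum f A) = (\<Sum>x\<in>A. const_coeff (f x))"
  by (simp add: const_coeff_def lookup_sum)

lemma const_coeff_mult: "const_coeff (f * g) = const_coeff f * const_coeff g"
proof (induction f rule: monomial_induct)
  case (single m c)
  show ?case
  proof (induction g rule: monomial_induct)
    case (single n d)
    have "m + n = 0 \<longleftrightarrow> m = 0 \<and> n = 0"
      by (auto simp: poly_mapping_eq_iff fun_eq_iff lookup_add)
    then show ?case by (auto simp: const_coeff_def mult_single lookup_single when_def)
  qed (simp add: algebra_simps const_coeff_add)
qed (simp add: algebra_simps const_coeff_add)

lemma const_coeff_var: "const_coeff (var j) = 0"
  by (auto simp: const_coeff_def var_def lookup_single when_def poly_mapping_eq_iff fun_eq_iff)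

section \<open>Derivations and linear forms\<close>

lemma Der_add: "D \<in> Der A \<Longrightarrow> f \<in> A \<Longrightarrow> g \<in> A \<Longrightarrow> D (f + g) = D f + D g"
  and Der_cnst_mult: "D \<in> Der A \<Longrightarrow> f \<in> A \<Longrightarrow> D (cnst c * f) = cnst c * D f"
  and Der_mult: "D \<in> Der A \<Longrightarrow> f \<in> A \<Longrightarrow> g \<in> A \<Longrightarrow> D (f * g) = D f * g + f * D g"
  and Der_closed: "D \<in> Der A \<Longrightarrow> f \<in> A \<Longrightarrow> D f \<in> A"
  and Der_outside: "D \<in> Der A \<Longrightarrow> f \<notin> A \<Longrightarrow> D f = 0"
  by (auto simp: Der_def)

lemma Der_cnst:
  assumes D: "D \<in> Der A" and "1 \<in> A"
  shows "D (cnst c) = 0"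
proof -
  have "D 1 = 0" using Der_mult[OF D, of 1 1] assms by simp
  then show ?thesis using Der_cnst_mult[OF D, of 1 c] assms by simp
qed

lemma DerS_I:
  assumes "\<And>f g. D (f + g) = D f + D g" "\<And>c f. D (cnst c * f) = cnst c * D f"
    "\<And>f g. D (f * g) = D f * g + f * D g"
  shows "D \<in> DerS"
  using assms by (simp add: Der_def)

lemmas DerS_add = Der_add[where A = UNIV, OF _ UNIV_I UNIV_I]
lemmas DerS_mult = Der_mult[where A = UNIV, OF _ UNIV_I UNIV_I]
lemmas DerS_cnst = Der_cnst[where A = UNIV, OF _ UNIV_I]

lemma DerS_0: "D \<in> DerS \<Longrightarrow> D 0 = 0"
  using DerS_cnst[of D 0] by simp

lemma DerS_uminus: "D \<in> DerS \<Longrightarrow> D (- f) = - D f"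
  using DerS_add[of D f "- f"] DerS_0[of D] by (simp add: eq_neg_iff_add_eq_0 add.commute)

lemma DerS_diff: "D \<in> DerS \<Longrightarrow> D (f - g) = D f - D g"
  using DerS_add[of D f "- g"] by (simp add: DerS_uminus)

lemma DerS_sum: "D \<in> DerS \<Longrightarrow> D (sum f A) = (\<Sum>x\<in>A. D (f x))"
  by (induction A rule: infinite_finite_induct) (auto simp: DerS_0 DerS_add)

lemma DerS_cnst_mult: "D \<in> DerS \<Longrightarrow> D (cnst c * f) = cnst c * D f"
  by (simp add: DerS_mult DerS_cnst)

lemma DerS_eqI:
  fixes D D' :: "'n::finite vfield"
  assumes D: "D \<in> DerS" "D' \<in> DerS" and eq: "\<And>j. D (var j) = D' (var j)"
  shows "D = D'"
proof
  fix f show "D f = D' f"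
    by (induction f rule: cpoly_induct) (use D in \<open>auto simp: DerS_cnst DerS_add DerS_mult eq\<close>)
qed

lemma DerS_sum_smul:
  assumes "\<And>k. k \<in> K \<Longrightarrow> X k \<in> DerS"
  shows "(\<lambda>f. \<Sum>k\<in>K. y k * X k f) \<in> DerS"
proof (rule DerS_I, goal_cases)
  case (1 f g)
  show ?case using assms by (simp add: DerS_add algebra_simps sum.distrib)
next
  case (2 c f)
  show ?case using assms by (simp add: DerS_cnst_mult sum_distrib_left mult.left_commute)
next
  case (3 f g)
  show ?case using assms
    by (simp add: DerS_mult algebra_simps sum_distrib_left sum.distrib)
qed

lemma pd_DerS: "pd j \<in> DerS"
  by (rule DerS_I) (auto simp: pd_add pd_mult)

lemma DerS_conv_pd:
  fixes D :: "'n::finite vfield"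
  assumes "D \<in> DerS"
  shows "D f = (\<Sum>j\<in>UNIV. D (var j) * pd j f)"
proof -
  have "D = (\<lambda>f. \<Sum>j\<in>UNIV. D (var j) * pd j f)"
    using assms by (rule DerS_eqI) (auto intro!: DerS_sum_smul pd_DerS simp: pd_var if_distrib cong: if_cong)
  then show ?thesis by (rule fun_cong)
qed

lemma tangent_map_eq: "X \<in> DerS \<Longrightarrow> tangent_map p X = (\<chi> i. X (p i))"
  unfolding tangent_map_def by (subst DerS_conv_pd) auto

lemma dirder_DerS: "dirder v \<in> DerS"
  unfolding dirder_def by (rule DerS_sum_smul) (rule pd_DerS)

lemma dirder_cnst [simp]: "dirder v (cnst c) = 0"
  by (simp add: DerS_cnst dirder_DerS)

lemmas dirder_add = DerS_add[OF dirder_DerS]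
  and dirder_mult = DerS_mult[OF dirder_DerS]
  and dirder_sum = DerS_sum[OF dirder_DerS]

lemma dirder_var [simp]: "dirder v (var j) = cnst (v $ j)"
  by (simp add: dirder_def pd_var if_distrib cong: if_cong)

lemma dirder_plus: "dirder (v + w) f = dirder v f + dirder w f"
  by (simp add: dirder_def cnst_add algebra_simps sum.distrib)

lemma dirder_scale: "dirder (c *\<^sub>R v) f = cnst c * dirder v f"
  by (simp add: dirder_def cnst_mult sum_distrib_left mult_ac)

lemma dirder_zero [simp]: "dirder 0 f = 0"
  by (simp add: dirder_def)

lemma dirder_vsum: "dirder (sum g A) f = (\<Sum>x\<in>A. dirder (g x) f)"
  by (induction A rule: infinite_finite_induct) (auto simp: dirder_plus)

section \<open>Pullbacks along linear maps\<close>

lemma pullback_hom: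
  "pullback A (f + g) = pullback A f + pullback A g"
  "pullback A (f * g) = pullback A f * pullback A g"
  "pullback A (- f) = - pullback A f"
  "pullback A (f - g) = pullback A f - pullback A g"
  "pullback A (sum h K) = (\<Sum>x\<in>K. pullback A (h x))"
  "pullback A (prod h K) = (\<Prod>x\<in>K. pullback A (h x))"
  by (simp_all add: pullback_def subst_hom)

lemma pullback_cnst [simp]: "pullback A (cnst c) = cnst c"
  and pullback_0 [simp]: "pullback A 0 = 0"
  and pullback_1 [simp]: "pullback A 1 = 1"
  by (simp_all add: pullback_def)

lemma pullback_var: "pullback A (var i) = (\<Sum>j\<in>UNIV. cnst (A $ i $ j) * var j)"
  by (simp add: pullback_def)

lemma pullback_pullback: "pullback A (pullback A' f) = pullback (A' ** A) f"
proof (induction f rule: cpoly_induct)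
  case (var i)
  have "(\<Sum>j\<in>UNIV. \<Sum>k\<in>UNIV. cnst (A' $ i $ j) * (cnst (A $ j $ k) * var k))
      = (\<Sum>k\<in>UNIV. \<Sum>j\<in>UNIV. cnst (A' $ i $ j) * (cnst (A $ j $ k) * var k))"
    by (rule sum.swap)
  then show ?case
    by (simp add: pullback_var pullback_hom sum_distrib_left matrix_matrix_mult_def cnst_sum cnst_mult
        sum_distrib_right mult.assoc)
qed (simp_all add: pullback_hom)

lemma pullback_0_is_cnst: "\<exists>c. pullback 0 f = cnst c"
proof (induction f rule: cpoly_induct)
  case (var j)
  show ?case by (auto simp: pullback_var intro: exI[of _ 0])
qed (auto simp: pullback_hom simp flip: cnst_add cnst_mult)

text \<open>The chain rule for the linear map \<open>A\<close>.\<close>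

lemma dirder_pullback: "dirder v (pullback A f) = pullback A (dirder (A *v v) f)"
proof (induction f rule: cpoly_induct)
  case (var i)
  show ?case
    by (simp add: pullback_var pullback_hom dirder_sum dirder_mult matrix_vector_mult_def cnst_sum cnst_mult)
qed (simp_all add: pullback_hom dirder_add dirder_mult)

section \<open>Linear forms and divisibility by them\<close>

definition linear_form :: "(real^'n::finite \<Rightarrow> real) \<Rightarrow> 'n cpoly" where
  "linear_form \<phi> = (\<Sum>j\<in>UNIV. cnst (\<phi> (axis j 1)) * var j)"

lemma linear_axis_sum:
  fixes \<phi> :: "real^'n::finite \<Rightarrow> real"
  assumes "linear \<phi>"
  shows "\<phi> x = (\<Sum>j\<in>UNIV. x $ j * \<phi> (axis j 1))"
proof -
  have "\<phi> x = \<phi> (\<Sum>j\<in>UNIV. x $ j *\<^sub>R axis j 1)"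
    by (simp add: basis_expansion flip: scalar_mult_eq_scaleR)
  also have "\<dots> = (\<Sum>j\<in>UNIV. x $ j * \<phi> (axis j 1))"
    using assms by (simp add: linear_sum linear_scale)
  finally show ?thesis .
qed

lemma pullback_linear_form:
  assumes "linear \<phi>"
  shows "pullback A (linear_form \<phi>) = linear_form (\<lambda>x. \<phi> (A *v x))"
proof -
  have "\<phi> (A *v axis k 1) = (\<Sum>i\<in>UNIV. A $ i $ k * \<phi> (axis i 1))" for k
    by (subst linear_axis_sum[OF assms]) (simp add: matrix_vector_mul_component inner_axis)
  moreover have "(\<Sum>i\<in>UNIV. \<Sum>k\<in>UNIV. cnst (\<phi> (axis i 1)) * (cnst (A $ i $ k) * var k))
     = (\<Sum>k\<in>UNIV. \<Sum>i\<in>UNIV. cnst (\<phi> (axis i 1)) * (cnst (A $ i $ k) * var k))"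
    by (rule sum.swap)
  ultimately show ?thesis
    by (simp add: linear_form_def pullback_hom pullback_var cnst_sum cnst_mult sum_distrib_left
        sum_distrib_right mult_ac)
qed

lemma dirder_linear_form:
  "linear \<phi> \<Longrightarrow> dirder v (linear_form \<phi>) = cnst (\<phi> v)"
  using linear_axis_sum[of \<phi> v]
  by (simp add: linear_form_def dirder_sum dirder_mult cnst_sum cnst_mult mult_ac)

text \<open>The functional is recovered from the polynomial by directional derivatives.\<close>

lemma linear_form_eq_0_iff:
  assumes "linear \<phi>"
  shows "linear_form \<phi> = 0 \<longleftrightarrow> (\<forall>x. \<phi> x = 0)"
proof
  assume *: "linear_form \<phi> = 0"
  show "\<forall>x. \<phi> x = 0"
    using dirder_linear_form[OF assms] DerS_0[OF dirder_DerS] unfolding * by (simp del: cnst_0 add: cnst_0[symmetric])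
qed (simp add: linear_form_def)

lemma linear_form_scale: "linear_form (\<lambda>x. c * \<phi> x) = cnst c * linear_form \<phi>"
  by (simp add: linear_form_def cnst_mult sum_distrib_left mult_ac)

lemma linear_form_diff: "linear_form (\<lambda>x. \<phi> x - \<psi> x) = linear_form \<phi> - linear_form \<psi>"
  by (simp add: linear_form_def cnst_uminus cnst_add algebra_simps sum_subtractf sum_negf sum.distrib
      flip: add_uminus_conv_diff)

text \<open>This is a projection onto the kernel of \<open>\<phi>\<close> only if \<open>\<phi> b = 1\<close>.\<close>

definition kernel_projection :: "(real^'n::finite \<Rightarrow> real) \<Rightarrow> real^'n \<Rightarrow> real^'n^'n" where
  "kernel_projection \<phi> b = matrix (\<lambda>x. x - \<phi> x *\<^sub>R b)"

lemma kernel_projection_vector: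
  assumes "linear \<phi>"
  shows "kernel_projection \<phi> b *v x = x - \<phi> x *\<^sub>R b"
proof -
  have "linear (\<lambda>x. x - \<phi> x *\<^sub>R b)"
    using assms by (intro linearI) (auto simp: linear_add linear_scale algebra_simps)
  then show ?thesis unfolding kernel_projection_def by (simp add: matrix_works)
qed

text \<open>The map moves \<open>x\<close> by \<phi>(x) \<open>b\<close>, so modulo the form each
  coordinate agrees with its pullback; this congruence passes to sums and products.\<close>

lemma linear_form_dvd_diff_pullback:
  assumes "linear \<phi>"
  shows "linear_form \<phi> dvd f - pullback (kernel_projection \<phi> b) f"
proof (induction f rule: cpoly_induct)
  case (var i)
  have "kernel_projection \<phi> b $ i $ j = (if i = j then 1 else 0) - \<phi> (axis j 1) * b $ i" for j
    using arg_cong[OF kernel_projection_vector[OF assms, of b "axis j 1"], of "\<lambda>x. x $ i"]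
    by (simp add: matrix_vector_mul_component inner_axis) (auto simp: axis_def)
  then have "(\<Sum>j\<in>UNIV. cnst (kernel_projection \<phi> b $ i $ j) * var j)
    = (\<Sum>j\<in>UNIV. (if i = j then var j else 0) - cnst (b $ i) * (cnst (\<phi> (axis j 1)) * var j))"
    by (intro sum.cong refl)
      (auto simp: cnst_mult cnst_add cnst_uminus algebra_simps simp flip: add_uminus_conv_diff)
  then have "var i - pullback (kernel_projection \<phi> b) (var i) = linear_form \<phi> * cnst (b $ i)"
    by (simp add: pullback_var linear_form_def sum_subtractf flip: sum_distrib_left)
  then show ?case by simp
next
  case (add f g)
  show ?case using dvd_add[OF add.IH] by (simp add: pullback_hom algebra_simps)
next
  case (mult f g)
  let ?P = "pullback (kernel_projection \<phi> b)"
  have "f * g - ?P (f * g) = (f - ?P f) * g + ?P f * (g - ?P g)"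
    by (simp add: pullback_hom algebra_simps)
  then show ?case using mult.IH by (simp add: dvd_add)
qed simp

text \<open>With \<phi>(b) = 1 the projection lands in the kernel of \<phi>, where all multiples of
  the form vanish; the converse is the preceding congruence. Divisibility thus becomes vanishing
  under a ring homomorphism.\<close>

lemma linear_form_dvd_iff:
  assumes "linear \<phi>" and b: "\<phi> b = 1"
  shows "linear_form \<phi> dvd f \<longleftrightarrow> pullback (kernel_projection \<phi> b) f = 0"
proof
  have "linear_form (\<lambda>x. 0) = 0" by (simp add: linear_form_def)
  then have "pullback (kernel_projection \<phi> b) (linear_form \<phi>) = 0"
    using assms by (simp add: pullback_linear_form kernel_projection_vector linear_diff linear_scale)
  then show "linear_form \<phi> dvd f \<Longrightarrow> pullback (kernel_projection \<phi> b) f = 0"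
    by (auto elim!: dvdE simp: pullback_hom)
  show "pullback (kernel_projection \<phi> b) f = 0 \<Longrightarrow> linear_form \<phi> dvd f"
    using linear_form_dvd_diff_pullback[OF assms(1), of f b] by simp
qed

text \<open>A ring homomorphism into an integral domain that sends a product to 0 sends a factor to
  0. If \<phi> = 0, the form is 0, and the absence of zero divisors suffices.\<close>

lemma linear_form_prime:
  assumes "linear \<phi>" "linear_form \<phi> dvd f * g"
  shows "linear_form \<phi> dvd f \<or> linear_form \<phi> dvd g"
proof (cases "\<exists>x. \<phi> x \<noteq> 0")
  case True
  then obtain x where "\<phi> x \<noteq> 0" by blast
  then have "\<phi> ((1 / \<phi> x) *\<^sub>R x) = 1" using assms by (simp add: linear_scale)
  then show ?thesis using assms by (simp add: linear_form_dvd_iff pullback_hom cpoly_mult_eq_0_iff)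
next
  case False
  then have "linear_form \<phi> = 0" using assms by (simp add: linear_form_eq_0_iff)
  then show ?thesis using assms by (simp add: cpoly_mult_eq_0_iff)
qed

text \<open>Here \<psi> vanishes on the kernel of \<phi>, so it is a multiple of \<phi>, with factor
  \<psi>(b) for any \<open>b\<close> with \<phi>(b) = 1.\<close>

lemma linear_form_dvd_linear_form:
  assumes "linear \<phi>" "linear \<psi>" "linear_form \<phi> dvd linear_form \<psi>"
  shows "\<exists>c. \<forall>x. \<psi> x = c * \<phi> x"
proof (cases "\<exists>x. \<phi> x \<noteq> 0")
  case True
  then obtain x where "\<phi> x \<noteq> 0" by blast
  then have b: "\<phi> ((1 / \<phi> x) *\<^sub>R x) = 1" using assms by (simp add: linear_scale)
  define b where "b = (1 / \<phi> x) *\<^sub>R x"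
  have "pullback (kernel_projection \<phi> b) (linear_form \<psi>) = 0"
    using assms b by (simp add: linear_form_dvd_iff b_def)
  then have "linear_form (\<lambda>x. \<psi> (x - \<phi> x *\<^sub>R b)) = 0"
    using assms by (simp add: pullback_linear_form kernel_projection_vector)
  moreover have "linear (\<lambda>x. \<psi> (x - \<phi> x *\<^sub>R b))"
    using assms by (intro linearI) (auto simp: linear_add linear_scale linear_diff algebra_simps)
  ultimately have *: "\<psi> (x - \<phi> x *\<^sub>R b) = 0" for x
    by (simp add: linear_form_eq_0_iff)
  have "\<psi> x = \<psi> b * \<phi> x" for x
    using *[of x] assms(2) by (simp add: linear_diff linear_scale mult.commute)
  then show ?thesis by blast
next
  case False
  then have "linear_form \<phi> = 0" using assms by (simp add: linear_form_eq_0_iff)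
  then have "linear_form \<psi> = 0" using assms by simp
  then show ?thesis using assms by (auto simp: linear_form_eq_0_iff)
qed

text \<open>A denominator that is a product of linear forms can be cancelled one factor at a time, since
  linear forms are prime.\<close>

lemma prod_linear_forms_dvd_local:
  fixes y :: "'n::finite cpoly"
  assumes "finite A" and "\<And>a. a \<in> A \<Longrightarrow> linear (\<phi> a)"
    and nz: "\<And>a. a \<in> A \<Longrightarrow> linear_form (\<phi> a) \<noteq> 0"
    and "\<And>a. a \<in> A \<Longrightarrow> \<exists>b. \<not> linear_form (\<phi> a) dvd b \<and> (\<Prod>a\<in>A. linear_form (\<phi> a)) dvd b * y"
  shows "(\<Prod>a\<in>A. linear_form (\<phi> a)) dvd y"
  using assms
proof (induction A arbitrary: y rule: finite_induct)
  case (insert a A)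
  let ?l = "linear_form (\<phi> a)" and ?d = "\<Prod>a\<in>A. linear_form (\<phi> a)"
  obtain b c where "\<not> ?l dvd b" and bc: "b * y = ?l * ?d * c"
    using insert.prems(3)[of a] insert.hyps by (auto elim!: dvdE)
  moreover from bc have "?l dvd b * y" by (simp add: mult.assoc)
  ultimately have "?l dvd y" using linear_form_prime insert.prems(1) by blast
  then obtain y' where y: "y = ?l * y'" by (rule dvdE)
  have "?d dvd y'"
  proof (rule insert.IH)
    fix a' assume "a' \<in> A"
    then obtain b c where b: "\<not> linear_form (\<phi> a') dvd b" "b * y = ?l * ?d * c"
      using insert.prems(3)[of a'] insert.hyps by (auto elim!: dvdE)
    \<comment> \<open>The multiplier \<open>b\<close> available for \<open>y\<close> serves for
      \<open>y'\<close> as well: the factor \<open>?l\<close> cancels.\<close>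
    have "?l * (b * y') = ?l * (?d * c)" using b(2) by (simp add: y mult_ac)
    then have "b * y' = ?d * c" by (rule cpoly_mult_cancel_left) (simp add: insert.prems(2))
    then show "\<exists>b. \<not> linear_form (\<phi> a') dvd b \<and> ?d dvd b * y'" using b(1) by auto
  qed (use insert.prems in auto)
  then show ?case using insert.hyps by (simp add: y mult_dvd_mono)
qed simp

text \<open>A linear map fixes the origin.\<close>

lemma const_coeff_pullback: "const_coeff (pullback A f) = const_coeff f"
  by (induction f rule: cpoly_induct)
    (simp_all add: pullback_hom pullback_var const_coeff_cnst const_coeff_add const_coeff_mult
      const_coeff_sum const_coeff_var)

lemma sum_vfield_apply: "sum X K f = (\<Sum>x\<in>K. X x f)"
  by (induction K rule: infinite_finite_induct) auto

lemma DerS_plus: "X \<in> DerS \<Longrightarrow> Y \<in> DerS \<Longrightarrow> X + Y \<in> DerS"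
  by (auto simp: Der_def algebra_simps)

lemma DerS_smul: "X \<in> DerS \<Longrightarrow> a \<odot> X \<in> DerS"
  by (auto simp: Der_def smul_def algebra_simps)

lemma tangent_map_plus: "tangent_map p (X + Y) = tangent_map p X + tangent_map p Y"
  by (simp add: tangent_map_def vec_eq_iff distrib_right sum.distrib)

lemma tangent_map_smul: "tangent_map p (a \<odot> X) = a *s tangent_map p X"
  by (simp add: tangent_map_def vec_eq_iff smul_def sum_distrib_left mult.assoc)

lemma omega_map_plus: "omega_map p (X + Y) = omega_map p X + omega_map p Y"
  by (simp add: omega_map_def vec_eq_iff)

lemma omega_map_smul: "omega_map p (a \<odot> X) = a *s omega_map p X"
  by (simp add: omega_map_def vec_eq_iff smul_def)

section \<open>Coxeter groups\<close>

text \<open>Proper subspaces are null sets, and finitely many null sets do not cover the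
  space.\<close>

lemma finite_union_proper_subspaces:
  fixes F :: "'a::euclidean_space set set"
  assumes "finite F" and "\<And>T. T \<in> F \<Longrightarrow> subspace T \<and> T \<noteq> UNIV"
  shows "\<Union>F \<noteq> UNIV"
proof -
  have "negligible T" if "T \<in> F" for T
  proof (rule negligible_lowdim)
    have "dim T \<noteq> DIM('a)" using assms(2)[OF that] dim_eq_full[of T] span_eq_iff[of T] by metis
    then show "dim T < DIM('a)" using dim_subset_UNIV[of T] by linarith
  qed
  then have "negligible (\<Union>F)" using assms(1) by (intro negligible_Union) auto
  then show ?thesis using non_negligible_UNIV by metis
qed

text \<open>If the span of the complement were proper, then this span together with \<open>F\<close>
  would be a finite cover by proper subspaces.\<close>

lemma span_compl_union_proper_subspaces:
  fixes F :: "'a::euclidean_space set set"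
  assumes "finite F" and "\<And>T. T \<in> F \<Longrightarrow> subspace T \<and> T \<noteq> UNIV"
  shows "span (- \<Union>F) = UNIV"
proof (rule ccontr)
  assume *: "span (- \<Union>F) \<noteq> UNIV"
  have "\<Union>(insert (span (- \<Union>F)) F) \<noteq> UNIV"
    by (rule finite_union_proper_subspaces) (use assms * in auto)
  then show False using span_superset[of "- \<Union>F"] by auto
qed

lemma generated_mult: "w \<in> generated T \<Longrightarrow> w' \<in> generated T \<Longrightarrow> w ** w' \<in> generated T"
  by (induction rule: generated.induct) (auto intro: generated.mult simp flip: matrix_mul_assoc)

lemma generated_mem: "s \<in> T \<Longrightarrow> s \<in> generated T"
  using generated.mult[OF _ generated.one, of s] by simp

section \<open>Coordinates in an orthonormal frame\<close>

locale coxeter_frame =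
  fixes W :: "(real^'n^'n::finite) set" and B :: "real^'n \<Rightarrow> real^'n \<Rightarrow> real"
    and u :: "'n \<Rightarrow> real^'n" and p :: "'n \<Rightarrow> 'n cpoly"
  assumes W: "coxeter_group W" and inner: "invariant_inner_product W B"
    and onb: "orthonormal B u" and basic: "basic_invariants W p"
begin

lemma W_finite: "finite W" and W_generated: "W = generated {s \<in> W. reflection s}"
  and W_fixed: "(\<And>w. w \<in> W \<Longrightarrow> w *v v = v) \<Longrightarrow> v = 0"
  using W by (auto simp: coxeter_group_def)

lemma W_mult: "w \<in> W \<Longrightarrow> w' \<in> W \<Longrightarrow> w ** w' \<in> W"
  using W_generated generated_mult by metis

lemma W_one: "mat 1 \<in> W"
  using W_generated generated.one by metis

lemma B_linear: "linear (B x)" and B_sym: "B x y = B y x"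
  and B_pos: "x \<noteq> 0 \<Longrightarrow> B x x > 0" and B_inv: "w \<in> W \<Longrightarrow> B (w *v x) (w *v y) = B x y"
  using inner by (auto simp: invariant_inner_product_def)

lemma B_right: "B x (y + z) = B x y + B x z" "B x (c *\<^sub>R y) = c * B x y" "B x (y - z) = B x y - B x z"
  "B x 0 = 0" "B x (- y) = - B x y" "B x (sum f A) = (\<Sum>a\<in>A. B x (f a))"
  using B_linear[of x] by (simp_all add: linear_add linear_scale linear_diff linear_0 linear_neg linear_sum)

lemma B_left: "B (y + z) x = B y x + B z x" "B (c *\<^sub>R y) x = c * B y x" "B (y - z) x = B y x - B z x"
  "B 0 x = 0" "B (- y) x = - B y x" "B (sum f A) x = (\<Sum>a\<in>A. B (f a) x)"
  unfolding B_sym[of _ x] by (rule B_right)+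

lemma B_self_eq_0: "B x x = 0 \<longleftrightarrow> x = 0"
  using B_pos[of x] B_right(4)[of x] by (metis less_irrefl)

lemma B_u: "B (u i) (u j) = (if i = j then 1 else 0)"
  using onb by (simp add: orthonormal_def)

text \<open>Orthonormal vectors are independent, and by counting they span. The expansion holds for
  each \<open>u j\<close> and extends linearly.\<close>

lemma frame_expansion: "x = (\<Sum>k\<in>UNIV. B (u k) x *\<^sub>R u k)"
proof -
  let ?E = "{x. x = (\<Sum>k\<in>UNIV. B (u k) x *\<^sub>R u k)}"
  have u_in: "u j \<in> ?E" for j by (simp add: B_u if_distrib[of "\<lambda>c. c *\<^sub>R _"] cong: if_cong)
  have inj: "inj u" by (rule injI) (metis B_u zero_neq_one)
  have "independent (range u)"
  proof (subst independent_explicit, intro conjI allI impI ballI)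
    fix c v assume 0: "(\<Sum>v\<in>range u. c v *\<^sub>R v) = 0" and "v \<in> range u"
    then obtain j where j: "v = u j" by blast
    have "(\<Sum>k\<in>UNIV. c (u k) *\<^sub>R u k) = 0" using 0 inj by (simp add: sum.reindex)
    then have "B (u j) (\<Sum>k\<in>UNIV. c (u k) *\<^sub>R u k) = 0" by (simp add: B_right)
    then show "c v = 0" by (simp add: B_right B_u j if_distrib cong: if_cong)
  qed simp
  moreover have "card (range u) = dim (UNIV :: (real^'n) set)" using inj by (simp add: card_image)
  ultimately have "UNIV \<subseteq> span (range u)" by (intro card_ge_dim_independent) auto
  then have "x \<in> span (range u)" by blast
  then have "x \<in> ?E"
  proof (induction rule: span_induct)
    case base
    have "c *\<^sub>R x \<in> ?E" if "x \<in> ?E" for c x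
    proof -
      have "x = (\<Sum>k\<in>UNIV. B (u k) x *\<^sub>R u k)" using that by simp
      then show ?thesis
        unfolding mem_Collect_eq B_right(2) scaleR_scaleR[symmetric] scaleR_sum_right[symmetric]
        by (rule arg_cong)
    qed
    moreover have "x + y \<in> ?E" if "x \<in> ?E" "y \<in> ?E" for x y
    proof -
      have "x = (\<Sum>k\<in>UNIV. B (u k) x *\<^sub>R u k)" "y = (\<Sum>k\<in>UNIV. B (u k) y *\<^sub>R u k)"
        using that by simp_all
      then show ?thesis
        unfolding mem_Collect_eq B_right(1) scaleR_left_distrib sum.distrib by (rule arg_cong2)
    qed
    moreover have "0 \<in> ?E" by (simp add: B_right)
    ultimately show ?case unfolding Collect_mem_eq by (intro subspaceI)
  qed (use u_in in auto)
  then show ?thesis by simp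
qed

text \<open>Vectors are identified with linear forms through the inner product. By its invariance,
  pulling back forms corresponds to the action of \<open>W\<close> on vectors, up to inversion
  (\<open>pullback_lf\<close>).\<close>

definition lf :: "real^'n \<Rightarrow> 'n cpoly" where "lf v = linear_form (B v)"

lemma dirder_lf: "dirder v (lf w) = cnst (B w v)"
  by (simp add: lf_def dirder_linear_form B_linear)

lemma lf_eq_0_iff: "lf v = 0 \<longleftrightarrow> v = 0"
  unfolding lf_def linear_form_eq_0_iff[OF B_linear] using B_self_eq_0[of v] B_left(4) by metis

lemma lf_diff: "lf (a - b) = lf a - lf b"
proof -
  have "B (a - b) = (\<lambda>x. B a x - B b x)" by (rule ext) (simp add: B_left)
  then show ?thesis by (simp add: lf_def linear_form_diff)
qed

lemma lf_scale: "lf (c *\<^sub>R a) = cnst c * lf a"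
proof -
  have "B (c *\<^sub>R a) = (\<lambda>x. c * B a x)" by (rule ext) (simp add: B_left)
  then show ?thesis by (simp add: lf_def linear_form_scale)
qed

lemma var_frame: "var j = (\<Sum>k\<in>UNIV. cnst (u k $ j) * lf (u k))"
proof -
  have "linear_form (\<lambda>x. x $ j) = (\<Sum>k\<in>UNIV. cnst (u k $ j) * lf (u k))"
  proof -
    have "x $ j = (\<Sum>k\<in>UNIV. u k $ j * B (u k) x)" for x
      using arg_cong[OF frame_expansion[of x], of "\<lambda>x. x $ j"] by (simp add: mult.commute)
    then have "linear_form (\<lambda>x. x $ j) = linear_form (\<lambda>x. \<Sum>k\<in>UNIV. u k $ j * B (u k) x)"
      by (intro arg_cong[of _ _ linear_form] ext)
    also have "\<dots> = (\<Sum>k\<in>UNIV. cnst (u k $ j) * lf (u k))"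
      by (simp add: linear_form_def lf_def sum_distrib_left sum_distrib_right cnst_sum cnst_mult mult_ac)
        (rule sum.swap)
    finally show ?thesis .
  qed
  moreover have "linear_form (\<lambda>x. x $ j) = (\<Sum>i\<in>UNIV. if i = j then var i else 0)"
    unfolding linear_form_def by (rule sum.cong) (auto simp: axis_def)
  ultimately show ?thesis by simp
qed

lemma pullback_lf: "w \<in> W \<Longrightarrow> pullback w (lf (w *v v)) = lf v"
  by (simp add: lf_def pullback_linear_form B_linear B_inv)

lemma lf_dvd_lf:
  assumes "lf a dvd lf b" obtains c where "b = c *\<^sub>R a"
proof -
  obtain c where "\<forall>x. B b x = c * B a x"
    using linear_form_dvd_linear_form[of "B a" "B b"] assms B_linear unfolding lf_def by blast
  then have "B (b - c *\<^sub>R a) (b - c *\<^sub>R a) = 0" by (simp add: B_left)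
  then have "b = c *\<^sub>R a" by (simp add: B_self_eq_0)
  then show ?thesis by (rule that)
qed

lemma lf_prime: "lf a dvd f * g \<Longrightarrow> lf a dvd f \<or> lf a dvd g"
  unfolding lf_def using linear_form_prime B_linear by blast

lemma lf_prime_prod:
  assumes "finite A" "lf a dvd prod f A" "a \<noteq> 0"
  shows "\<exists>x\<in>A. lf a dvd f x"
  using assms(1,2)
proof induction
  case empty
  \<comment> \<open>A nonzero form is not a unit: 1 remains 1 under the projection onto the
    kernel.\<close>
  have "B a ((1 / B a a) *\<^sub>R a) = 1" using B_self_eq_0 assms(3) by (simp add: B_right)
  then show ?case using empty by (simp add: lf_def linear_form_dvd_iff[OF B_linear])
next
  case (insert x A)
  then show ?case using lf_prime by auto
qed

text \<open>The \<open>lf (u k)\<close> are linear coordinates, and \<open>dirder (u k)\<close> are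
  the corresponding partial derivatives.\<close>

lemma frame_derivation:
  assumes "D \<in> DerS"
  shows "D f = (\<Sum>k\<in>UNIV. D (lf (u k)) * dirder (u k) f)"
proof -
  have "D = (\<lambda>f. \<Sum>k\<in>UNIV. D (lf (u k)) * dirder (u k) f)"
  proof (rule DerS_eqI)
    fix j
    have "D (var j) = (\<Sum>k\<in>UNIV. cnst (u k $ j) * D (lf (u k)))"
      using assms by (subst var_frame) (simp add: DerS_sum DerS_cnst_mult)
    then show "D (var j) = (\<Sum>k\<in>UNIV. D (lf (u k)) * dirder (u k) (var j))"
      by (simp add: mult.commute)
  qed (use assms in \<open>auto intro: DerS_sum_smul dirder_DerS\<close>)
  then show ?thesis by (rule fun_cong)
qed

section \<open>Orbits of vectors and the orbit polynomial\<close>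

definition orbit :: "real^'n \<Rightarrow> (real^'n) set" where "orbit v = (\<lambda>w. w *v v) ` W"

lemma finite_orbit: "finite (orbit v)"
  using W_finite by (simp add: orbit_def)

lemma self_in_orbit: "v \<in> orbit v"
  using W_one image_eqI[of v "\<lambda>w. w *v v" "mat 1"] by (simp add: orbit_def)

lemma W_inj: assumes "w \<in> W" shows "inj ((*v) w)"
proof (rule injI)
  fix x y assume "w *v x = w *v y"
  then have "B (w *v (x - y)) (w *v (x - y)) = 0"
    by (simp add: matrix_vector_mult_diff_distrib B_right)
  then show "x = y" using assms by (simp add: B_inv B_self_eq_0)
qed

lemma orbit_image:
  assumes "w \<in> W" shows "(*v) w ` orbit v = orbit v"
proof (rule endo_inj_surj[OF finite_orbit])
  show "(*v) w ` orbit v \<subseteq> orbit v"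
    using assms W_mult by (auto simp: orbit_def matrix_vector_mul_assoc)
qed (use W_inj[OF assms] inj_on_subset in blast)

text \<open>The value at \<open>v\<close> of the derivative of the orbit polynomial of \<open>v\<close>.\<close>

definition orbit_different :: "real^'n \<Rightarrow> 'n cpoly" where
  "orbit_different v = (\<Prod>\<mu>\<in>orbit v - {v}. lf (v - \<mu>))"

lemma orbit_different_neq_0: "orbit_different v \<noteq> 0"
  by (simp add: orbit_different_def cpoly_prod_eq_0_iff finite_orbit lf_eq_0_iff)

text \<open>The chain rule in a weak form: what matters is that one family \<open>c\<close> serves
  for all derivations \<open>D\<close>.\<close>

lemma derivation_subst:
  "\<exists>c. \<forall>D\<in>DerS. D (subst p q) = (\<Sum>i\<in>UNIV. c i * D (p i))"
proof (induction q rule: cpoly_induct)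
  case (cnst c)
  show ?case by (auto simp: DerS_cnst intro: exI[of _ "\<lambda>_. 0"])
next
  case (var j)
  have *: "D (p j) = (\<Sum>i\<in>UNIV. (if i = j then 1 else 0) * D (p i))" for D :: "'n vfield"
    by (simp add: if_distrib[of "\<lambda>c. c * _"] cong: if_cong)
  then show ?case unfolding subst_var by (intro exI[of _ "\<lambda>i. if i = j then 1 else 0"] ballI) (rule *)
next
  case (add f g)
  then obtain c c' where "\<forall>D\<in>DerS. D (subst p f) = (\<Sum>i\<in>UNIV. c i * D (p i))"
    "\<forall>D\<in>DerS. D (subst p g) = (\<Sum>i\<in>UNIV. c' i * D (p i))" by blast
  then show ?case
    by (intro exI[of _ "\<lambda>i. c i + c' i"]) (auto simp: subst_hom DerS_add algebra_simps sum.distrib)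
next
  case (mult f g)
  then obtain c c' where c: "\<forall>D\<in>DerS. D (subst p f) = (\<Sum>i\<in>UNIV. c i * D (p i))"
    and c': "\<forall>D\<in>DerS. D (subst p g) = (\<Sum>i\<in>UNIV. c' i * D (p i))" by blast
  have "D (subst p (f * g)) = (\<Sum>i\<in>UNIV. (c i * subst p g + subst p f * c' i) * D (p i))"
    if D: "D \<in> DerS" for D
    unfolding subst_mult DerS_mult[OF D] bspec[OF c D] bspec[OF c' D]
    by (simp add: sum_distrib_left sum_distrib_right algebra_simps flip: sum.distrib)
  then show ?case by (intro exI[of _ "\<lambda>i. c i * subst p g + subst p f * c' i"] ballI)
qed

lemma subst_bij: "bij_betw (subst p) UNIV (invariants W)"
  using basic by (simp add: basic_invariants_def)

lemma inj_subst: "inj (subst p)"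
  using subst_bij by (simp add: bij_betw_def)

lemma range_subst: "range (subst p) = invariants W"
  using subst_bij by (simp add: bij_betw_def)

lemma p_invariant: "p i \<in> invariants W"
  using range_subst subst_var[of p i] by (metis rangeI)

lemma derivation_invariant:
  assumes "f \<in> invariants W"
  shows "\<exists>c. \<forall>D\<in>DerS. D f = (\<Sum>i\<in>UNIV. c i * D (p i))"
proof -
  obtain q where "f = subst p q" using assms range_subst by blast
  then show ?thesis using derivation_subst by simp
qed

text \<open>An element of \<open>W\<close> permutes the orbit and hence the linear factors of the
  product.\<close>

lemma orbit_poly_invariant:
  "coeff (\<Prod>\<mu>\<in>orbit v. [:- lf \<mu>, 1:]) n \<in> invariants W"
proof -
  have "pullback w (coeff (\<Prod>\<mu>\<in>orbit v. [:- lf \<mu>, 1:]) n) = coeff (\<Prod>\<mu>\<in>orbit v. [:- lf \<mu>, 1:]) n"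
    if w: "w \<in> W" for w
  proof -
    \<comment> \<open>Pulling back undoes \<open>w\<close> in every root. Since this holds for any
      finite set of roots, induction over the set is possible; stability under \<open>w\<close>
      enters only afterwards, through reindexing.\<close>
    have *: "pullback w (coeff (\<Prod>\<mu>\<in>A. [:- lf (w *v \<mu>), 1:]) n) = coeff (\<Prod>\<mu>\<in>A. [:- lf \<mu>, 1:]) n"
      if "finite A" for A
      using that
    proof (induction A arbitrary: n)
      case (insert a A)
      have "pullback w (coeff [:- lf (w *v a), 1:] i) = coeff [:- lf a, 1:] i" for i
        using w by (auto simp: coeff_pCons pullback_hom pullback_lf split: nat.splits)
      then show ?case using insert by (simp add: coeff_mult pullback_hom del: mult_pCons_left)
    qed simp
    have "(\<Prod>\<mu>\<in>orbit v. [:- lf \<mu>, 1:]) = (\<Prod>\<mu>\<in>(*v) w ` orbit v. [:- lf \<mu>, 1:])"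
      by (simp add: orbit_image w)
    also have "\<dots> = (\<Prod>\<mu>\<in>orbit v. [:- lf (w *v \<mu>), 1:])"
      using W_inj[OF w] by (simp add: prod.reindex inj_on_subset)
    finally show ?thesis using *[OF finite_orbit] by simp
  qed
  then show ?thesis by (simp add: invariants_def)
qed

text \<open>Differentiate the orbit polynomial, whose coefficients are invariant, at its root \<open>lf v\<close>.\<close>

lemma orbit_different_derivation:
  "\<exists>c. \<forall>D\<in>DerS. orbit_different v * D (lf v) = (\<Sum>i\<in>UNIV. c i * D (p i))"
proof -
  define H where "H = (\<Prod>\<mu>\<in>orbit v. [:- lf \<mu>, 1:])"
  define H1 where "H1 = (\<Prod>\<mu>\<in>orbit v - {v}. [:- lf \<mu>, 1:])"
  have H: "H = [:- lf v, 1:] * H1"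
    unfolding H_def H1_def by (rule prod.remove[OF finite_orbit self_in_orbit])
  \<comment> \<open>One more than the degree, so that \<open>coeff H1 N\<close> is 0 and the
    boundary term of the following sum disappears.\<close>
  define N where "N = Suc (degree H1)"
  \<comment> \<open>By the factorization of \<open>H\<close>, the coefficients of \<open>H\<close>
    are differences involving consecutive coefficients of \<open>H1\<close>, so the sum telescopes.
    Its main part becomes the value of \<open>H1\<close> at the root \<open>lf v\<close>.\<close>
  have tele: "(\<Sum>n\<le>m. lf v ^ n * D (coeff H n)) =
      - D (lf v) * (\<Sum>n\<le>m. coeff H1 n * lf v ^ n) - lf v ^ Suc m * D (coeff H1 m)"
    if "D \<in> DerS" for D m
  proof (induction m)
    case 0
    show ?case using that by (simp add: H DerS_uminus DerS_mult algebra_simps)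
  next
    case (Suc m)
    have "coeff H (Suc m) = coeff H1 m - lf v * coeff H1 (Suc m)" by (simp add: H)
    then have DH: "D (coeff H (Suc m)) = D (coeff H1 m) - (D (lf v) * coeff H1 (Suc m) + lf v * D (coeff H1 (Suc m)))"
      using that by (simp only: DerS_diff DerS_mult)
    show ?case unfolding sum.atMost_Suc Suc.IH DH by (simp add: algebra_simps)
  qed
  have "(\<Sum>n\<le>N. coeff H1 n * lf v ^ n) = poly H1 (lf v)"
    by (simp add: N_def poly_altdef coeff_eq_0)
  also have "\<dots> = orbit_different v"
    by (simp add: H1_def orbit_different_def poly_prod lf_diff)
  finally have sum_N: "(\<Sum>n\<le>N. coeff H1 n * lf v ^ n) = orbit_different v" .
  have "coeff H1 N = 0" by (simp add: N_def coeff_eq_0)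
  then have 1: "orbit_different v * D (lf v) = - (\<Sum>n\<le>N. lf v ^ n * D (coeff H n))"
    if "D \<in> DerS" for D
    using tele[OF that, of N] that by (simp add: sum_N DerS_0)
  have "\<forall>n. \<exists>c. \<forall>D\<in>DerS. D (coeff H n) = (\<Sum>i\<in>UNIV. c i * D (p i))"
    unfolding H_def using orbit_poly_invariant derivation_invariant by blast
  then obtain c where c: "\<And>n D. D \<in> DerS \<Longrightarrow> D (coeff H n) = (\<Sum>i\<in>UNIV. c n i * D (p i))"
    by metis
  have "orbit_different v * D (lf v) = (\<Sum>i\<in>UNIV. - (\<Sum>n\<le>N. lf v ^ n * c n i) * D (p i))"
    if "D \<in> DerS" for D
  proof -
    have "(\<Sum>n\<le>N. lf v ^ n * D (coeff H n)) = (\<Sum>n\<le>N. \<Sum>i\<in>UNIV. lf v ^ n * c n i * D (p i))"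
      using that by (simp add: c sum_distrib_left mult.assoc)
    also have "\<dots> = (\<Sum>i\<in>UNIV. \<Sum>n\<le>N. lf v ^ n * c n i * D (p i))" by (rule sum.swap)
    finally show ?thesis using 1[OF that] by (simp add: sum_distrib_right sum_negf)
  qed
  then show ?thesis by (intro exI[of _ "\<lambda>i. - (\<Sum>n\<le>N. lf v ^ n * c n i)"] ballI)
qed

text \<open>This is the injectivity of \<open>tp\<close>: values on the \<open>p i\<close> determine
  each \<open>D (lf v)\<close> up to the nonzero factor \<open>orbit_different v\<close>, which
  cancels.\<close>

lemma DerS_eq_if_eq_on_p:
  assumes D: "D \<in> DerS" "D' \<in> DerS" and eq: "\<And>i. D (p i) = D' (p i)"
  shows "D = D'"
proof
  fix f
  have "D (lf v) = D' (lf v)" for v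
  proof -
    obtain c where "\<forall>D\<in>DerS. orbit_different v * D (lf v) = (\<Sum>i\<in>UNIV. c i * D (p i))"
      using orbit_different_derivation by blast
    then have "orbit_different v * D (lf v) = orbit_different v * D' (lf v)" using D eq by simp
    then show ?thesis by (rule cpoly_mult_cancel_left) (rule orbit_different_neq_0)
  qed
  then show "D f = D' f" by (subst (1 2) frame_derivation) (use D in auto)
qed

section \<open>Reflections and the factors of the orbit different\<close>

text \<open>Defined for every vector \<open>b\<close>, because poles have to be excluded along all
  hyperplanes and not just along the mirrors of \<open>W\<close>.\<close>

definition reflect :: "real^'n \<Rightarrow> real^'n \<Rightarrow> real^'n" where
  "reflect b x = x - (2 * B b x / B b b) *\<^sub>R b"

lemma linear_reflect: "linear (reflect b)"
  by (rule linearI) (simp_all add: reflect_def B_right algebra_simps add_divide_distrib)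

text \<open>The derivative of an invariant along the normal \<open>b\<close> changes sign under the
  reflection, since \<open>b\<close> does. It therefore vanishes on the mirror.\<close>

lemma lf_dvd_dirder_invariant:
  assumes b: "b \<noteq> 0" and w: "w \<in> W" "\<And>x. w *v x = reflect b x" and f: "f \<in> invariants W"
  shows "lf b dvd dirder b f"
proof -
  define g where "g = dirder b f"
  define P where "P = kernel_projection (B b) ((1 / B b b) *\<^sub>R b)"
  have Bb: "B b b \<noteq> 0" using b B_self_eq_0 by simp
  have Px: "P *v x = x - (B b x / B b b) *\<^sub>R b" for x
    unfolding P_def using Bb by (simp add: kernel_projection_vector B_linear)
  have "w *v b = - b" using Bb by (simp add: w(2) reflect_def scaleR_2)
  moreover have "pullback w f = f" using f w(1) by (simp add: invariants_def)
  ultimately have "g = pullback w (dirder (- b) f)" using dirder_pullback[of b w f] by (simp add: g_def)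
  also have "dirder (- b) f = - g"
    using dirder_scale[of "-1" b f] by (simp add: g_def cnst_uminus)
  finally have g: "pullback w g = - g" by (metis minus_minus pullback_hom(3))
  have "w *v (P *v x) = P *v x" for x
    using Bb by (simp add: w(2) reflect_def Px B_right)
  then have "w ** P = P" by (simp add: matrix_eq matrix_vector_mul_assoc[symmetric])
  \<comment> \<open>The reflection is the identity on the mirror, so \<open>g\<close> and its
    pullback, which is \<open>- g\<close>, have the same restriction there.\<close>
  then have "pullback P g = pullback P (pullback w g)" by (simp add: pullback_pullback)
  then have "pullback P g + pullback P g = 0" by (simp add: g pullback_hom eq_neg_iff_add_eq_0)
  moreover have "cnst 2 = (2 :: 'n cpoly)" by (metis cnst_1 cnst_add one_add_one)
  ultimately have "cnst 2 * pullback P g = 0" by simp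
  then have "pullback P g = 0" by (simp add: cpoly_mult_eq_0_iff)
  moreover have "B b ((1 / B b b) *\<^sub>R b) = 1" using Bb by (simp add: B_right)
  ultimately show ?thesis by (simp add: lf_def linear_form_dvd_iff[OF B_linear] P_def g_def)
qed

text \<open>If \<open>w *v v\<close> is \<open>v - c *\<^sub>R b\<close>, equality of the norms is a
  quadratic equation for \<open>c\<close>, whose roots are the two cases.\<close>

lemma lf_dvd_lf_orbit:
  assumes w: "w \<in> W" and "lf b dvd lf (v - w *v v)"
  shows "w *v v = v \<or> w *v v = reflect b v"
proof (cases "b = 0")
  case True
  then show ?thesis using assms(2) lf_eq_0_iff by (metis dvd_0_left_iff eq_iff_diff_eq_0)
next
  case False
  then have Bb: "B b b \<noteq> 0" using B_self_eq_0 by simp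
  obtain c where c: "v - w *v v = c *\<^sub>R b" using assms(2) lf_dvd_lf by blast
  then have wv: "w *v v = v - c *\<^sub>R b" by (simp add: algebra_simps)
  have "B (w *v v) (w *v v) = B v v" using w by (rule B_inv)
  then have "c * (c * B b b - 2 * B b v) = 0"
    unfolding wv by (simp add: B_left B_right B_sym[of v b] algebra_simps)
  then have "c = 0 \<or> c = 2 * B b v / B b b" using Bb by (auto simp: field_simps)
  then show ?thesis by (auto simp: wv reflect_def)
qed

text \<open>By primality the form divides a single factor, which can only come from the point
  \<open>reflect b v\<close>. Taking \<open>A\<close> without this point shows that
  \<open>lf b\<close> occurs at most once in \<open>orbit_different v\<close>.\<close>

lemma lf_dvd_orbit_different:
  assumes "b \<noteq> 0" "A \<subseteq> orbit v - {v}" "lf b dvd (\<Prod>\<mu>\<in>A. lf (v - \<mu>))"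
  shows "reflect b v \<in> A"
proof -
  have "finite A" using assms(2) finite_orbit finite_subset by blast
  then obtain \<mu> where "\<mu> \<in> A" "lf b dvd lf (v - \<mu>)" using lf_prime_prod[OF _ assms(3,1)] by blast
  moreover from this assms(2) obtain w where "w \<in> W" "\<mu> = w *v v" "\<mu> \<noteq> v" by (auto simp: orbit_def)
  ultimately show ?thesis using lf_dvd_lf_orbit[of w b v] by auto
qed

section \<open>Lifting self-adjoint endomorphisms\<close>

text \<open>Each \<open>w\<close> agrees with \<open>reflect b\<close> on a proper subspace only.
  The finitely many subspaces leave enough vectors to span.\<close>

lemma span_not_reflect:
  assumes b: "b \<noteq> 0" and no_reflect: "\<And>w. w \<in> W \<Longrightarrow> \<exists>x. w *v x \<noteq> reflect b x"
  shows "span {v. \<forall>w\<in>W. w *v v \<noteq> reflect b v} = UNIV"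
proof -
  let ?F = "(\<lambda>w. {v. w *v v = reflect b v}) ` W"
  have "span (- \<Union>?F) = UNIV"
  proof (rule span_compl_union_proper_subspaces)
    fix T assume "T \<in> ?F"
    then obtain w where w: "w \<in> W" "T = {v. w *v v = reflect b v}" by blast
    have "subspace T"
      unfolding w(2) using linear_reflect[of b]
      by (intro subspaceI)
        (auto simp: linear_0 linear_add linear_scale matrix_vector_right_distrib
          matrix_vector_mult_scaleR)
    then show "subspace T \<and> T \<noteq> UNIV" using no_reflect[OF w(1)] w(2) by auto
  qed (use W_finite in simp)
  moreover have "- \<Union>?F = {v. \<forall>w\<in>W. w *v v \<noteq> reflect b v}" by auto
  ultimately show ?thesis by simp
qed

section \<open>The Jacobian and its inverse up to a denominator\<close>

definition jacobian :: "'n cpoly^'n^'n" where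
  "jacobian = (\<chi> i l. dirder (u l) (p i))"

text \<open>Clears the denominators of all rows of the inverse Jacobian at once.\<close>

definition common_denominator :: "'n cpoly" where
  "common_denominator = (\<Prod>k\<in>UNIV. orbit_different (u k))"

lemma common_denominator_neq_0: "common_denominator \<noteq> 0"
  by (simp add: common_denominator_def cpoly_prod_eq_0_iff orbit_different_neq_0)

lemma jacobian_inverse:
  obtains X where "X ** jacobian = mat common_denominator" "jacobian ** X = mat common_denominator"
proof -
  obtain c where c: "\<And>v D. D \<in> DerS \<Longrightarrow> orbit_different v * D (lf v) = (\<Sum>i\<in>UNIV. c v i * D (p i))"
    using orbit_different_derivation by metis
  \<comment> \<open>Row \<open>k\<close> consists of the coefficients for \<open>lf (u k)\<close>,
    which carry the denominator \<open>orbit_different (u k)\<close>, multiplied by the denominators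
    of the other rows.\<close>
  define X where "X = (\<chi> k i. (\<Prod>j\<in>UNIV - {k}. orbit_different (u j)) * c (u k) i)"
  have "(\<Sum>i\<in>UNIV. (\<Prod>j\<in>UNIV - {k}. orbit_different (u j)) * c (u k) i * dirder (u l) (p i))
      = (if k = l then common_denominator else 0)" for k l
  proof -
    have "(\<Sum>i\<in>UNIV. (\<Prod>j\<in>UNIV - {k}. orbit_different (u j)) * c (u k) i * dirder (u l) (p i))
      = (\<Prod>j\<in>UNIV - {k}. orbit_different (u j)) * (orbit_different (u k) * cnst (B (u k) (u l)))"
      unfolding dirder_lf[symmetric] c[OF dirder_DerS] by (simp add: sum_distrib_left mult.assoc)
    also have "\<dots> = (if k = l then common_denominator else 0)"
      by (simp add: B_u common_denominator_def prod.remove[of UNIV k] mult_ac)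
    finally show ?thesis .
  qed
  then have "X ** jacobian = mat common_denominator"
    by (simp add: vec_eq_iff X_def jacobian_def matrix_matrix_mult_def mat_def)
  then show ?thesis
    using cpoly_left_right_inverse common_denominator_neq_0 that by blast
qed

text \<open>The multiplication by \<open>M\<close> along the quotient map lifts to vector fields on
  \<open>V\<close> when J^-1 M J is polynomial, that is, when \<open>?d\<close> divides every entry
  of \<open>Y\<close>. The hypothesis \<open>sym\<close> reads M K = K M^T for the Gram matrix
  K.\<close>

lemma selfadjoint_lifts:
  assumes sym: "\<And>i j. (\<Sum>k\<in>UNIV. M i k * gstar u p k j) = (\<Sum>k\<in>UNIV. gstar u p i k * M j k)"
    and D: "D \<in> DerS"
  shows "\<exists>D'\<in>DerS. \<forall>i. D' (p i) = (\<Sum>k\<in>UNIV. M i k * D (p k))"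
proof -
  let ?J = jacobian and ?d = common_denominator
  obtain X where XJ: "X ** ?J = mat ?d" and JX: "?J ** X = mat ?d" using jacobian_inverse by blast
  define M' where "M' = (\<chi> i j. M i j)"
  define Y where "Y = X ** M' ** ?J"
  have K: "?J ** transpose ?J = (\<chi> i j. gstar u p i j)"
    by (simp add: jacobian_def matrix_matrix_mult_def transpose_def gstar_def)
  have MK: "M' ** (?J ** transpose ?J) = ?J ** transpose ?J ** transpose M'"
    unfolding K by (simp add: M'_def matrix_matrix_mult_def transpose_def sym)
  have mat_left: "(mat ?d ** A) $ i $ j = ?d * A $ i $ j" for A :: "'n cpoly^'n^'n" and i j
    by (simp add: matrix_matrix_mult_def mat_def if_distrib[of "\<lambda>c. c * _"] cong: if_cong)
  have mat_right: "(A ** mat ?d) $ i $ j = ?d * A $ i $ j" for A :: "'n cpoly^'n^'n" and i j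
    by (simp add: matrix_matrix_mult_def mat_def if_distrib[of "\<lambda>c. _ * c"] mult.commute cong: if_cong)
  have mat_comm: "mat ?d ** A = A ** mat ?d" for A :: "'n cpoly^'n^'n"
    by (simp add: vec_eq_iff mat_left mat_right)
  have JY: "?J ** Y = mat ?d ** (M' ** ?J)"
    unfolding Y_def by (simp add: matrix_mul_assoc JX)
  have JY_nth: "(?J ** Y) $ i $ l = ?d * (\<Sum>k\<in>UNIV. M i k * dirder (u l) (p k))" for i l
    unfolding JY mat_left by (simp add: matrix_matrix_mult_def M'_def jacobian_def)
  \<comment> \<open>Symmetry of \<open>Y\<close> is obtained after multiplication by
    \<open>transpose ?J\<close>. Multiplying further by \<open>transpose X\<close> leaves only the
    nonzero scalar \<open>?d\<close>, which cancels.\<close>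
  have "transpose Y ** transpose ?J = Y ** transpose ?J"
  proof -
    have "Y ** transpose ?J = X ** (M' ** (?J ** transpose ?J))"
      by (simp add: Y_def matrix_mul_assoc)
    also have "\<dots> = mat ?d ** (transpose ?J ** transpose M')"
      unfolding MK by (simp add: matrix_mul_assoc XJ)
    also have "\<dots> = transpose (M' ** ?J) ** transpose (mat ?d)"
      by (simp add: matrix_transpose_mul mat_comm transpose_mat)
    also have "\<dots> = transpose Y ** transpose ?J"
      by (metis JY matrix_transpose_mul)
    finally show ?thesis by simp
  qed
  then have "transpose Y ** (transpose ?J ** transpose X) = Y ** (transpose ?J ** transpose X)"
    by (simp add: matrix_mul_assoc)
  then have "transpose Y ** mat ?d = Y ** mat ?d"
    by (simp add: XJ transpose_mat flip: matrix_transpose_mul)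
  then have "?d * transpose Y $ i $ j = ?d * Y $ i $ j" for i j
    by (metis mat_right)
  then have "transpose Y $ i $ j = Y $ i $ j" for i j
    by (rule cpoly_mult_cancel_left) (rule common_denominator_neq_0)
  then have Ysym: "Y $ j $ i = Y $ i $ j" for i j by (simp add: transpose_def)

  \<comment> \<open>The bilinear form with matrix \<open>Y\<close>, evaluated at arbitrary vectors,
    so that rows can be taken along a vector suited to a given hyperplane. The field
    \<open>E v\<close> has \<open>y a v\<close> as its derivative of \<open>lf a\<close>; its image
    under \<open>tp\<close> is \<open>?d\<close> times \<open>M\<close> applied to that of the
    derivative along \<open>v\<close>.\<close>
  define y where "y a v = (\<Sum>k\<in>UNIV. \<Sum>l\<in>UNIV. cnst (B (u k) a) * cnst (B (u l) v) * Y $ k $ l)" for a v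
  define E where "E v = (\<lambda>f. \<Sum>k\<in>UNIV. (\<Sum>l\<in>UNIV. cnst (B (u l) v) * Y $ k $ l) * dirder (u k) f)" for v
  have E_DerS: "E v \<in> DerS" for v unfolding E_def by (intro DerS_sum_smul dirder_DerS)
  have E_lf: "E v (lf a) = y a v" for a v
    by (simp add: E_def y_def dirder_lf sum_distrib_left sum_distrib_right B_sym[of a] mult_ac)
  have y_sym: "y a v = y v a" for a v
    unfolding y_def by (subst sum.swap) (rule sum.cong[OF refl], rule sum.cong[OF refl], subst Ysym, simp add: mult_ac)
  have y_add: "y (a + b) v = y a v + y b v" and y_scale: "y (c *\<^sub>R a) v = cnst c * y a v" for a b v c
    by (simp_all add: y_def B_right cnst_add cnst_mult algebra_simps sum.distrib sum_distrib_left)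
  have E_p: "E v (p i) = ?d * (\<Sum>k\<in>UNIV. M i k * dirder v (p k))" for v i
  proof -
    have "E v (p i) = (\<Sum>l\<in>UNIV. cnst (B (u l) v) * (?J ** Y) $ i $ l)"
      unfolding E_def by (simp add: jacobian_def matrix_matrix_mult_def sum_distrib_left sum_distrib_right mult_ac)
        (rule sum.swap)
    also have "\<dots> = ?d * (\<Sum>l\<in>UNIV. cnst (B (u l) v) * (\<Sum>k\<in>UNIV. M i k * dirder (u l) (p k)))"
      by (simp add: JY_nth sum_distrib_left mult_ac)
    also have "(\<Sum>l\<in>UNIV. cnst (B (u l) v) * (\<Sum>k\<in>UNIV. M i k * dirder (u l) (p k)))
        = (\<Sum>k\<in>UNIV. M i k * dirder (\<Sum>l\<in>UNIV. B (u l) v *\<^sub>R u l) (p k))"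
      by (simp add: dirder_vsum dirder_scale sum_distrib_left mult_ac) (rule sum.swap)
    finally show ?thesis by (simp flip: frame_expansion)
  qed

  \<comment> \<open>For \<open>b\<close> nonzero this says that \<open>f / ?d\<close> has no pole
    along the hyperplane orthogonal to \<open>b\<close>, or that it lies in the localization at the
    prime \<open>lf b\<close>.\<close>
  define good where "good b f \<longleftrightarrow> (\<exists>g. \<not> lf b dvd g \<and> ?d dvd g * f)" for b f
  have good_add: "good b (f + g)" if fg: "good b f" "good b g" for b f g
  proof -
    obtain s t where st: "\<not> lf b dvd s" "?d dvd s * f" "\<not> lf b dvd t" "?d dvd t * g"
      using fg unfolding good_def by blast
    have "?d dvd t * (s * f) + s * (t * g)" using st by (simp add: dvd_add)
    then have "?d dvd (s * t) * (f + g)" by (simp add: algebra_simps)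
    then show ?thesis using st lf_prime unfolding good_def by blast
  qed
  have good_mult: "good b (h * f)" if "good b f" for b h f
    using that unfolding good_def by (metis dvd_mult mult.left_commute)
  \<comment> \<open>Apply the relation for \<open>lf a\<close> to \<open>E v\<close>, whose values
    on the \<open>p i\<close> are all divisible by \<open>?d\<close>.\<close>
  have y_F: "?d dvd orbit_different a * y a v" for a v
  proof -
    obtain c where c: "\<forall>D\<in>DerS. orbit_different a * D (lf a) = (\<Sum>i\<in>UNIV. c i * D (p i))"
      using orbit_different_derivation by blast
    have "orbit_different a * y a v = (\<Sum>i\<in>UNIV. c i * E v (p i))"
      using bspec[OF c E_DerS[of v]] by (simp add: E_lf)
    then show ?thesis by (simp add: E_p dvd_sum dvd_mult)
  qed
  \<comment> \<open>The hypothesis excludes \<open>reflect b a\<close> as a further point of the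
    orbit, so \<open>lf b\<close> does not divide the denominator of the row
    \<open>a\<close>.\<close>
  have y_good_generic: "good b (y a v)" if "b \<noteq> 0" and "\<And>w. w \<in> W \<Longrightarrow> w *v a = reflect b a \<Longrightarrow> w *v a = a"
    for a b v
  proof -
    have "reflect b a \<notin> orbit a - {a}" using that(2) unfolding orbit_def by (metis DiffE imageE insertI1)
    then have "\<not> lf b dvd orbit_different a"
      unfolding orbit_different_def using lf_dvd_orbit_different[OF \<open>b \<noteq> 0\<close> subset_refl] by blast
    then show ?thesis using y_F unfolding good_def by blast
  qed
  have y_good_span: "good b (y a v)" if "b \<noteq> 0" and a: "a \<in> span G" and "\<And>a. a \<in> G \<Longrightarrow> good b (y a v)"
    for a b v G
    using a
  proof (induction rule: span_induct)
    case base
    have "\<not> lf b dvd 1"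
      using lf_prime_prod[of "{}" b "\<lambda>_. 1"] \<open>b \<noteq> 0\<close> by auto
    moreover have "y 0 v = 0" using y_scale[of 0 0 v] by simp
    ultimately have "good b (y 0 v)" unfolding good_def by (intro exI[of _ 1]) simp
    then show ?case by (auto intro!: subspaceI good_add good_mult simp: y_add y_scale)
  qed (use that in auto)
  have y_good: "good b (y a v)" if b: "b \<noteq> 0" for a b v
  proof (cases "\<exists>w\<in>W. \<forall>x. w *v x = reflect b x")
    case False
    \<comment> \<open>When the hyperplane is not a mirror, the rows without a pole belong to
      spanning vectors, and linearity in \<open>a\<close> gives the rest.\<close>
    then have "a \<in> span {v. \<forall>w\<in>W. w *v v \<noteq> reflect b v}"
      using span_not_reflect[OF b] by auto
    then show ?thesis
    proof (rule y_good_span[OF b])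
      fix a assume "a \<in> {v. \<forall>w\<in>W. w *v v \<noteq> reflect b v}"
      then show "good b (y a v)" by (intro y_good_generic[OF b]) auto
    qed
  next
    case True
    then obtain w where w: "w \<in> W" "\<And>x. w *v x = reflect b x" by blast
    have Bb: "B b b \<noteq> 0" using b B_self_eq_0 by simp
    \<comment> \<open>By symmetry the row of the normal \<open>b\<close> is the column of
      \<open>b\<close>. In the case of a pole, the denominator \<open>orbit_different v\<close>
      contains \<open>lf b\<close> just once; it cancels against the factor \<open>lf b\<close> of
      the normal derivatives of the invariants.\<close>
    have y_b: "good b (y b v)" for v
    proof (cases "reflect b v = v")
      case True
      then show ?thesis unfolding y_sym[of b] using b by (intro y_good_generic) auto
    next
      case False
      define c where "c = 2 * B b v / B b b"
      have c: "v - reflect b v = c *\<^sub>R b" by (simp add: reflect_def c_def)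
      then have "c \<noteq> 0" using False by auto
      define r where "r = (\<Prod>\<mu>\<in>orbit v - {v} - {reflect b v}. lf (v - \<mu>))"
      have r: "\<not> lf b dvd r"
        unfolding r_def using lf_dvd_orbit_different[OF b, of "orbit v - {v} - {reflect b v}" v] by auto
      have "reflect b v \<in> orbit v - {v}" using w False by (auto simp: orbit_def simp flip: w(2))
      then have F: "orbit_different v = lf b * (cnst c * r)"
        unfolding orbit_different_def r_def
        by (subst prod.remove[of _ "reflect b v"]) (auto simp: finite_orbit c lf_scale)
      have "\<forall>k. \<exists>g. dirder b (p k) = lf b * g"
        using lf_dvd_dirder_invariant[OF b w(1) w(2) p_invariant] by (auto elim: dvdE)
      then obtain g where g: "\<And>k. dirder b (p k) = lf b * g k" by metis
      obtain e where e: "\<forall>D\<in>DerS. orbit_different v * D (lf v) = (\<Sum>i\<in>UNIV. e i * D (p i))"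
        using orbit_different_derivation by blast
      have "lf b * (cnst c * r * y v b) = orbit_different v * y v b" by (simp add: F mult_ac)
      also have "\<dots> = lf b * (?d * (\<Sum>i\<in>UNIV. e i * (\<Sum>k\<in>UNIV. M i k * g k)))"
        using bspec[OF e E_DerS[of b]] by (simp add: E_lf E_p g sum_distrib_left mult_ac)
      finally have *: "cnst c * r * y v b = ?d * (\<Sum>i\<in>UNIV. e i * (\<Sum>k\<in>UNIV. M i k * g k))"
        by (rule cpoly_mult_cancel_left) (simp add: lf_eq_0_iff b)
      have "cnst (1 / complex_of_real c) * cnst c = (1 :: 'n cpoly)"
        using \<open>c \<noteq> 0\<close> by (simp flip: cnst_mult)
      then have "r * y v b = cnst (1 / complex_of_real c) * cnst c * (r * y v b)" by simp
      also have "\<dots> = cnst (1 / complex_of_real c) * (cnst c * r * y v b)" by (simp add: mult.assoc)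
      finally have "r * y v b = cnst (1 / complex_of_real c) * (cnst c * r * y v b)" .
      then have "?d dvd r * y v b" unfolding * by simp
      then show ?thesis using r unfolding y_sym[of b] good_def by blast
    qed
    \<comment> \<open>The component of \<open>a\<close> orthogonal to \<open>b\<close> is fixed by
      \<open>reflect b\<close>, hence generic; the remaining component is a multiple of
      \<open>b\<close>.\<close>
    have "good b (y (a - (B b a / B b b) *\<^sub>R b) v)"
      using b Bb by (intro y_good_generic) (auto simp: reflect_def B_right)
    moreover have "good b (y ((B b a / B b b) *\<^sub>R b) v)"
      unfolding y_scale by (intro good_mult y_b)
    ultimately have "good b (y (a - (B b a / B b b) *\<^sub>R b + (B b a / B b b) *\<^sub>R b) v)"
      unfolding y_add by (rule good_add)
    then show ?thesis by simp
  qed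

  have "?d dvd y a v" for a v
  proof -
    \<comment> \<open>The denominator is flattened to one product of linear forms indexed by pairs.
      Proportional factors may occur several times, which the local criterion allows.\<close>
    let ?A = "Sigma UNIV (\<lambda>k. orbit (u k) - {u k})"
    define \<phi> where "\<phi> = (\<lambda>(k, \<mu>). B (u k - \<mu>))"
    have lf_\<phi>: "linear_form (\<phi> x) = lf (u (fst x) - snd x)" for x
      by (auto simp: \<phi>_def lf_def split: prod.splits)
    have d: "?d = (\<Prod>x\<in>?A. linear_form (\<phi> x))"
      unfolding common_denominator_def orbit_different_def lf_\<phi>
      by (subst prod.Sigma) (auto simp: finite_orbit split_def)
    show ?thesis unfolding d
    proof (rule prod_linear_forms_dvd_local)
      fix x assume x: "x \<in> ?A"
      then have nz: "u (fst x) - snd x \<noteq> 0" by auto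
      then show "linear_form (\<phi> x) \<noteq> 0" by (simp add: lf_\<phi> lf_eq_0_iff)
      show "\<exists>b. \<not> linear_form (\<phi> x) dvd b \<and> (\<Prod>x\<in>?A. linear_form (\<phi> x)) dvd b * y a v"
        using y_good[OF nz, of a v] unfolding good_def d lf_\<phi> .
      show "linear (\<phi> x)" by (auto simp: \<phi>_def B_linear split: prod.splits)
    qed (auto simp: finite_orbit)
  qed
  moreover have "y (u k) (u l) = Y $ k $ l" for k l
  proof -
    have 1: "cnst (B (u i) (u k)) * cnst (B (u j) (u l)) * Y $ i $ j
        = (if i = k then if j = l then Y $ i $ j else 0 else 0)" for i j
      by (simp add: B_u)
    have 2: "(\<Sum>j\<in>UNIV. if i = k then if j = l then Y $ i $ j else 0 else 0)
        = (if i = k then Y $ i $ l else 0)" for i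
      by simp
    have "y (u k) (u l) = (\<Sum>i\<in>UNIV. if i = k then Y $ i $ l else 0)"
      unfolding y_def 1 2 ..
    then show ?thesis by simp
  qed
  ultimately have "\<exists>z. Y $ k $ l = ?d * z" for k l by (metis dvdE)
  then obtain Z where Z: "\<And>k l. Y $ k $ l = ?d * Z k l" by metis

  \<comment> \<open>The matrix \<open>Z\<close> is the polynomial matrix J^-1 M J, here applied to
    the components of \<open>D\<close> in the frame.\<close>
  define D' where "D' = (\<lambda>f. \<Sum>k\<in>UNIV. (\<Sum>l\<in>UNIV. D (lf (u l)) * Z k l) * dirder (u k) f)"
  have "D' (p i) = (\<Sum>k\<in>UNIV. M i k * D (p k))" for i
  proof -
    have JZ: "(\<Sum>k\<in>UNIV. Z k l * dirder (u k) (p i)) = (\<Sum>k\<in>UNIV. M i k * dirder (u l) (p k))" for l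
    proof -
      have "?d * (\<Sum>k\<in>UNIV. Z k l * dirder (u k) (p i)) = (?J ** Y) $ i $ l"
        by (simp add: matrix_matrix_mult_def jacobian_def Z sum_distrib_left mult_ac)
      also have "\<dots> = ?d * (\<Sum>k\<in>UNIV. M i k * dirder (u l) (p k))"
        by (rule JY_nth)
      finally show ?thesis by (rule cpoly_mult_cancel_left) (rule common_denominator_neq_0)
    qed
    have "D' (p i) = (\<Sum>k\<in>UNIV. \<Sum>l\<in>UNIV. D (lf (u l)) * (Z k l * dirder (u k) (p i)))"
      by (simp add: D'_def sum_distrib_right mult.assoc)
    also have "\<dots> = (\<Sum>l\<in>UNIV. D (lf (u l)) * (\<Sum>k\<in>UNIV. Z k l * dirder (u k) (p i)))"
      by (subst sum.swap) (simp add: sum_distrib_left)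
    also have "\<dots> = (\<Sum>l\<in>UNIV. \<Sum>k\<in>UNIV. M i k * (D (lf (u l)) * dirder (u l) (p k)))"
      unfolding JZ by (simp add: sum_distrib_left mult_ac)
    also have "\<dots> = (\<Sum>k\<in>UNIV. M i k * (\<Sum>l\<in>UNIV. D (lf (u l)) * dirder (u l) (p k)))"
      by (subst sum.swap) (simp add: sum_distrib_left)
    also have "\<dots> = (\<Sum>k\<in>UNIV. M i k * D (p k))"
      by (intro sum.cong arg_cong2[of _ _ _ _ "(*)"] refl) (rule frame_derivation[OF D, symmetric])
    finally show ?thesis .
  qed
  moreover have "D' \<in> DerS" unfolding D'_def by (intro DerS_sum_smul dirder_DerS)
  ultimately show ?thesis by blast
qed

section \<open>Irreducible summands and vector fields on the quotient\<close>

text \<open>\<open>generated\<close> provides only a monoid; as the generators are involutions,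
  reversing a word inverts it.\<close>

lemma W_inverse: "w \<in> W \<Longrightarrow> \<exists>w'\<in>W. w ** w' = mat 1"
proof -
  have "\<exists>w'\<in>generated T. w ** w' = mat 1"
    if "w \<in> generated T" and inv: "\<And>s. s \<in> T \<Longrightarrow> s ** s = mat 1" for w and T :: "(real^'n^'n) set"
    using that(1)
  proof induction
    case one
    show ?case using generated.one by auto
  next
    case (mult s w)
    then obtain w' where "w' \<in> generated T" "w ** w' = mat 1" by blast
    moreover from this have "s ** w ** (w' ** s) = mat 1"
      using inv[OF mult.hyps(1)] matrix_mul_assoc[of "s ** w" w' s] matrix_mul_assoc[of s w w'] by simp
    ultimately show ?case using generated_mult generated_mem mult.hyps(1) by blast
  qed
  then show "w \<in> W \<Longrightarrow> \<exists>w'\<in>W. w ** w' = mat 1"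
    using W_generated by (metis (no_types, lifting) mem_Collect_eq reflection_def)
qed

lemma W_fixes_if_reflections_fix:
  assumes "\<And>s. s \<in> W \<Longrightarrow> reflection s \<Longrightarrow> s *v x = x"
  shows "x = 0"
proof (rule W_fixed)
  fix w assume "w \<in> W"
  then have "w \<in> generated {s \<in> W. reflection s}" using W_generated by simp
  then show "w *v x = x"
    by induction (use assms in \<open>auto simp flip: matrix_vector_mul_assoc\<close>)
qed

lemma irreducible_summand_subspace: "irreducible_summand W U \<Longrightarrow> subspace U"
  and irreducible_summand_closed: "irreducible_summand W U \<Longrightarrow> w \<in> W \<Longrightarrow> x \<in> U \<Longrightarrow> w *v x \<in> U"
  by (auto simp: irreducible_summand_def)

lemma irreducible_summand_Int:
  assumes "irreducible_summand W U" "irreducible_summand W U'" "U \<noteq> U'"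
  shows "U \<inter> U' = {0}"
proof -
  have "subspace (U \<inter> U')"
    using assms(1,2) by (intro subspace_inter) (auto simp: irreducible_summand_def)
  moreover have "\<forall>w\<in>W. (*v) w ` (U \<inter> U') \<subseteq> U \<inter> U'"
    using assms(1,2) unfolding irreducible_summand_def by blast
  ultimately have "U \<inter> U' = {0} \<or> U \<inter> U' = U" "U \<inter> U' = {0} \<or> U \<inter> U' = U'"
    using assms unfolding irreducible_summand_def by (meson inf_le1, meson inf_le2)
  then show ?thesis using assms(3) by auto
qed

text \<open>The \<open>(-1)\<close>-eigenspace of a reflection is a line, so it cannot meet both summands.\<close>

lemma reflection_fixes_summand:
  assumes U: "irreducible_summand W U" "irreducible_summand W U'" "U \<noteq> U'"
    and s: "s \<in> W" "reflection s" and x: "x \<in> U" "s *v x \<noteq> x" and y: "y \<in> U'"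
  shows "s *v y = y"
proof (rule ccontr)
  assume y': "s *v y \<noteq> y"
  have sub: "subspace U" "subspace U'" and inv: "s *v x \<in> U" "s *v y \<in> U'"
    using U s x y by (simp_all add: irreducible_summand_subspace irreducible_summand_closed)
  have ss: "s *v (s *v z) = z" for z
    using s(2) by (simp add: reflection_def matrix_vector_mul_assoc)
  \<comment> \<open>Both differences are nonzero vectors of the (-1)-eigenspace \<open>F\<close>.
    Since the summands meet only in 0 they are independent, which contradicts the dimension of the
    fixed space \<open>E\<close>.\<close>
  define a b where "a = x - s *v x" and "b = y - s *v y"
  have ab: "a \<in> U" "b \<in> U'" "a \<noteq> 0" "b \<noteq> 0"
    using x y y' sub inv by (auto simp: a_def b_def subspace_diff)
  define E where "E = {v. s *v v = v}"
  define F where "F = {v. s *v v = - v}"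
  have EF: "subspace E" "subspace F"
    unfolding E_def F_def
    by (auto intro!: subspaceI simp: matrix_vector_right_distrib matrix_vector_mult_scaleR)
  have "E \<inter> F \<subseteq> {0}"
  proof
    fix z assume "z \<in> E \<inter> F"
    then have 1: "s *v z = z" and 2: "s *v z = - z" unfolding E_def F_def by blast+
    have "z = - z" using 1[symmetric] 2 by (rule trans)
    then have "z + z = 0" by (simp only: eq_neg_iff_add_eq_0)
    then have "2 *\<^sub>R z = 0" by (simp only: scaleR_2)
    then show "z \<in> {0}" by simp
  qed
  have "a \<in> F" "b \<in> F"
    by (auto simp: F_def a_def b_def matrix_vector_mult_diff_distrib ss)
  moreover have "a \<notin> span {b}"
  proof
    assume "a \<in> span {b}"
    then have "a \<in> U'" using ab sub by (metis empty_subsetI insert_subset span_minimal subsetD)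
    then show False using irreducible_summand_Int[OF U] ab by blast
  qed
  then have "independent {a, b}" "a \<noteq> b"
    using ab by (auto simp: independent_insert span_base)
  ultimately have "2 \<le> dim F"
    using independent_card_le_dim[of "{a, b}" F] by simp
  moreover have "dim {x + y |x y. x \<in> E \<and> y \<in> F} + dim (E \<inter> F) = dim E + dim F"
    using EF by (intro dim_sums_Int)
  moreover have "dim {x + y |x y. x \<in> E \<and> y \<in> F} \<le> CARD('n)"
    using dim_subset_UNIV[of "{x + y |x y. x \<in> E \<and> y \<in> F}"] by simp
  moreover have "dim E + 1 = CARD('n)" using s(2) by (simp add: reflection_def E_def)
  moreover have "dim (E \<inter> F) = 0" using \<open>E \<inter> F \<subseteq> {0}\<close> by simp
  ultimately show False by simp
qed

text \<open>The part of \<open>U\<close> orthogonal to \<open>U'\<close> is invariant, so it is 0 or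
  \<open>U\<close>. A reflection moving some \<open>x\<close> in \<open>U\<close> fixes
  \<open>U'\<close> and makes \<open>x - s *v x\<close> a nonzero element of this part. If the part
  were 0, all reflections would therefore fix \<open>U\<close>, forcing \<open>U\<close> to be
  0.\<close>

lemma irreducible_summands_orthogonal:
  assumes U: "irreducible_summand W U" "irreducible_summand W U'" "U \<noteq> U'"
    and x: "x \<in> U" and y: "y \<in> U'"
  shows "B x y = 0"
proof -
  let ?U0 = "{x \<in> U. \<forall>y\<in>U'. B x y = 0}"
  have "subspace ?U0"
    using irreducible_summand_subspace[OF U(1)] by (auto simp: subspace_def B_left)
  moreover have "(*v) w ` ?U0 \<subseteq> ?U0" if w: "w \<in> W" for w
  proof -
    have "B (w *v x) y = 0" if "\<forall>y\<in>U'. B x y = 0" "y \<in> U'" for x y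
    proof -
      obtain w' where w': "w' \<in> W" "w ** w' = mat 1" using W_inverse w by blast
      then have "w' *v y \<in> U'" using U(2) that(2) irreducible_summand_closed by blast
      moreover have "y = w *v (w' *v y)" using w'(2) by (simp add: matrix_vector_mul_assoc)
      then have "B (w *v x) y = B x (w' *v y)" using B_inv[OF w, of x "w' *v y"] by simp
      ultimately show ?thesis using that(1) by simp
    qed
    then show ?thesis using U(1) w irreducible_summand_closed by auto
  qed
  ultimately have "?U0 = {0} \<or> ?U0 = U"
    using U(1) unfolding irreducible_summand_def by (metis (mono_tags, lifting) mem_Collect_eq subsetI)
  moreover have "?U0 \<noteq> {0}"
  proof
    assume U0: "?U0 = {0}"
    have "s *v x = x" if s: "s \<in> W" "reflection s" and x: "x \<in> U" for s x
    proof (rule ccontr)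
      assume sx: "s *v x \<noteq> x"
      have "s *v y = y" if "y \<in> U'" for y
        using reflection_fixes_summand[OF U s x sx that] .
      then have "B (x - s *v x) y = 0" if "y \<in> U'" for y
        using B_inv[OF s(1), of x y] that by (simp add: B_left)
      moreover have "x - s *v x \<in> U"
        using U(1) s x irreducible_summand_closed by (intro subspace_diff irreducible_summand_subspace) auto
      ultimately have "x - s *v x \<in> ?U0" by simp
      then show False using U0 sx by simp
    qed
    then have "U \<subseteq> {0}" using W_fixes_if_reflections_fix by blast
    then show False using U(1) subspace_0 by (auto simp: irreducible_summand_def)
  qed
  ultimately show ?thesis using x y by blast
qed

section \<open>Orthogonal projections and the coordinate rings of the summands\<close>

definition orth_proj :: "(real^'n) set \<Rightarrow> real^'n^'n \<Rightarrow> bool" where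
  "orth_proj U P \<longleftrightarrow> range ((*v) P) = U \<and> P ** P = P \<and> (\<forall>x y. B (P *v x) y = B x (P *v y))"

text \<open>Idempotents with the same range fix each other's values; self-adjointness then makes the
  norm of the difference vanish.\<close>

lemma orth_proj_unique:
  assumes P: "orth_proj U P" and Q: "orth_proj U Q"
  shows "P = Q"
proof -
  have "P *v x = Q *v x" for x
  proof -
    have idem: "P *v (P *v z) = P *v z" "Q *v (Q *v z) = Q *v z" for z
      using P Q by (simp_all add: orth_proj_def matrix_vector_mul_assoc)
    have "range ((*v) P) = range ((*v) Q)" using P Q by (simp add: orth_proj_def)
    then have "\<exists>z. P *v y = Q *v z" "\<exists>z. Q *v y = P *v z" for y by (metis rangeE rangeI)+
    then have PQ: "Q *v (P *v z) = P *v z" "P *v (Q *v z) = Q *v z" for z using idem by metis+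
    have "B (P *v x - Q *v x) (P *v x - Q *v x) = 0"
      using P Q by (simp add: B_left B_right orth_proj_def)
        (metis (no_types, lifting) PQ add.right_neutral cancel_comm_monoid_add_class.diff_cancel idem)
    then show ?thesis by (simp add: B_self_eq_0)
  qed
  then show ?thesis by (simp add: matrix_eq)
qed

text \<open>By uniqueness of the projection, membership becomes a fixed point condition for a single
  ring homomorphism.\<close>

lemma coord_ring_fixed:
  assumes P: "orth_proj U P"
  shows "f \<in> coord_ring B U \<longleftrightarrow> pullback P f = f"
proof
  assume "f \<in> coord_ring B U"
  then obtain Q g where "orth_proj U Q" "f = pullback Q g" by (auto simp: coord_ring_def orth_proj_def)
  then have "P ** P = P" "f = pullback P g" using orth_proj_unique[OF P] P by (auto simp: orth_proj_def)
  then show "pullback P f = f" by (simp add: pullback_pullback)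
next
  assume "pullback P f = f"
  then show "f \<in> coord_ring B U"
    using P unfolding coord_ring_def orth_proj_def mem_Collect_eq by (intro exI[of _ P] exI[of _ f]) simp
qed

lemma coord_ring_obtain:
  assumes "f \<in> coord_ring B U" obtains P where "orth_proj U P" "pullback P f = f"
  using assms coord_ring_fixed unfolding coord_ring_def orth_proj_def by blast

lemma orth_proj_mult_0:
  assumes U: "irreducible_summand W U" "irreducible_summand W U'" "U \<noteq> U'"
    and P: "orth_proj U P" and Q: "orth_proj U' Q"
  shows "B (P *v x) (Q *v y) = 0" and "Q ** P = 0"
proof -
  show *: "B (P *v x) (Q *v y) = 0" for x y
    using irreducible_summands_orthogonal[OF U] P Q by (metis orth_proj_def rangeI)
  have "B (Q *v (P *v x)) (Q *v (P *v x)) = 0" for x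
    using Q * by (simp add: orth_proj_def)
  then have "Q *v (P *v x) = 0" for x by (simp add: B_self_eq_0)
  then show "Q ** P = 0" by (simp add: matrix_eq matrix_vector_mul_assoc[symmetric])
qed

text \<open>The projections onto two different summands compose to 0, so only the value at the
  origin survives.\<close>

lemma coord_ring_pullback_cnst:
  assumes U: "irreducible_summand W U" "irreducible_summand W U'" "U \<noteq> U'"
    and P: "orth_proj U P" and f: "f \<in> coord_ring B U'"
  shows "\<exists>c. pullback P f = cnst c"
proof -
  obtain Q where Q: "orth_proj U' Q" "pullback Q f = f" using f by (rule coord_ring_obtain)
  have "pullback P f = pullback P (pullback Q f)" by (simp add: Q)
  also have "\<dots> = pullback 0 f" by (simp add: pullback_pullback orth_proj_mult_0[OF U P Q(1)])
  finally show ?thesis using pullback_0_is_cnst by metis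
qed

text \<open>The gradients of the two invariants lie in different summands, which are
  orthogonal.\<close>

lemma gstar_orthogonal:
  assumes U: "irreducible_summand W U" "irreducible_summand W U'" "U \<noteq> U'"
    and i: "p i \<in> coord_ring B U" and j: "p j \<in> coord_ring B U'"
  shows "gstar u p i j = 0"
proof -
  obtain P where P: "orth_proj U P" "pullback P (p i) = p i" using i by (rule coord_ring_obtain)
  obtain Q where Q: "orth_proj U' Q" "pullback Q (p j) = p j" using j by (rule coord_ring_obtain)
  \<comment> \<open>A function pulled back along a projection is constant along the kernel, so only
    the projected direction contributes.\<close>
  have *: "dirder v f = (\<Sum>l\<in>UNIV. cnst (B (u l) (P *v v)) * dirder (u l) f)"
    if "P ** P = P" "pullback P f = f" for P v f
  proof -
    have "dirder v f = pullback P (dirder (P *v v) f)"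
      using dirder_pullback[of v P f] that by simp
    also have "\<dots> = dirder (P *v v) f"
      using dirder_pullback[of "P *v v" P f] that by (simp add: matrix_vector_mul_assoc)
    also have "\<dots> = dirder (\<Sum>l\<in>UNIV. B (u l) (P *v v) *\<^sub>R u l) f"
      by (simp flip: frame_expansion)
    finally show ?thesis by (simp only: dirder_vsum dirder_scale)
  qed
  \<comment> \<open>By the frame expansion the sum over \<open>k\<close> is the inner product of
    vectors from the two summands.\<close>
  have orth: "(\<Sum>k\<in>UNIV. B (u l) (P *v u k) * B (u m) (Q *v u k)) = 0" for l m
  proof -
    have "(\<Sum>k\<in>UNIV. B (u l) (P *v u k) * B (u m) (Q *v u k))
        = (\<Sum>k\<in>UNIV. B (P *v u l) (u k) * B (u k) (Q *v u m))"
    proof (intro sum.cong refl)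
      fix k
      have "B (u l) (P *v u k) = B (P *v u l) (u k)" using P(1) by (simp add: orth_proj_def)
      moreover have "B (u m) (Q *v u k) = B (Q *v u m) (u k)" using Q(1) by (simp add: orth_proj_def)
      ultimately show "B (u l) (P *v u k) * B (u m) (Q *v u k) = B (P *v u l) (u k) * B (u k) (Q *v u m)"
        by (simp only: B_sym[of "Q *v u m"])
    qed
    also have "\<dots> = B (P *v u l) (\<Sum>k\<in>UNIV. B (u k) (Q *v u m) *\<^sub>R u k)"
      by (simp add: B_right mult.commute)
    also have "\<dots> = 0"
      by (simp add: orth_proj_mult_0(1)[OF U P(1) Q(1)] flip: frame_expansion)
    finally show ?thesis .
  qed
  have PP: "P ** P = P" "Q ** Q = Q" using P Q by (auto simp: orth_proj_def)
  have "gstar u p i j = (\<Sum>k\<in>UNIV. (\<Sum>l\<in>UNIV. cnst (B (u l) (P *v u k)) * dirder (u l) (p i))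
      * (\<Sum>m\<in>UNIV. cnst (B (u m) (Q *v u k)) * dirder (u m) (p j)))"
    unfolding gstar_def
    by (intro sum.cong refl arg_cong2[of _ _ _ _ "(*)"] *[OF PP(1) P(2)] *[OF PP(2) Q(2)])
  also have "\<dots> = (\<Sum>k\<in>UNIV. \<Sum>l\<in>UNIV. \<Sum>m\<in>UNIV.
      cnst (B (u l) (P *v u k) * B (u m) (Q *v u k)) * (dirder (u l) (p i) * dirder (u m) (p j)))"
    unfolding sum_product by (intro sum.cong refl) (simp add: cnst_mult mult_ac)
  also have "\<dots> = (\<Sum>l\<in>UNIV. \<Sum>k\<in>UNIV. \<Sum>m\<in>UNIV.
      cnst (B (u l) (P *v u k) * B (u m) (Q *v u k)) * (dirder (u l) (p i) * dirder (u m) (p j)))"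
    by (rule sum.swap)
  also have "\<dots> = (\<Sum>l\<in>UNIV. \<Sum>m\<in>UNIV. \<Sum>k\<in>UNIV.
      cnst (B (u l) (P *v u k) * B (u m) (Q *v u k)) * (dirder (u l) (p i) * dirder (u m) (p j)))"
    by (intro sum.cong refl sum.swap)
  also have "\<dots> = (\<Sum>l\<in>UNIV. \<Sum>m\<in>UNIV.
      cnst (of_real (\<Sum>k\<in>UNIV. B (u l) (P *v u k) * B (u m) (Q *v u k))) * (dirder (u l) (p i) * dirder (u m) (p j)))"
    by (simp only: sum_distrib_right[symmetric] cnst_sum of_real_sum)
  also have "\<dots> = 0" by (simp only: orth) simp
  finally show ?thesis .
qed

text \<open>A consequence of algebraic independence. It ensures that no basic invariant belongs to
  two summands, where it would have to be constant.\<close>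

lemma p_not_cnst: "p i \<noteq> cnst c"
proof
  assume "p i = cnst c"
  then have "subst p (var i) = subst p (cnst c)" by simp
  then have "var i = cnst c" using inj_subst by (simp only: inj_eq)
  then have "pd i (var i) = pd i (cnst c)" by (rule arg_cong)
  then show False by (simp add: pd_var)
qed

lemma irreducible_summand_unique:
  assumes "irreducible_summand W U" "irreducible_summand W U'"
    and "p i \<in> coord_ring B U" "p i \<in> coord_ring B U'"
  shows "U = U'"
proof (rule ccontr)
  assume "U \<noteq> U'"
  obtain P where "orth_proj U P" "pullback P (p i) = p i" using assms(3) by (rule coord_ring_obtain)
  then show False using coord_ring_pullback_cnst[OF assms(1,2) \<open>U \<noteq> U'\<close> _ assms(4)] p_not_cnst by metis
qed

section \<open>Subalgebras generated by basic invariants and their derivations\<close>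

text \<open>Covers the full invariant ring (\<open>I = UNIV\<close>) and the invariant rings of the
  summands at once.\<close>

definition subalg :: "'n set \<Rightarrow> 'n cpoly set" where
  "subalg I = subst p ` polys_in I"

lemma subalg_UNIV: "subalg UNIV = invariants W"
  by (simp add: subalg_def polys_in_UNIV range_subst)

text \<open>Restriction to \<open>U\<close> fixes the basic invariants of \<open>U\<close> and turns
  the others into constants, so it retracts the invariants onto polynomials in those of
  \<open>U\<close>.\<close>

lemma subalg_summand:
  assumes adapted: "adapted W B p" and U: "irreducible_summand W U" and ne: "p k \<in> coord_ring B U"
  shows "invariants W \<inter> coord_ring B U = subalg {i. p i \<in> coord_ring B U}"
proof
  let ?I = "{i. p i \<in> coord_ring B U}"
  \<comment> \<open>The invariant \<open>p k\<close> serves to provide the orthogonal projection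
    onto \<open>U\<close>.\<close>
  obtain P where P: "orth_proj U P" using ne by (rule coord_ring_obtain)
  note fixed = coord_ring_fixed[OF P]
  have "\<exists>c. pullback P (p i) = cnst c" if "i \<notin> ?I" for i
  proof -
    obtain U' where "irreducible_summand W U'" "p i \<in> coord_ring B U'"
      using adapted by (auto simp: adapted_def)
    then show ?thesis using that by (intro coord_ring_pullback_cnst[OF U _ _ P]) auto
  qed
  then obtain c where c: "\<And>i. i \<notin> ?I \<Longrightarrow> pullback P (p i) = cnst (c i)" by metis
  \<comment> \<open>The restriction to \<open>U\<close> as a substitution in the variables of
    \<open>q\<close>; injectivity of \<open>subst p\<close> transfers the fixed point equation to
    \<open>q\<close>.\<close>
  define s where "s i = (if i \<in> ?I then var i else cnst (c i))" for i
  show "invariants W \<inter> coord_ring B U \<subseteq> subalg ?I"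
  proof
    fix f assume f: "f \<in> invariants W \<inter> coord_ring B U"
    then obtain q where q: "f = subst p q" using range_subst by blast
    have "subst p q = pullback P (subst p q)" using f q fixed by simp
    also have "\<dots> = subst (\<lambda>i. pullback P (p i)) q" by (simp add: pullback_def subst_subst)
    also have "(\<lambda>i. pullback P (p i)) = (\<lambda>i. subst p (s i))"
    proof
      fix i show "pullback P (p i) = subst p (s i)"
        using c[of i] fixed[of "p i"] by (cases "i \<in> ?I") (simp_all add: s_def)
    qed
    also have "subst (\<lambda>i. subst p (s i)) q = subst p (subst s q)" by (simp add: subst_subst)
    finally have "q = subst s q" using inj_subst by (simp only: inj_eq)
    moreover have "subst s q \<in> polys_in ?I"
      by (intro subst_in_polys_in) (auto simp: s_def intro: polys_in.intros)
    ultimately show "f \<in> subalg ?I" by (auto simp: subalg_def q)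
  qed
  have "pullback P (subst p q) = subst p q" if "q \<in> polys_in ?I" for q
    using that by induction (use fixed in \<open>auto simp: subst_hom pullback_hom\<close>)
  then show "subalg ?I \<subseteq> invariants W \<inter> coord_ring B U"
    using range_subst fixed by (auto simp: subalg_def)
qed

context
  fixes I :: "'n set" and A assumes A: "A = subalg I"
begin

lemma subalg_cnst: "cnst c \<in> A" and subalg_0: "0 \<in> A" and subalg_1: "1 \<in> A"
proof -
  show "cnst c \<in> A" for c unfolding A subalg_def using polys_in.cnst subst_cnst by (metis image_eqI)
  from this[of 0] this[of 1] show "0 \<in> A" "1 \<in> A" by simp_all
qed

lemma subalg_p: "i \<in> I \<Longrightarrow> p i \<in> A"
  unfolding A subalg_def using polys_in.var subst_var by (metis image_eqI)

lemma subalg_add: "f \<in> A \<Longrightarrow> g \<in> A \<Longrightarrow> f + g \<in> A"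
  and subalg_mult: "f \<in> A \<Longrightarrow> g \<in> A \<Longrightarrow> f * g \<in> A"
  unfolding A subalg_def by (auto simp flip: subst_hom intro: polys_in.intros)

lemma coord_field_subst: "q \<in> polys_in I \<Longrightarrow> coord_field p A i (subst p q) = subst p (pd i q)"
  unfolding A coord_field_def subalg_def using inj_subst by simp

lemma coord_field_p: "j \<in> I \<Longrightarrow> coord_field p A i (p j) = (if i = j then 1 else 0)"
  using coord_field_subst[OF polys_in.var] by (simp add: pd_var)

lemma subalg_cases: "f \<in> A \<Longrightarrow> (\<And>q. q \<in> polys_in I \<Longrightarrow> f = subst p q \<Longrightarrow> thesis) \<Longrightarrow> thesis"
  unfolding A subalg_def by blast

lemma coord_field_Der: "coord_field p A i \<in> Der A"
proof -
  have *: "coord_field p A i f \<in> A" if "f \<in> A" for f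
    using that by (rule subalg_cases) (auto simp: coord_field_subst, auto simp: A subalg_def pd_polys_in)
  have "coord_field p A i (f + g) = coord_field p A i f + coord_field p A i g"
    "coord_field p A i (f * g) = coord_field p A i f * g + f * coord_field p A i g"
    if "f \<in> A" "g \<in> A" for f g
  proof -
    obtain q r where "q \<in> polys_in I" "f = subst p q" "r \<in> polys_in I" "g = subst p r"
      using subalg_cases \<open>f \<in> A\<close> \<open>g \<in> A\<close> by metis
    then show "coord_field p A i (f + g) = coord_field p A i f + coord_field p A i g"
      "coord_field p A i (f * g) = coord_field p A i f * g + f * coord_field p A i g"
      using coord_field_subst[of "q + r"] coord_field_subst[of "q * r"]
      by (auto simp: coord_field_subst pd_add pd_mult subst_hom polys_in.intros)
  qed
  moreover have "coord_field p A i (cnst c) = 0" for c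
    using coord_field_subst[OF polys_in.cnst] by simp
  moreover have "coord_field p A i f = 0" if "f \<notin> A" for f
    using that by (simp add: coord_field_def)
  ultimately show ?thesis using * by (simp add: Der_def subalg_cnst)
qed

lemma Der_smul: "a \<in> A \<Longrightarrow> X \<in> Der A \<Longrightarrow> a \<odot> X \<in> Der A"
  by (auto simp: Der_def smul_def subalg_mult algebra_simps)

lemma Der_plus: "X \<in> Der A \<Longrightarrow> Y \<in> Der A \<Longrightarrow> X + Y \<in> Der A"
  by (auto simp: Der_def subalg_add algebra_simps)

lemma Der_zero: "0 \<in> Der A"
  by (auto simp: Der_def subalg_0)

lemma Der_sum: "(\<And>x. x \<in> K \<Longrightarrow> X x \<in> Der A) \<Longrightarrow> sum X K \<in> Der A"
  by (induction K rule: infinite_finite_induct) (auto simp: Der_zero Der_plus)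

text \<open>A derivation is determined by its values on the generators; outside \<open>A\<close>
  both sides are 0 by the representation of derivations. This is the freeness of the module on the
  coordinate fields.\<close>

lemma Der_coord_expansion:
  assumes X: "X \<in> Der A"
  shows "X = (\<Sum>i\<in>I. X (p i) \<odot> coord_field p A i)"
proof
  fix f
  show "X f = (\<Sum>i\<in>I. X (p i) \<odot> coord_field p A i) f"
  proof (cases "f \<in> A")
    case False
    then show ?thesis
      using X by (simp add: sum_vfield_apply smul_def Der_outside[OF coord_field_Der] Der_outside)
  next
    case True
    then obtain q where q: "q \<in> polys_in I" "f = subst p q" using subalg_cases by blast
    have mem: "r \<in> polys_in I \<Longrightarrow> subst p r \<in> A" for r by (simp add: A subalg_def)
    have "X (subst p q) = (\<Sum>i\<in>I. X (p i) * subst p (pd i q))"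
      using q(1)
    proof induction
      case (cnst c)
      show ?case using X by (simp add: Der_cnst subalg_1)
    next
      case (var i)
      have "(\<Sum>j\<in>I. X (p j) * (if i = j then 1 else 0)) = (\<Sum>j\<in>I. if i = j then X (p j) else 0)"
        by (intro sum.cong) auto
      then show ?case using var by (simp add: pd_var if_distrib[of "subst p"] cong: if_cong)
    next
      case (add f g)
      then show ?case using X mem by (simp add: subst_hom pd_add Der_add algebra_simps sum.distrib)
    next
      case (mult f g)
      then have "X (subst p (f * g)) = (\<Sum>i\<in>I. X (p i) * subst p (pd i f)) * subst p g
          + subst p f * (\<Sum>i\<in>I. X (p i) * subst p (pd i g))"
        using X mem by (simp add: subst_hom Der_mult)
      also have "\<dots> = (\<Sum>i\<in>I. X (p i) * subst p (pd i (f * g)))"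
        by (simp add: sum_distrib_left sum_distrib_right subst_hom pd_mult algebra_simps flip: sum.distrib)
      finally show ?case .
    qed
    then show ?thesis using q by (simp add: sum_vfield_apply smul_def coord_field_subst)
  qed
qed

lemma Der_eqI:
  assumes "X \<in> Der A" "Y \<in> Der A" and "\<And>i. i \<in> I \<Longrightarrow> X (p i) = Y (p i)"
  shows "X = Y"
  using Der_coord_expansion[OF assms(1)] Der_coord_expansion[OF assms(2)] assms(3)
  by (metis (mono_tags, lifting) sum.cong)

lemma linear_on_zero:
  assumes "linear_on A (Der A) N F" shows "F 0 = 0"
proof -
  have "F (0 \<odot> 0) = 0 \<odot> F 0" using assms Der_zero subalg_0 by (simp add: linear_on_def)
  moreover have "0 \<odot> X = 0" for X :: "'n vfield" by (auto simp: smul_def)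
  ultimately show ?thesis by metis
qed

lemma linear_on_sum:
  assumes "linear_on A (Der A) N F" and "\<And>x. x \<in> K \<Longrightarrow> a x \<in> A" "\<And>x. x \<in> K \<Longrightarrow> X x \<in> Der A"
  shows "F (\<Sum>x\<in>K. a x \<odot> X x) = (\<Sum>x\<in>K. a x \<odot> F (X x))"
  using assms(2,3)
proof (induction K rule: infinite_finite_induct)
  case (insert x K)
  have "F (a x \<odot> X x + (\<Sum>x\<in>K. a x \<odot> X x)) = a x \<odot> F (X x) + F (\<Sum>x\<in>K. a x \<odot> X x)"
    using assms(1) insert.prems Der_smul by (simp add: linear_on_def Der_sum)
  then show ?case using insert by (simp only: sum.insert[OF insert.hyps] insertI2)
qed (simp_all add: linear_on_zero[OF assms(1)])

end

section \<open>The Frobenius multiplication\<close>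

text \<open>The self-adjointness holds because the transpose of multiplication by \<open>X\<close> corresponds under \<open>\<sharp>\<close>
  to multiplication by \<open>X\<close>.\<close>

lemma irreducible_frobenius_structure:
  assumes A: "A = subalg I" and irr: "irreducible_frobenius_mult A I u p mulU"
  defines "C \<equiv> \<lambda>i j k. mulU (coord_field p A i) (coord_field p A j) (p k)"
  shows irreducible_frobenius_closed: "\<And>i j k. k \<in> I \<Longrightarrow> C i j k \<in> A"
    and irreducible_frobenius_comm: "\<And>i j k. C i j k = C j i k"
    and irreducible_frobenius_assoc:
      "\<And>i j k l. (\<Sum>a\<in>I. C i j a * C a k l) = (\<Sum>a\<in>I. C j k a * C i a l)"
    and irreducible_frobenius_unit: "\<exists>m\<in>I. \<forall>j\<in>I. \<forall>k\<in>I. C m j k = (if j = k then 1 else 0)"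
    and irreducible_frobenius_adjoint: "\<And>a b c. a \<in> I \<Longrightarrow> b \<in> I \<Longrightarrow>
      (\<Sum>i\<in>I. C c i a * gstar u p i b) = (\<Sum>i\<in>I. gstar u p a i * C c i b)"
proof -
  obtain m H where m: "m \<in> I" and inv: "inverse_matrix A I (etastar u p A m) H"
    and frob: "frobenius_manifold A (metric p I H) mulU (coord_field p A m) (euler_field p A I m)"
    and K: "\<And>\<alpha> \<beta>. \<alpha> \<in> one_forms A I \<Longrightarrow> \<beta> \<in> one_forms A I \<Longrightarrow>
      (\<Sum>i\<in>I. \<Sum>j\<in>I. \<alpha> i * \<beta> j * gstar u p i j) =
      metric p I H (mulU (sharp p A I (etastar u p A m) \<alpha>) (sharp p A I (etastar u p A m) \<beta>)) (euler_field p A I m)"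
    using irr unfolding irreducible_frobenius_mult_def by blast
  let ?dp = "coord_field p A" and ?ip = "metric p I H" and ?G = "etastar u p A m"
    and ?E = "euler_field p A I m"
  let ?sh = "sharp p A I ?G"
  note der = coord_field_Der[OF A] and mem_p = subalg_p[OF A]
  have lin1: "linear_on A (Der A) (Der A) (\<lambda>X. mulU X Y)" and lin2: "linear_on A (Der A) (Der A) (mulU Y)"
    if "Y \<in> Der A" for Y
    using that frob unfolding frobenius_manifold_def bilinear_on_def by blast+
  have mul_Der: "mulU X Y \<in> Der A" if "X \<in> Der A" "Y \<in> Der A" for X Y
    using lin2[OF that(1)] that(2) by (simp add: linear_on_def)
  have comm: "mulU X Y = mulU Y X" if "X \<in> Der A" "Y \<in> Der A" for X Y
    using frob that unfolding frobenius_manifold_def commutative_on_def by blast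
  have assoc: "mulU (mulU X Y) Z = mulU X (mulU Y Z)" if "X \<in> Der A" "Y \<in> Der A" "Z \<in> Der A" for X Y Z
    using frob that unfolding frobenius_manifold_def associative_on_def by blast
  have invariant: "?ip (mulU X Y) Z = ?ip X (mulU Y Z)" if "X \<in> Der A" "Y \<in> Der A" "Z \<in> Der A" for X Y Z
    using frob that unfolding frobenius_manifold_def by blast
  show closed: "C i j k \<in> A" if "k \<in> I" for i j k
    unfolding C_def by (rule Der_closed[OF mul_Der[OF der der] mem_p[OF that]])
  show C_comm: "C i j k = C j i k" for i j k
    unfolding C_def using comm[OF der der] by metis
  have exp1: "mulU X Y = (\<Sum>i\<in>I. X (p i) \<odot> mulU (?dp i) Y)" if "X \<in> Der A" "Y \<in> Der A" for X Y
    using linear_on_sum[OF A lin1[OF that(2)], of I "\<lambda>i. X (p i)" ?dp] Der_closed[OF that(1) mem_p] der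
    by (simp flip: Der_coord_expansion[OF A that(1)])
  have exp2: "mulU X Y = (\<Sum>i\<in>I. Y (p i) \<odot> mulU X (?dp i))" if "X \<in> Der A" "Y \<in> Der A" for X Y
    using exp1[OF that(2,1)] comm that der by (metis (no_types, lifting) sum.cong)
  show "(\<Sum>a\<in>I. C i j a * C a k l) = (\<Sum>a\<in>I. C j k a * C i a l)" for i j k l
  proof -
    have "mulU (mulU (?dp i) (?dp j)) (?dp k) (p l) = mulU (?dp i) (mulU (?dp j) (?dp k)) (p l)"
      by (simp only: assoc[OF der der der])
    then show ?thesis
      unfolding exp1[OF mul_Der[OF der der] der] exp2[OF der mul_Der[OF der der]]
        sum_vfield_apply smul_def C_def .
  qed
  have "mulU (?dp m) (?dp j) = ?dp j" for j
    using frob der unfolding frobenius_manifold_def is_unit_on_def by blast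
  then show "\<exists>m\<in>I. \<forall>j\<in>I. \<forall>k\<in>I. C m j k = (if j = k then 1 else 0)"
    using m by (intro bexI[of _ m]) (simp_all add: C_def coord_field_p[OF A])

  have GH: "(\<Sum>j\<in>I. ?G i j * H k j) = (if i = k then 1 else 0)" if "i \<in> I" "k \<in> I" for i k
  proof -
    have G_sym: "?G i j = ?G j i" for i j by (simp add: etastar_def gstar_def mult.commute)
    have HG: "(\<Sum>j\<in>I. H k j * ?G j i) = (if k = i then 1 else 0)"
      using inv that by (simp add: inverse_matrix_def)
    have "(\<Sum>j\<in>I. ?G i j * H k j) = (\<Sum>j\<in>I. H k j * ?G j i)"
      by (intro sum.cong refl) (subst G_sym, rule mult.commute)
    then show ?thesis using HG by auto
  qed
  \<comment> \<open>Since \<open>coord_field\<close> takes the value 0 outside \<open>A\<close>, the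
    entries lie in \<open>A\<close> in either case.\<close>
  have G_mem: "?G i j \<in> A" for i j
  proof (cases "gstar u p i j \<in> A")
    case True
    then show ?thesis unfolding etastar_def by (rule Der_closed[OF der])
  next
    case False
    then show ?thesis by (simp add: etastar_def coord_field_def subalg_0[OF A])
  qed
  have sharp_Der: "?sh \<alpha> \<in> Der A" if "\<alpha> \<in> one_forms A I" for \<alpha>
    unfolding sharp_def using that
    by (intro Der_sum[OF A] Der_smul[OF A] der subalg_mult[OF A] G_mem) (auto simp: one_forms_def)
  have sharp_p: "?sh \<alpha> (p l) = (\<Sum>a\<in>I. \<alpha> a * ?G a l)" if "l \<in> I" for \<alpha> l
    using that by (simp add: sharp_def sum_vfield_apply smul_def coord_field_p[OF A] if_distrib cong: if_cong)
  \<comment> \<open>\<open>sharp\<close> inverts the metric, so the inner product with a sharpened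
    form is evaluation of the form.\<close>
  have pairing: "?ip (?sh \<alpha>) Y = (\<Sum>j\<in>I. \<alpha> j * Y (p j))" for \<alpha> Y
  proof -
    have "?ip (?sh \<alpha>) Y = (\<Sum>i\<in>I. \<Sum>j\<in>I. (\<Sum>a\<in>I. \<alpha> a * ?G a i) * Y (p j) * H i j)"
      by (simp add: metric_def sharp_p)
    also have "\<dots> = (\<Sum>i\<in>I. \<Sum>j\<in>I. \<Sum>a\<in>I. \<alpha> a * Y (p j) * (?G a i * H i j))"
      by (simp add: sum_distrib_left sum_distrib_right mult_ac)
    also have "\<dots> = (\<Sum>j\<in>I. \<Sum>i\<in>I. \<Sum>a\<in>I. \<alpha> a * Y (p j) * (?G a i * H i j))"
      by (rule sum.swap)
    also have "\<dots> = (\<Sum>j\<in>I. \<Sum>a\<in>I. \<Sum>i\<in>I. \<alpha> a * Y (p j) * (?G a i * H i j))"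
      by (intro sum.cong refl sum.swap)
    also have "\<dots> = (\<Sum>j\<in>I. \<Sum>a\<in>I. if a = j then \<alpha> a * Y (p j) else 0)"
    proof (intro sum.cong refl)
      fix j a assume "j \<in> I" "a \<in> I"
      then have "(\<Sum>i\<in>I. ?G a i * H i j) = (if a = j then 1 else 0)"
        using inv by (simp add: inverse_matrix_def)
      then show "(\<Sum>i\<in>I. \<alpha> a * Y (p j) * (?G a i * H i j)) = (if a = j then \<alpha> a * Y (p j) else 0)"
        by (simp flip: sum_distrib_left)
    qed
    finally show ?thesis by simp
  qed
  have nondeg: "Z = Z'" if Z: "Z \<in> Der A" "Z' \<in> Der A" and eq: "\<And>Y. Y \<in> Der A \<Longrightarrow> ?ip Z Y = ?ip Z' Y" for Z Z'
  proof (rule Der_eqI[OF A Z])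
    fix l assume l: "l \<in> I"
    \<comment> \<open>The field corresponding to dp_l under the metric; pairing with it extracts the
      component of index \<open>l\<close>.\<close>
    define Y where "Y = (\<Sum>j\<in>I. ?G l j \<odot> ?dp j)"
    have Y: "Y \<in> Der A" unfolding Y_def by (intro Der_sum[OF A] Der_smul[OF A] der G_mem)
    have Yp: "Y (p j) = ?G l j" if "j \<in> I" for j
      using that by (simp add: Y_def sum_vfield_apply smul_def coord_field_p[OF A] if_distrib cong: if_cong)
    have "?ip Z Y = Z (p l)" for Z
    proof -
      have "?ip Z Y = (\<Sum>i\<in>I. Z (p i) * (\<Sum>j\<in>I. ?G l j * H i j))"
        by (simp add: metric_def Yp sum_distrib_left mult.assoc)
      also have "\<dots> = (\<Sum>i\<in>I. if l = i then Z (p i) else 0)"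
        using l by (intro sum.cong refl) (auto simp: GH)
      finally show ?thesis using l by simp
    qed
    then show "Z (p l) = Z' (p l)" using eq[OF Y] by simp
  qed

  fix a b c assume a: "a \<in> I" and b: "b \<in> I"
  \<comment> \<open>\<open>d a\<close> is the form dp_a, and \<open>t a\<close> is its image under
    the transpose of multiplication by the coordinate field of index \<open>c\<close>.\<close>
  define d where "d a i = (if i = a then 1 else 0 :: 'n cpoly)" for a i :: 'n
  define t where "t a i = (if i \<in> I then C c i a else 0)" for a i
  have forms: "d a \<in> one_forms A I" "t a \<in> one_forms A I" if "a \<in> I" for a
    using that closed[OF that] by (auto simp: one_forms_def d_def t_def subalg_0[OF A] subalg_1[OF A])
  have sharp_t: "?sh (t a) = mulU (?dp c) (?sh (d a))" if a: "a \<in> I" for a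
  proof (rule nondeg)
    show "?sh (t a) \<in> Der A" "mulU (?dp c) (?sh (d a)) \<in> Der A"
      using forms[OF a] by (auto intro: sharp_Der mul_Der der)
    fix Y assume Y: "Y \<in> Der A"
    have "?ip (mulU (?dp c) (?sh (d a))) Y = ?ip (mulU (?sh (d a)) (?dp c)) Y"
      using comm[OF der sharp_Der[OF forms(1)[OF a]]] by simp
    also have "\<dots> = ?ip (?sh (d a)) (mulU (?dp c) Y)"
      by (rule invariant[OF sharp_Der[OF forms(1)[OF a]] der Y])
    also have "\<dots> = mulU (?dp c) Y (p a)"
      using a by (simp add: pairing d_def if_distrib[of "\<lambda>c. c * _"] cong: if_cong)
    also have "\<dots> = (\<Sum>j\<in>I. Y (p j) * C c j a)"
      unfolding exp2[OF der Y] by (simp add: sum_vfield_apply smul_def C_def)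
    also have "\<dots> = ?ip (?sh (t a)) Y"
      unfolding pairing by (intro sum.cong refl) (simp add: t_def mult.commute)
    finally show "?ip (?sh (t a)) Y = ?ip (mulU (?dp c) (?sh (d a))) Y" by simp
  qed
  \<comment> \<open>Both sides are the triple product of the coordinate field \<open>c\<close> with
    the fields of dp_a and dp_b; the intersection form expresses them through
    \<open>gstar\<close>.\<close>
  have "mulU (?sh (t a)) (?sh (d b)) = mulU (?sh (d a)) (?sh (t b))"
    unfolding sharp_t[OF a] sharp_t[OF b]
      comm[OF der sharp_Der[OF forms(1)[OF a]]]
    by (rule assoc[OF sharp_Der[OF forms(1)[OF a]] der sharp_Der[OF forms(1)[OF b]]])
  then have "(\<Sum>i\<in>I. \<Sum>j\<in>I. t a i * d b j * gstar u p i j) = (\<Sum>i\<in>I. \<Sum>j\<in>I. d a i * t b j * gstar u p i j)"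
    by (simp add: K forms a b)
  moreover have "(\<Sum>i\<in>I. \<Sum>j\<in>I. t a i * d b j * gstar u p i j) = (\<Sum>i\<in>I. C c i a * gstar u p i b)"
  proof (intro sum.cong refl)
    fix i assume "i \<in> I"
    have "(\<Sum>j\<in>I. t a i * d b j * gstar u p i j) = (\<Sum>j\<in>I. if j = b then t a i * gstar u p i j else 0)"
      by (intro sum.cong) (auto simp: d_def)
    then show "(\<Sum>j\<in>I. t a i * d b j * gstar u p i j) = C c i a * gstar u p i b"
      using \<open>i \<in> I\<close> b by (simp add: t_def)
  qed
  moreover have "(\<Sum>i\<in>I. \<Sum>j\<in>I. d a i * t b j * gstar u p i j) = (\<Sum>j\<in>I. gstar u p a j * C c j b)"
  proof (subst sum.swap, intro sum.cong refl)
    fix j assume "j \<in> I"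
    have "(\<Sum>i\<in>I. d a i * t b j * gstar u p i j) = (\<Sum>i\<in>I. if i = a then t b j * gstar u p i j else 0)"
      by (intro sum.cong) (auto simp: d_def)
    then show "(\<Sum>i\<in>I. d a i * t b j * gstar u p i j) = gstar u p a j * C c j b"
      using \<open>j \<in> I\<close> a by (simp add: t_def mult.commute)
  qed
  ultimately show "(\<Sum>i\<in>I. C c i a * gstar u p i b) = (\<Sum>i\<in>I. gstar u p a i * C c i b)" by simp
qed

section \<open>From the irreducible summands to the whole group\<close>

text \<open>The structure constants vanish unless all three indices belong to one summand, and
  inside a summand they are those of its irreducible multiplication. The set \<open>N\<close>
  contains one index per summand, as the unit is the sum of the units of the factors.\<close>

lemma frobenius_mult_structure:
  assumes adapted: "adapted W B p" and frob: "frobenius_mult W B u p mul"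
  defines "C \<equiv> \<lambda>i j k. mul (coord_field p (invariants W) i) (coord_field p (invariants W) j) (p k)"
  shows frobenius_mult_comm: "\<And>i j k. C i j k = C j i k"
    and frobenius_mult_assoc: "\<And>i j k l. (\<Sum>a\<in>UNIV. C i j a * C a k l) = (\<Sum>a\<in>UNIV. C j k a * C i a l)"
    and frobenius_mult_unit: "\<exists>N. N \<noteq> {} \<and> (\<forall>j k. (\<Sum>i\<in>N. C i j k) = (if j = k then 1 else 0))"
    and frobenius_mult_adjoint: "\<And>a b c.
      (\<Sum>k\<in>UNIV. C c k a * gstar u p k b) = (\<Sum>k\<in>UNIV. gstar u p a k * C c k b)"
proof -
  let ?R = "invariants W"
  have "\<forall>i. \<exists>U. irreducible_summand W U \<and> p i \<in> coord_ring B U"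
    using adapted by (simp add: adapted_def)
  then obtain U where U: "\<And>i. irreducible_summand W (U i)" and pU: "\<And>i. p i \<in> coord_ring B (U i)"
    by metis
  define I where "I i = {j. p j \<in> coord_ring B (U i)}" for i
  have I_iff: "j \<in> I i \<longleftrightarrow> U j = U i" for i j
    unfolding I_def using irreducible_summand_unique[OF U U pU] pU by (metis mem_Collect_eq)
  have I_eq: "U i = U j \<Longrightarrow> I i = I j" for i j by (simp add: I_def)
  have R: "?R = subalg UNIV" by (simp add: subalg_UNIV)
  note blocks = frob[unfolded frobenius_mult_def Let_def, THEN conjunct2, THEN spec, THEN mp, OF U, folded I_def]
  define S where "S i = ?R \<inter> coord_ring B (U i)" for i
  have "\<forall>i. \<exists>mulU. irreducible_frobenius_mult (S i) (I i) u p mulU \<and>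
      (\<forall>a\<in>I i. \<forall>b\<in>I i. mul (coord_field p ?R a) (coord_field p ?R b) =
        (\<Sum>k\<in>I i. mulU (coord_field p (S i) a) (coord_field p (S i) b) (p k) \<odot> coord_field p ?R k))"
    unfolding S_def using blocks[THEN conjunct1] ..
  from choice[OF this] obtain mulU where mulU_all: "\<forall>i. irreducible_frobenius_mult (S i) (I i) u p (mulU i) \<and>
      (\<forall>a\<in>I i. \<forall>b\<in>I i. mul (coord_field p ?R a) (coord_field p ?R b) =
        (\<Sum>k\<in>I i. mulU i (coord_field p (S i) a) (coord_field p (S i) b) (p k) \<odot> coord_field p ?R k))" ..
  then have irr: "irreducible_frobenius_mult (S i) (I i) u p (mulU i)" for i by blast
  have mulU: "mul (coord_field p ?R a) (coord_field p ?R b) =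
        (\<Sum>k\<in>I i. mulU i (coord_field p (S i) a) (coord_field p (S i) b) (p k) \<odot> coord_field p ?R k)"
    if "a \<in> I i" "b \<in> I i" for i a b
    using mulU_all that by blast
  define CU where "CU i a b k = mulU i (coord_field p (S i) a) (coord_field p (S i) b) (p k)" for i a b k
  have CU: "C a b l = (if l \<in> I i then CU i a b l else 0)" if "a \<in> I i" "b \<in> I i" for i a b l
  proof -
    have "C a b l = (\<Sum>k\<in>I i. CU i a b k * (if k = l then 1 else 0))"
      unfolding C_def mulU[OF that] sum_vfield_apply smul_def coord_field_p[OF R UNIV_I] CU_def ..
    then show ?thesis by (simp add: if_distrib cong: if_cong)
  qed
  have zero: "C a b k = 0" if "U a \<noteq> U b" for a b k
  proof -
    have "b \<notin> I a" "a \<in> I a" using that I_iff by auto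
    then have "mul (coord_field p ?R a) (coord_field p ?R b) = 0"
      using blocks[of a, THEN conjunct2] by blast
    then show ?thesis by (simp add: C_def)
  qed
  have zero': "C a b k = 0" if "U k \<noteq> U a" for a b k
    using zero[of a b k] CU[of a a b k] that I_iff by auto
  have zero'': "C a b k = 0" if "U k \<noteq> U b" for a b k
    using zero[of a b k] zero'[of k a b] that by metis
  have A: "S i = subalg (I i)" for i
    unfolding S_def I_def by (rule subalg_summand[OF adapted U pU])
  note irr_comm = irreducible_frobenius_comm[OF A irr, folded CU_def]
    and irr_assoc = irreducible_frobenius_assoc[OF A irr, folded CU_def]
    and irr_unit = irreducible_frobenius_unit[OF A irr, folded CU_def]
    and irr_adjoint = irreducible_frobenius_adjoint[OF A irr, folded CU_def]

  show comm: "C i j k = C j i k" for i j k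
  proof (cases "U i = U j")
    case True
    then have "i \<in> I i" "j \<in> I i" by (simp_all add: I_iff)
    then show ?thesis using irr_comm by (simp add: CU)
  qed (simp add: zero)

  have restrict: "(\<Sum>a\<in>UNIV. f a) = (\<Sum>a\<in>I i. f a)" if "\<And>a. U a \<noteq> U i \<Longrightarrow> f a = 0" for f :: "'n \<Rightarrow> 'n cpoly" and i
    using that by (intro sum.mono_neutral_right) (auto simp: I_iff)

  show "(\<Sum>a\<in>UNIV. C i j a * C a k l) = (\<Sum>a\<in>UNIV. C j k a * C i a l)" for i j k l
  proof (cases "U j = U i \<and> U k = U i \<and> U l = U i")
    case True
    then have mem: "i \<in> I i" "j \<in> I i" "k \<in> I i" "l \<in> I i" by (simp_all add: I_iff)
    have "(\<Sum>a\<in>UNIV. C i j a * C a k l) = (\<Sum>a\<in>I i. C i j a * C a k l)"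
      by (rule restrict) (simp add: zero')
    also have "\<dots> = (\<Sum>a\<in>I i. CU i i j a * CU i a k l)"
      using mem by (intro sum.cong refl) (simp add: CU[of _ i])
    also have "\<dots> = (\<Sum>a\<in>I i. CU i j k a * CU i i a l)" by (rule irr_assoc)
    also have "\<dots> = (\<Sum>a\<in>I i. C j k a * C i a l)"
      using mem by (intro sum.cong refl) (simp add: CU[of _ i])
    also have "\<dots> = (\<Sum>a\<in>UNIV. C j k a * C i a l)"
      by (rule restrict[symmetric]) (use True zero' in simp)
    finally show ?thesis .
  next
    case False
    have "C i j a * C a k l = 0" for a
      using False zero zero' zero'' by (metis mult_zero_left mult_zero_right)
    moreover have "C j k a * C i a l = 0" for a
      using False zero zero' zero'' by (metis mult_zero_left mult_zero_right)
    ultimately show ?thesis by simp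
  qed

  \<comment> \<open>The choice is made for each block and not for each index, so that indices of the
    same summand receive the same unit.\<close>
  have "\<forall>I\<in>range I. \<exists>m\<in>I. \<forall>j\<in>I. \<forall>k. C m j k = (if j = k then 1 else 0)"
  proof
    fix J assume "J \<in> range I"
    then obtain i where i: "J = I i" by blast
    obtain m where m: "m \<in> I i" "\<And>j k. j \<in> I i \<Longrightarrow> k \<in> I i \<Longrightarrow> CU i m j k = (if j = k then 1 else 0)"
      using irr_unit[of i] by blast
    then show "\<exists>m\<in>J. \<forall>j\<in>J. \<forall>k. C m j k = (if j = k then 1 else 0)"
      unfolding i by (intro bexI[of _ m]) (auto simp: CU[of _ i])
  qed
  then obtain m where m: "\<And>i. m (I i) \<in> I i"
      "\<And>i j k. j \<in> I i \<Longrightarrow> C (m (I i)) j k = (if j = k then 1 else 0)"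
    by (metis rangeI)
  show "\<exists>N. N \<noteq> {} \<and> (\<forall>j k. (\<Sum>i\<in>N. C i j k) = (if j = k then 1 else 0))"
  proof (intro exI[of _ "m ` range I"] conjI allI)
    fix j k
    have "C x j k = 0" if x: "x \<in> m ` range I" "x \<noteq> m (I j)" for x
    proof (rule zero)
      obtain i where "x = m (I i)" using x(1) by blast
      then show "U x \<noteq> U j" using m(1)[of i] x(2) I_eq[of i j] by (auto simp: I_iff)
    qed
    then have "(\<Sum>i\<in>m ` range I. C i j k) = (\<Sum>i\<in>{m (I j)}. C i j k)"
      by (intro sum.mono_neutral_right) auto
    then show "(\<Sum>i\<in>m ` range I. C i j k) = (if j = k then 1 else 0)"
      using m(2)[of j j k] by (simp add: I_iff)
  qed simp

  show "(\<Sum>k\<in>UNIV. C c k a * gstar u p k b) = (\<Sum>k\<in>UNIV. gstar u p a k * C c k b)" for a b c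
  proof -
    have gs: "gstar u p i j = 0" if "U i \<noteq> U j" for i j
      using gstar_orthogonal[OF U U that pU pU] .
    have L: "(\<Sum>k\<in>UNIV. C c k a * gstar u p k b) = (\<Sum>k\<in>I c. C c k a * gstar u p k b)"
      by (rule restrict) (use zero in \<open>metis mult_zero_left\<close>)
    have R: "(\<Sum>k\<in>UNIV. gstar u p a k * C c k b) = (\<Sum>k\<in>I c. gstar u p a k * C c k b)"
      by (rule restrict) (use zero in \<open>metis mult_zero_right\<close>)
    show ?thesis
    proof (cases "U a = U c \<and> U b = U c")
      case True
      then have mem: "a \<in> I c" "b \<in> I c" "c \<in> I c" by (simp_all add: I_iff)
      have "(\<Sum>k\<in>I c. C c k a * gstar u p k b) = (\<Sum>k\<in>I c. CU c c k a * gstar u p k b)"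
        using mem by (intro sum.cong refl) (simp add: CU[of _ c])
      also have "\<dots> = (\<Sum>k\<in>I c. gstar u p a k * CU c c k b)"
        by (rule irr_adjoint[OF mem(1,2)])
      also have "\<dots> = (\<Sum>k\<in>I c. gstar u p a k * C c k b)"
        using mem by (intro sum.cong refl) (simp add: CU[of _ c])
      finally show ?thesis unfolding L R .
    next
      case False
      have "C c k a * gstar u p k b = 0" if "k \<in> I c" for k
        using False that zero'[of a c k] gs[of k b] by (metis I_iff mult_zero_left mult_zero_right)
      moreover have "gstar u p a k * C c k b = 0" if "k \<in> I c" for k
        using False that zero'[of b c k] gs[of a k] by (metis I_iff mult_zero_left mult_zero_right)
      ultimately show ?thesis unfolding L R by simp
    qed
  qed
qed

section \<open>The tangent map at the origin and generically\<close>

text \<open>The linear part of an invariant is a \<open>W\<close>-invariant linear form, hence 0 as \<open>V\<^sup>W = 0\<close>.\<close>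

lemma const_coeff_dirder_invariant:
  assumes f: "f \<in> invariants W"
  shows "const_coeff (dirder v f) = 0"
proof -
  define L where "L v = const_coeff (dirder v f)" for v
  have L_W: "L (w *v v) = L v" if "w \<in> W" for w v
  proof -
    have "dirder v f = pullback w (dirder (w *v v) f)"
      using dirder_pullback[of v w f] f that by (simp add: invariants_def)
    then show ?thesis by (simp add: L_def const_coeff_pullback)
  qed
  have L_lin: "L (x + y) = L x + L y" "L (c *\<^sub>R x) = of_real c * L x" for x y c
    by (simp_all add: L_def dirder_plus dirder_scale const_coeff_add const_coeff_mult const_coeff_cnst)
  \<comment> \<open>The inner product represents an invariant functional by a vector
    \<open>a\<close>, which is then fixed by \<open>W\<close>.\<close>
  have 0: "l = (\<lambda>v. 0)" if lin: "linear l" and inv: "\<And>w v. w \<in> W \<Longrightarrow> l (w *v v) = l v" for l :: "real^'n \<Rightarrow> real"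
  proof -
    define a where "a = (\<Sum>k\<in>UNIV. l (u k) *\<^sub>R u k)"
    have l: "l x = B a x" for x
    proof -
      have "l x = l (\<Sum>k\<in>UNIV. B (u k) x *\<^sub>R u k)" by (simp flip: frame_expansion)
      then show ?thesis using lin by (simp add: a_def B_left linear_sum linear_scale mult.commute)
    qed
    have "a = 0"
    proof (rule W_fixed)
      fix w assume w: "w \<in> W"
      then obtain w' where w': "w' \<in> W" "w ** w' = mat 1" using W_inverse by blast
      have "B (w *v a) x = B a x" for x
      proof -
        have x: "x = w *v (w' *v x)" by (simp add: matrix_vector_mul_assoc w')
        have "B (w *v a) x = B a (w' *v x)" using B_inv[OF w, of a "w' *v x"] x by simp
        then show ?thesis using inv[OF w'(1), of x] by (simp add: l)
      qed
      then have "B (w *v a - a) (w *v a - a) = 0" by (simp add: B_left)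
      then show "w *v a = a" by (simp add: B_self_eq_0)
    qed
    then show ?thesis by (auto simp: l B_left)
  qed
  \<comment> \<open>The absence of fixed vectors is known on the real space, so real and imaginary
    part are treated separately.\<close>
  have "(\<lambda>v. Re (L v)) = (\<lambda>v. 0)"
    by (rule 0) (auto simp: L_W L_lin intro!: linearI)
  moreover have "(\<lambda>v. Im (L v)) = (\<lambda>v. 0)"
    by (rule 0) (auto simp: L_W L_lin intro!: linearI)
  ultimately have "L v = 0" by (simp add: complex_eq_iff fun_eq_iff)
  then show ?thesis by (simp add: L_def)
qed

lemma tangent_map_inj:
  assumes "X \<in> DerS" "Y \<in> DerS" "tangent_map p X = tangent_map p Y"
  shows "X = Y"
  using assms by (intro DerS_eq_if_eq_on_p) (simp_all add: tangent_map_eq vec_eq_iff)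

text \<open>The cokernel of \<open>tp\<close> is killed by \<open>common_denominator\<close>. This
  supplies fields on which a supposed unit can be tested.\<close>

lemma tangent_map_generically_surj:
  "\<exists>X\<in>DerS. tangent_map p X = common_denominator *s v"
proof -
  obtain Z where Z: "jacobian ** Z = mat common_denominator" using jacobian_inverse by blast
  define X where "X = (\<lambda>f. \<Sum>k\<in>UNIV. (Z *v v) $ k * dirder (u k) f)"
  have "X \<in> DerS" unfolding X_def by (intro DerS_sum_smul dirder_DerS)
  have "X (p i) = (jacobian *v (Z *v v)) $ i" for i
    by (simp add: X_def jacobian_def matrix_vector_mult_def[of "\<chi> i l. dirder (u l) (p i)"] mult.commute)
  also have "(jacobian *v (Z *v v)) $ i = common_denominator * v $ i" for i
    unfolding matrix_vector_mul_assoc Z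
    by (simp add: matrix_vector_mult_def mat_def if_distrib[of "\<lambda>c. c * _"] cong: if_cong)
  finally have "tangent_map p X = common_denominator *s v"
    using \<open>X \<in> DerS\<close> by (simp add: tangent_map_eq vec_eq_iff)
  then show ?thesis using \<open>X \<in> DerS\<close> by blast
qed

lemma const_coeff_tangent_map:
  assumes "X \<in> DerS" shows "const_coeff (tangent_map p X $ i) = 0"
proof -
  have "tangent_map p X $ i = (\<Sum>k\<in>UNIV. X (lf (u k)) * dirder (u k) (p i))"
    using assms by (simp add: tangent_map_eq flip: frame_derivation)
  then show ?thesis
    by (simp add: const_coeff_sum const_coeff_mult const_coeff_dirder_invariant p_invariant)
qed

end

section \<open>The product and the module structure on vector fields\<close>

theorem proposition2p3:
  fixes W :: "(real^'n^'n::finite) set"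
    and B :: "real^'n \<Rightarrow> real^'n \<Rightarrow> real"
    and u :: "'n \<Rightarrow> real^'n"
    and p :: "'n \<Rightarrow> 'n cpoly"
    and mul :: "'n vfield \<Rightarrow> 'n vfield \<Rightarrow> 'n vfield"
  assumes "coxeter_group W"
    and "invariant_inner_product W B" and "orthonormal B u"
    and "basic_invariants W p" and "adapted W B p"
    and "frobenius_mult W B u p mul"
  shows
    "(\<exists>star.
        bilinear_on UNIV DerS UNIV DerS DerS star \<and>
        commutative_on DerS star \<and> associative_on DerS star \<and>
        (\<nexists>\<epsilon>. is_unit_on DerS star \<epsilon>) \<and>
        (\<forall>\<eta>1\<in>DerS. \<forall>\<eta>2\<in>DerS. \<forall>\<theta>1\<in>DerR W. \<forall>\<theta>2\<in>DerR W.
           lift_of p \<eta>1 \<theta>1 \<and> lift_of p \<eta>2 \<theta>2 \<longrightarrow>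
           tangent_map p (star \<eta>1 \<eta>2) = omega_map p (mul \<theta>1 \<theta>2)))
     \<and>
     (\<exists>act.
        bilinear_on (invariants W) (DerR W) UNIV DerS DerS act \<and>
        (\<forall>\<theta>\<in>DerR W. \<forall>\<xi>\<in>DerR W. \<forall>\<eta>\<in>DerS. act (mul \<theta> \<xi>) \<eta> = act \<theta> (act \<xi> \<eta>)) \<and>
        (\<exists>\<epsilon>. is_unit_on (DerR W) mul \<epsilon> \<and> (\<forall>\<eta>\<in>DerS. act \<epsilon> \<eta> = \<eta>)) \<and>
        (\<forall>\<theta>\<in>DerR W. \<forall>\<xi>\<in>DerR W. \<forall>\<eta>\<in>DerS. lift_of p \<eta> \<xi> \<longrightarrow>
           tangent_map p (act \<theta> \<eta>) = omega_map p (mul \<theta> \<xi>)) \<and>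
        (\<forall>\<theta>\<in>DerR W. \<forall>\<eta>\<in>DerS.
           tangent_map p (act \<theta> \<eta>) =
           extended_mult (invariants W) p mul (omega_map p \<theta>) (tangent_map p \<eta>)))"
proof -
  interpret coxeter_frame W B u p
    by unfold_locales (use assms in auto)
  let ?R = "invariants W"
  have R: "?R = subalg UNIV" by (simp add: subalg_UNIV)
  let ?d = "coord_field p ?R" and ?tp = "tangent_map p" and ?om = "omega_map p"
  define C where "C i j k = mul (?d i) (?d j) (p k)" for i j k
  define ext where "ext = extended_mult ?R p mul"
  note C_comm = frobenius_mult_comm[OF assms(5,6), folded C_def]
    and C_assoc = frobenius_mult_assoc[OF assms(5,6), folded C_def]
    and C_unit = frobenius_mult_unit[OF assms(5,6), folded C_def]
    and C_adjoint = frobenius_mult_adjoint[OF assms(5,6), folded C_def]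
  have ext_nth: "ext s t $ k = (\<Sum>i\<in>UNIV. \<Sum>j\<in>UNIV. s $ i * t $ j * C i j k)" for s t k
    by (simp add: ext_def extended_mult_def C_def omega_map_def)
  have ext_comm: "ext s t = ext t s" for s t
    unfolding vec_eq_iff ext_nth by (subst sum.swap) (simp add: C_comm[of _ _] mult_ac)
  have ext_add: "ext s (t + t') = ext s t + ext s t'" and ext_scale: "ext s (a *s t) = a *s ext s t" for s t t' a
    unfolding vec_eq_iff vector_add_component vector_smult_component ext_nth
    by (simp_all add: algebra_simps sum.distrib sum_distrib_left)
  have ext_add': "ext (t + t') s = ext t s + ext t' s" and ext_scale': "ext (a *s t) s = a *s ext t s" for s t t' a
    unfolding ext_comm[of _ s] by (rule ext_add, rule ext_scale)
  have ext_assoc: "ext (ext s t) r = ext s (ext t r)" for s t r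
  proof -
    have "ext (ext s t) r $ l = ext s (ext t r) $ l" for l
    proof -
      have "ext (ext s t) r $ l =
          (\<Sum>a\<in>UNIV. \<Sum>k\<in>UNIV. \<Sum>i\<in>UNIV. \<Sum>j\<in>UNIV. s $ i * t $ j * r $ k * (C i j a * C a k l))"
        by (simp add: ext_nth sum_distrib_left sum_distrib_right mult_ac)
      also have "\<dots> = (\<Sum>k\<in>UNIV. \<Sum>a\<in>UNIV. \<Sum>i\<in>UNIV. \<Sum>j\<in>UNIV. s $ i * t $ j * r $ k * (C i j a * C a k l))"
        by (rule sum.swap)
      also have "\<dots> = (\<Sum>k\<in>UNIV. \<Sum>i\<in>UNIV. \<Sum>a\<in>UNIV. \<Sum>j\<in>UNIV. s $ i * t $ j * r $ k * (C i j a * C a k l))"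
        by (intro sum.cong refl sum.swap)
      also have "\<dots> = (\<Sum>k\<in>UNIV. \<Sum>i\<in>UNIV. \<Sum>j\<in>UNIV. \<Sum>a\<in>UNIV. s $ i * t $ j * r $ k * (C i j a * C a k l))"
        by (intro sum.cong refl sum.swap)
      also have "\<dots> = (\<Sum>k\<in>UNIV. \<Sum>i\<in>UNIV. \<Sum>j\<in>UNIV. \<Sum>a\<in>UNIV. s $ i * t $ j * r $ k * (C j k a * C i a l))"
        by (simp only: sum_distrib_left[symmetric] C_assoc)
      also have "\<dots> = (\<Sum>i\<in>UNIV. \<Sum>k\<in>UNIV. \<Sum>j\<in>UNIV. \<Sum>a\<in>UNIV. s $ i * t $ j * r $ k * (C j k a * C i a l))"
        by (rule sum.swap)
      also have "\<dots> = (\<Sum>i\<in>UNIV. \<Sum>k\<in>UNIV. \<Sum>a\<in>UNIV. \<Sum>j\<in>UNIV. s $ i * t $ j * r $ k * (C j k a * C i a l))"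
        by (intro sum.cong refl sum.swap)
      also have "\<dots> = (\<Sum>i\<in>UNIV. \<Sum>a\<in>UNIV. \<Sum>k\<in>UNIV. \<Sum>j\<in>UNIV. s $ i * t $ j * r $ k * (C j k a * C i a l))"
        by (intro sum.cong refl sum.swap)
      also have "\<dots> = (\<Sum>i\<in>UNIV. \<Sum>a\<in>UNIV. \<Sum>j\<in>UNIV. \<Sum>k\<in>UNIV. s $ i * t $ j * r $ k * (C j k a * C i a l))"
        by (intro sum.cong refl sum.swap)
      also have "\<dots> = ext s (ext t r) $ l"
        by (simp add: ext_nth sum_distrib_left sum_distrib_right mult_ac)
      finally show ?thesis .
    qed
    then show ?thesis by (simp add: vec_eq_iff)
  qed
  obtain N where N: "N \<noteq> {}" "\<And>j k. (\<Sum>i\<in>N. C i j k) = (if j = k then 1 else 0)"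
    using C_unit by blast
  \<comment> \<open>The unit of Der_R, in coordinates.\<close>
  define e :: "('n cpoly)^'n" where "e = (\<chi> i. if i \<in> N then 1 else 0)"
  have ext_e: "ext e t = t" for t
  proof -
    have "ext e t $ k = (\<Sum>i\<in>N. \<Sum>j\<in>UNIV. t $ j * C i j k)" for k
    proof -
      have "ext e t $ k = (\<Sum>i\<in>UNIV. if i \<in> N then (\<Sum>j\<in>UNIV. t $ j * C i j k) else 0)"
        unfolding ext_nth by (intro sum.cong refl) (simp add: e_def)
      then show ?thesis by (simp add: sum.If_cases)
    qed
    also have "(\<Sum>i\<in>N. \<Sum>j\<in>UNIV. t $ j * C i j k) = (\<Sum>j\<in>UNIV. t $ j * (\<Sum>i\<in>N. C i j k))" for k
      by (subst sum.swap) (simp add: sum_distrib_left)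
    finally show ?thesis by (simp add: N(2) vec_eq_iff if_distrib cong: if_cong)
  qed
  have ext_e': "ext t e = t" for t using ext_e ext_comm by metis

  \<comment> \<open>Self-adjointness is \<open>S\<close>-linear in \<open>s\<close>. Hence
    multiplication by every element of the extended module lifts, which gives both the product on
    Der_S and the action of Der_R.\<close>
  have lifts: "\<exists>D'. D' \<in> DerS \<and> ?tp D' = ext s (?tp D)" if D: "D \<in> DerS" for s D
  proof -
    define M where "M i k = (\<Sum>c\<in>UNIV. s $ c * C c k i)" for i k
    have "(\<Sum>k\<in>UNIV. M a k * gstar u p k b) = (\<Sum>k\<in>UNIV. gstar u p a k * M b k)" for a b
    proof -
      have "(\<Sum>k\<in>UNIV. M a k * gstar u p k b) = (\<Sum>c\<in>UNIV. s $ c * (\<Sum>k\<in>UNIV. C c k a * gstar u p k b))"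
        unfolding M_def sum_distrib_right sum_distrib_left by (subst sum.swap) (simp add: mult.assoc)
      also have "\<dots> = (\<Sum>c\<in>UNIV. s $ c * (\<Sum>k\<in>UNIV. gstar u p a k * C c k b))"
        by (simp only: C_adjoint)
      also have "\<dots> = (\<Sum>k\<in>UNIV. gstar u p a k * M b k)"
        unfolding M_def sum_distrib_right sum_distrib_left by (subst sum.swap) (simp add: mult.left_commute)
      finally show ?thesis .
    qed
    then obtain D' where D': "D' \<in> DerS" "\<And>i. D' (p i) = (\<Sum>k\<in>UNIV. M i k * D (p k))"
      using selfadjoint_lifts[of M D] D by blast
    have "?tp D' $ i = ext s (?tp D) $ i" for i
    proof -
      have "?tp D' $ i = (\<Sum>k\<in>UNIV. \<Sum>c\<in>UNIV. s $ c * D (p k) * C c k i)"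
        using D' by (simp add: tangent_map_eq M_def sum_distrib_left sum_distrib_right mult_ac)
      also have "\<dots> = ext s (?tp D) $ i"
        using D by (subst sum.swap) (simp add: ext_nth tangent_map_eq)
      finally show ?thesis .
    qed
    then show ?thesis using D'(1) by (auto simp: vec_eq_iff)
  qed
  \<comment> \<open>The lift is unique because \<open>tp\<close> is injective, so all algebraic
    identities for \<open>opr\<close> are checked after applying \<open>tp\<close>.\<close>
  define opr where "opr s D = (SOME D'. D' \<in> DerS \<and> ?tp D' = ext s (?tp D))" for s D
  have opr: "opr s D \<in> DerS" "?tp (opr s D) = ext s (?tp D)" if "D \<in> DerS" for s D
    using someI_ex[OF lifts[OF that]] by (simp_all add: opr_def)
  have opr_add: "opr (s + t) D = opr s D + opr t D"
    and opr_scale: "opr (a *s s) D = a \<odot> opr s D"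
    and opr_ext: "opr (ext s t) D = opr s (opr t D)"
    and opr_e: "opr e D = D" if "D \<in> DerS" for s t a D
    using that
    by (auto intro!: tangent_map_inj DerS_plus DerS_smul opr
        simp: opr tangent_map_plus tangent_map_smul ext_add' ext_scale' ext_assoc ext_e)
  have opr_add': "opr s (D + D') = opr s D + opr s D'"
    and opr_scale': "opr s (a \<odot> D) = a \<odot> opr s D" if "D \<in> DerS" "D' \<in> DerS" for s a D D'
    using that
    by (auto intro!: tangent_map_inj DerS_plus DerS_smul opr
        simp: opr tangent_map_plus tangent_map_smul ext_add ext_scale DerS_plus DerS_smul)
  have opr_comm: "opr (?tp D) D' = opr (?tp D') D" if "D \<in> DerS" "D' \<in> DerS" for D D'
    using that ext_comm by (auto intro!: tangent_map_inj opr simp: opr)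

  have bil: "bilinear_on ?R (DerR W) ?R (DerR W) (DerR W) mul"
    using assms(6) by (simp add: frobenius_mult_def Let_def)
  then have lin1: "linear_on ?R (DerR W) (DerR W) (\<lambda>X. mul X Y)"
    and lin2: "linear_on ?R (DerR W) (DerR W) (mul Y)" if "Y \<in> DerR W" for Y
    using that by (auto simp: bilinear_on_def)
  have mul_Der: "mul X Y \<in> DerR W" if "X \<in> DerR W" "Y \<in> DerR W" for X Y
    using lin2[OF that(1)] that(2) by (simp add: linear_on_def)
  note der = coord_field_Der[OF R]
  have om_mul: "?om (mul X Y) = ext (?om X) (?om Y)" if X: "X \<in> DerR W" and Y: "Y \<in> DerR W" for X Y
  proof -
    have Xp: "X (p i) \<in> ?R" and Yp: "Y (p i) \<in> ?R" for i
      using Der_closed[OF X p_invariant] Der_closed[OF Y p_invariant] by auto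
    have 1: "mul X Y = (\<Sum>i\<in>UNIV. X (p i) \<odot> mul (?d i) Y)"
      using linear_on_sum[OF R lin1[OF Y], of UNIV "\<lambda>i. X (p i)" ?d] Xp der
      by (simp flip: Der_coord_expansion[OF R X])
    have 2: "mul (?d i) Y = (\<Sum>j\<in>UNIV. Y (p j) \<odot> mul (?d i) (?d j))" for i
      using linear_on_sum[OF R lin2[OF der], of UNIV "\<lambda>i. Y (p i)" ?d] Yp der
      by (simp flip: Der_coord_expansion[OF R Y])
    show ?thesis
      unfolding 1 2
      by (simp add: vec_eq_iff ext_nth omega_map_def sum_vfield_apply smul_def C_def
          sum_distrib_left mult.assoc)
  qed
  have om_inj: "X = Y" if "X \<in> DerR W" "Y \<in> DerR W" "?om X = ?om Y" for X Y
    using that by (intro Der_eqI[OF R]) (simp_all add: omega_map_def vec_eq_iff)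
  define \<epsilon> where "\<epsilon> = (\<Sum>i\<in>N. ?d i)"
  have \<epsilon>: "\<epsilon> \<in> DerR W" unfolding \<epsilon>_def by (intro Der_sum[OF R] der)
  have om_\<epsilon>: "?om \<epsilon> = e"
    by (simp add: \<epsilon>_def e_def omega_map_def sum_vfield_apply coord_field_p[OF R] vec_eq_iff)
  have unit: "is_unit_on (DerR W) mul \<epsilon>"
    unfolding is_unit_on_def
    using \<epsilon> by (auto intro!: om_inj mul_Der simp: om_mul om_\<epsilon> ext_e ext_e')

  have no_unit: "\<not> is_unit_on DerS (\<lambda>D. opr (?tp D)) \<delta>" for \<delta>
  proof
    assume \<delta>: "is_unit_on DerS (\<lambda>D. opr (?tp D)) \<delta>"
    then have "\<delta> \<in> DerS" by (simp add: is_unit_on_def)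
    \<comment> \<open>A unit \<delta> must fix this field; cancelling the denominator yields
      \<open>?tp \<delta> = e\<close>, whose value at the origin is not 0.\<close>
    obtain D where D: "D \<in> DerS" "?tp D = common_denominator *s e"
      using tangent_map_generically_surj by blast
    have "opr (?tp \<delta>) D = D" using \<delta> D by (simp add: is_unit_on_def)
    then have "ext (?tp \<delta>) (?tp D) = ?tp D" using opr(2)[OF D(1)] by metis
    then have "common_denominator *s ?tp \<delta> = common_denominator *s e"
      by (simp add: D ext_scale ext_e')
    then have "common_denominator * ?tp \<delta> $ k = common_denominator * e $ k" for k
      by (metis vector_smult_component)
    then have "?tp \<delta> $ k = e $ k" for k
      by (rule cpoly_mult_cancel_left) (rule common_denominator_neq_0)
    moreover obtain k where "k \<in> N" using N(1) by blast
    ultimately have "const_coeff (?tp \<delta> $ k) = 1"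
      using const_coeff_cnst[of 1] by (simp add: e_def)
    then show False using const_coeff_tangent_map[OF \<open>\<delta> \<in> DerS\<close>] by simp
  qed

  show ?thesis
  proof (rule conjI[OF exI[of _ "\<lambda>D. opr (?tp D)"] exI[of _ "\<lambda>\<theta>. opr (?om \<theta>)"]]; intro conjI exI[of _ \<epsilon>])
    show "bilinear_on UNIV DerS UNIV DerS DerS (\<lambda>D. opr (?tp D))"
      by (auto simp: bilinear_on_def linear_on_def opr tangent_map_plus tangent_map_smul
          opr_add opr_scale opr_add' opr_scale')
    show "commutative_on DerS (\<lambda>D. opr (?tp D))"
      by (simp add: commutative_on_def opr_comm)
    show "associative_on DerS (\<lambda>D. opr (?tp D))"
      by (simp add: associative_on_def opr opr_ext)
    show "\<nexists>\<epsilon>. is_unit_on DerS (\<lambda>D. opr (?tp D)) \<epsilon>"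
      using no_unit by blast
    show "\<forall>\<eta>1\<in>DerS. \<forall>\<eta>2\<in>DerS. \<forall>\<theta>1\<in>DerR W. \<forall>\<theta>2\<in>DerR W.
        lift_of p \<eta>1 \<theta>1 \<and> lift_of p \<eta>2 \<theta>2 \<longrightarrow> ?tp (opr (?tp \<eta>1) \<eta>2) = ?om (mul \<theta>1 \<theta>2)"
      by (simp add: lift_of_def opr om_mul)
    show "bilinear_on ?R (DerR W) UNIV DerS DerS (\<lambda>\<theta>. opr (?om \<theta>))"
      by (auto simp: bilinear_on_def linear_on_def opr omega_map_plus omega_map_smul
          opr_add opr_scale opr_add' opr_scale')
    show "\<forall>\<theta>\<in>DerR W. \<forall>\<xi>\<in>DerR W. \<forall>\<eta>\<in>DerS. opr (?om (mul \<theta> \<xi>)) \<eta> = opr (?om \<theta>) (opr (?om \<xi>) \<eta>)"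
      by (simp add: om_mul opr_ext)
    show "is_unit_on (DerR W) mul \<epsilon>" by (rule unit)
    show "\<forall>\<eta>\<in>DerS. opr (?om \<epsilon>) \<eta> = \<eta>" by (simp add: om_\<epsilon> opr_e)
    show "\<forall>\<theta>\<in>DerR W. \<forall>\<xi>\<in>DerR W. \<forall>\<eta>\<in>DerS. lift_of p \<eta> \<xi> \<longrightarrow>
        ?tp (opr (?om \<theta>) \<eta>) = ?om (mul \<theta> \<xi>)"
      by (simp add: lift_of_def opr om_mul)
    show "\<forall>\<theta>\<in>DerR W. \<forall>\<eta>\<in>DerS.
        ?tp (opr (?om \<theta>) \<eta>) = extended_mult ?R p mul (?om \<theta>) (?tp \<eta>)"
      by (simp add: opr flip: ext_def)
  qed
qed

end
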